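(* Let $a,b\in\mathbb{R}$ and consider the linear neutral delay differential equation $$y'(t)-y'(t-1)+a\,y(t)+b\,y(t-1)=0,\quad t>0,$$ with characteristic equation $\lambda(e^\lambda-1)+a\,e^\lambda+b=0$, $\lambda\in\mathbb{C}$, whose roots are denoted $\lambda_n$. The stability of the solution $y=0$ is as follows. Open quadrants (only one is asymptotically stable, the others are unstable): - if $a>|b|$: asymptotic stability, and $\Re(\lambda_n)<0$ for all $n$; - if $b>|a|$: instability, and $\Re(\lambda_n)>0$ for all $n$; - if $b<-|a|$: instability, and $\Re(\lambda_n)>0$ for all roots except one root, which has $\Re(\lambda)<0$; - if $-a>|b|$: instability, and $\Re(\lambda_n)<0$ for all roots except one root, which has $\Re(\lambda)>0$. Edges: - if $a=|b|\neq 0$: stability, and $\Re(\lambda_n)=0$ for all roots, except one root $\lambda=-a<0$ if $b<0$; - if $a=b>0$: stability, and $\Re(\lambda_n)=0$ for all $n$; - if $a=-b<0$: instability, and $\Re(\lambda_n)=0$ for all roots except one positive root $\lambda=-a$. Origin: - if $a=b=0$: weak instability, i.e. $\Re(\lambda_n)=0$ for all roots, all roots being simple except $0$, which has multiplicity $2$.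
   Context: Characteristic roots are the $\lambda\in\mathbb{C}$ such that $y(t)=e^{\lambda t}$ solves the equation; there are countably many. Solutions $y\in H^1_{loc}((-1,+\infty))$ are those with initial data $y=y_0\in H^1((-1,0))$ on $(-1,0)$. Stability, asymptotic stability and instability of $y=0$ have their usual (Lyapunov) meaning with respect to the initial datum $y_0$. *)

theory Defs
  imports "HOL-Complex_Analysis.Complex_Analysis"
begin

(* Sobolev spaces on an open set I of reals, for complex-valued functions.
   Elements are represented by functions up to equality almost everywhere; all notions below are
   invariant under changing a function on a null set. *)

definition L2_on :: "real set \<Rightarrow> (real \<Rightarrow> complex) \<Rightarrow> bool" where
  "L2_on I u \<longleftrightarrow>
     set_borel_measurable lebesgue I u \<and> set_integrable lebesgue I (\<lambda>x. (norm (u x))\<^sup>2)"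

definition L1_loc :: "real set \<Rightarrow> (real \<Rightarrow> complex) \<Rightarrow> bool" where
  "L1_loc I u \<longleftrightarrow> (\<forall>K. compact K \<and> K \<subseteq> I \<longrightarrow> set_integrable lebesgue K u)"

definition test_function :: "real set \<Rightarrow> (real \<Rightarrow> real) \<Rightarrow> bool" where
  "test_function I \<phi> \<longleftrightarrow>
     \<phi> C1_differentiable_on UNIV \<and> (\<exists>K. compact K \<and> K \<subseteq> I \<and> (\<forall>x. x \<notin> K \<longrightarrow> \<phi> x = 0))"

(* Test functions of class C^1 with compact support; by mollification this gives the same weak
   derivatives as smooth test functions. Local integrability is required explicitly because the
   Bochner integral of a non-integrable function is 0 by convention. *)
definition has_weak_deriv :: "real set \<Rightarrow> (real \<Rightarrow> complex) \<Rightarrow> (real \<Rightarrow> complex) \<Rightarrow> bool" where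
  "has_weak_deriv I u g \<longleftrightarrow> L1_loc I u \<and> L1_loc I g \<and>
     (\<forall>\<phi>. test_function I \<phi> \<longrightarrow>
        (LINT x:I|lebesgue. deriv \<phi> x *\<^sub>R u x) = - (LINT x:I|lebesgue. \<phi> x *\<^sub>R g x))"

(* A weak derivative is unique up to a null set; this picks a representative. *)
definition weak_deriv :: "real set \<Rightarrow> (real \<Rightarrow> complex) \<Rightarrow> real \<Rightarrow> complex" where
  "weak_deriv I u = (SOME g. has_weak_deriv I u g)"

definition H1_on :: "real set \<Rightarrow> (real \<Rightarrow> complex) \<Rightarrow> bool" where
  "H1_on I u \<longleftrightarrow> L2_on I u \<and> (\<exists>g. has_weak_deriv I u g \<and> L2_on I g)"

definition H1_loc :: "real set \<Rightarrow> (real \<Rightarrow> complex) \<Rightarrow> bool" where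
  "H1_loc I u \<longleftrightarrow>
     (\<exists>g. has_weak_deriv I u g \<and> (\<forall>K. compact K \<and> K \<subseteq> I \<longrightarrow> L2_on K u \<and> L2_on K g))"

definition H1_norm :: "real set \<Rightarrow> (real \<Rightarrow> complex) \<Rightarrow> real" where
  "H1_norm I u =
     sqrt ((LINT x:I|lebesgue. (norm (u x))\<^sup>2) + (LINT x:I|lebesgue. (norm (weak_deriv I u x))\<^sup>2))"

(* y solves y'(t) - y'(t-1) + a y(t) + b y(t-1) = 0 for t > 0 with initial datum y0 on (-1,0).
   Continuity of y at 0 is part of membership in H1_loc. *)
definition ndde_solution ::
  "real \<Rightarrow> real \<Rightarrow> (real \<Rightarrow> complex) \<Rightarrow> (real \<Rightarrow> complex) \<Rightarrow> bool" where
  "ndde_solution a b y0 y \<longleftrightarrow>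
     H1_on {-1<..<0} y0 \<and> H1_loc {-1<..} y \<and>
     (AE t in lebesgue. -1 < t \<and> t < 0 \<longrightarrow> y t = y0 t) \<and>
     (AE t in lebesgue. t > 0 \<longrightarrow>
        weak_deriv {-1<..} y t - weak_deriv {-1<..} y (t - 1)
          + complex_of_real a * y t + complex_of_real b * y (t - 1) = 0)"

(* The state at time t is the history segment y(t + s), s in (-1,0), measured in H^1((-1,0));
   at t = 0 it is the initial datum. *)
definition state_norm :: "(real \<Rightarrow> complex) \<Rightarrow> real \<Rightarrow> real" where
  "state_norm y t = H1_norm {-1<..<0} (\<lambda>s. y (t + s))"

definition lyapunov_stable :: "real \<Rightarrow> real \<Rightarrow> bool" where
  "lyapunov_stable a b \<longleftrightarrow>
     (\<forall>\<epsilon>>0. \<exists>\<delta>>0. \<forall>y0 y. ndde_solution a b y0 y \<and> H1_norm {-1<..<0} y0 < \<delta> \<longrightarrow>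
        (\<forall>t\<ge>0. state_norm y t < \<epsilon>))"

definition asymptotically_stable :: "real \<Rightarrow> real \<Rightarrow> bool" where
  "asymptotically_stable a b \<longleftrightarrow> lyapunov_stable a b \<and>
     (\<exists>\<delta>>0. \<forall>y0 y. ndde_solution a b y0 y \<and> H1_norm {-1<..<0} y0 < \<delta> \<longrightarrow>
        (state_norm y \<longlongrightarrow> 0) at_top)"

definition unstable :: "real \<Rightarrow> real \<Rightarrow> bool" where
  "unstable a b \<longleftrightarrow> \<not> lyapunov_stable a b"

definition char_fun :: "real \<Rightarrow> real \<Rightarrow> complex \<Rightarrow> complex" where
  "char_fun a b z = z * (exp z - 1) + complex_of_real a * exp z + complex_of_real b"

definition char_roots :: "real \<Rightarrow> real \<Rightarrow> complex set" where
  "char_roots a b = {z. char_fun a b z = 0}"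

lemma char_roots_iff_exp_solution:
  fixes a b :: real and z :: complex
  defines "y \<equiv> \<lambda>t::real. exp (z * of_real t)"
  shows "z \<in> char_roots a b \<longleftrightarrow>
    (\<forall>t>0. vector_derivative y (at t) - vector_derivative y (at (t - 1))
            + of_real a * y t + of_real b * y (t - 1) = 0)"
proof -
  have d: "vector_derivative y (at t) = z * y t" for t
    unfolding y_def
    by (rule vector_derivative_at)
       (auto intro!: derivative_eq_intros has_vector_derivative_real_field)
  have s: "y t = exp z * y (t - 1)" for t
    by (simp add: y_def algebra_simps flip: exp_add)
  have "vector_derivative y (at t) - vector_derivative y (at (t - 1))
          + of_real a * y t + of_real b * y (t - 1) = char_fun a b z * y (t - 1)" for t
    unfolding d s[of t] char_fun_def by (simp add: algebra_simps)
  moreover have "y t \<noteq> 0" for t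
    by (simp add: y_def)
  ultimately show ?thesis
    by (auto simp: char_roots_def intro: exI[of _ 1])
qed

end

theory Submission
  imports Defs
begin

text \<open>
  A number \<open>z\<close> is a characteristic root iff \<open>exp z (z + a) = z - b\<close>, and
  \<open>\<bar>z + a\<bar>\<^sup>2 - \<bar>z - b\<bar>\<^sup>2 = (a + b) (2 Re z + a - b)\<close>; comparing moduli locates the roots
  when \<open>a > \<bar>b\<bar>\<close>, and \<open>z \<mapsto> - z\<close> exchanges \<open>a\<close> and \<open>b\<close>. If \<open>- a > \<bar>b\<bar>\<close>, two roots in the right
  half-plane are incompatible because
  \<open>exp (- z) - exp (- w) = - (a + b) (z - w) / ((z - b) (w - b))\<close>, where the modulus equation
  makes the right-hand side larger than the left one.

  Instability is witnessed by \<open>exp (z t)\<close> for a root with \<open>Re z > 0\<close> (such roots exist near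
  \<open>2\<pi>ki\<close>), and by \<open>y t = t\<close> when \<open>a = b = 0\<close>. Stability follows from an energy which is monotone
  along classical solutions. Averaging over \<open>[t, t + h]\<close> turns a weak solution into a classical one
  and converges to it in \<open>H\<^sup>1\<close> as \<open>h\<close> tends to \<open>0\<close>, so the estimate carries over. For
  \<open>a > \<bar>b\<bar>\<close> the dissipation makes the solution square integrable; then the averaged solutions
  decay, and by linearity and stability they are uniformly close to the original one.
\<close>

subsection \<open>Characteristic roots\<close>

text \<open>The root equation can be written \<open>exp z = 1 - (a + b) / (z + a)\<close>, so roots
  of large modulus near \<open>2\<pi>ki\<close> approach the imaginary axis. Even if all roots lie
  in the open left half-plane there is no spectral gap, and their location alone does not give
  stability; hence the energy. It comes from the same algebra as the roots: the equation says that
  \<open>z' + a z\<close> at time \<open>t\<close> equals \<open>z' - b z\<close> at time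
  \<open>t - 1\<close>, and the modulus identity, with \<open>z'\<close> in place of root times
  \<open>z\<close>, turns the difference of the two squares into a time derivative plus a term of
  fixed sign. The equation is neutral, so solutions gain no regularity with time: \<open>z'\<close>
  stays merely square integrable and the energy cannot be differentiated pointwise. Averaging cures
  this because it commutes with an autonomous linear equation. If \<open>a + b = 0\<close>, the
  energy does not contain the value of \<open>z\<close> at all, which is why \<open>z\<close> has to
  be bounded separately through the damping \<open>a > 0\<close>.\<close>

lemma char_root_iff:
  "z \<in> char_roots a b \<longleftrightarrow> exp z * (z + of_real a) = z - of_real b"
  by (auto simp: char_roots_def char_fun_def algebra_simps add_eq_0_iff)

text \<open>This is time reversal: if \<open>y\<close> satisfies the equation on the whole line,
  then \<open>t \<mapsto> y (- t)\<close> satisfies the one with \<open>a\<close> and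
  \<open>b\<close> interchanged.\<close>

lemma char_root_minus_iff: "- z \<in> char_roots b a \<longleftrightarrow> z \<in> char_roots a b"
proof -
  have "exp (- z) * (- z + of_real b) = - z - of_real a \<longleftrightarrow>
        exp z * (exp (- z) * (- z + of_real b)) = exp z * (- z - of_real a)"
    by simp
  also have "exp z * (exp (- z) * (- z + of_real b)) = - z + of_real b"
    by (simp add: exp_minus)
  finally show ?thesis
    by (auto simp: char_root_iff algebra_simps)
qed

lemma norm_shift_diff:
  fixes z :: complex and a b :: real
  shows "(norm (z + a))\<^sup>2 - (norm (z - b))\<^sup>2 = (a + b) * (2 * Re z + (a - b))"
  unfolding cmod_power2 by (simp add: power2_eq_square algebra_simps)

lemma char_root_norm_eq:
  assumes "z \<in> char_roots a b"
  shows "exp (2 * Re z) * (norm (z + a))\<^sup>2 = (norm (z - b))\<^sup>2"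
proof -
  have "norm (z - b) = norm (exp z * (z + a))"
    using assms by (simp add: char_root_iff)
  then show ?thesis
    by (simp add: norm_mult power_mult_distrib flip: exp_double)
qed

text \<open>In the closed right half-plane both effects push the left side of the modulus equation
  up: the exponential is at least 1, and \<open>z + a\<close> is longer than \<open>z - b\<close>.
  As \<open>a - b > 0\<close>, the second inequality is strict even on the imaginary axis.\<close>

lemma char_root_Re_neg:
  assumes "a > \<bar>b\<bar>" "z \<in> char_roots a b"
  shows "Re z < 0"
proof (rule ccontr)
  assume "\<not> Re z < 0"
  then have s: "Re z \<ge> 0" by simp
  have "(a + b) * (2 * Re z + (a - b)) > 0"
    using assms(1) s by (intro mult_pos_pos) auto
  then have "(norm (z + a))\<^sup>2 > (norm (z - b))\<^sup>2"
    using norm_shift_diff[of z a b] by linarith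
  moreover have "exp (2 * Re z) * (norm (z + a))\<^sup>2 \<ge> 1 * (norm (z + a))\<^sup>2"
    using s by (intro mult_right_mono) auto
  ultimately show False using char_root_norm_eq[OF assms(2)] by linarith
qed

text \<open>For \<open>a = b\<close> the difference of the squared moduli has the sign of
  \<open>Re z\<close>, as has \<open>exp (2 * Re z) - 1\<close>, so neither sign is possible. Only
  one half-plane needs an argument, because the root set is now symmetric under negation.\<close>

lemma char_root_Re_eq_0:
  assumes "a > 0" "z \<in> char_roots a a"
  shows "Re z = 0"
proof -
  have *: "Re z \<ge> 0" if "z \<in> char_roots a a" for z
  proof (rule ccontr)
    assume "\<not> Re z \<ge> 0"
    then have s: "Re z < 0" by simp
    have "(norm (z + a))\<^sup>2 < (norm (z - a))\<^sup>2"
      using norm_shift_diff[of z a a] mult_pos_neg[of "2 * a" "2 * Re z"] s assms(1) by auto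
    moreover have "exp (2 * Re z) * (norm (z + a))\<^sup>2 \<le> 1 * (norm (z + a))\<^sup>2"
      using s by (intro mult_right_mono) auto
    ultimately show False using char_root_norm_eq[OF that] by linarith
  qed
  show ?thesis
    using *[OF assms(2)] *[of "- z"] assms(2) char_root_minus_iff[of z a a] by auto
qed

section \<open>The function \<open>sinh s / s\<close> and uniqueness of the root in the right
  half-plane\<close>

lemma sinh_le_mult_cosh:
  assumes "x \<ge> (0::real)"
  shows "sinh x \<le> x * cosh x"
proof -
  have "0 * cosh 0 - sinh 0 \<le> x * cosh x - sinh x"
    using assms
  proof (rule DERIV_nonneg_imp_nondecreasing)
    fix u :: real assume "0 \<le> u"
    then show "\<exists>d. ((\<lambda>x. x * cosh x - sinh x) has_real_derivative d) (at u) \<and> 0 \<le> d"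
      by (intro exI[of _ "u * sinh u"] conjI) (auto intro!: derivative_eq_intros)
  qed
  then show ?thesis by simp
qed

lemma sinh_over_self_mono:
  assumes "0 < x" "x \<le> (y::real)"
  shows "sinh x / x \<le> sinh y / y"
  using assms(2)
proof (rule DERIV_nonneg_imp_nondecreasing)
  fix u assume "x \<le> u" "u \<le> y"
  then have "u > 0" using assms by simp
  then show "\<exists>d. ((\<lambda>x. sinh x / x) has_real_derivative d) (at u) \<and> 0 \<le> d"
    using sinh_le_mult_cosh[of u]
    by (intro exI[of _ "(cosh u * u - sinh u) / (u * u)"] conjI)
       (auto intro!: derivative_eq_intros simp: mult.commute)
qed

lemma sinh_over_self_ge_1:
  assumes "0 < (x::real)"
  shows "1 \<le> sinh x / x"
  using real_le_x_sinh[of x] assms by (simp add: sinh_field_def exp_minus)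

text \<open>Taking out the midpoint factor \<open>exp (- (z + w) / 2)\<close> leaves twice the
  hyperbolic sine of \<open>(w - z) / 2\<close>, and the squared modulus of \<open>sinh\<close> at
  \<open>x + iy\<close> is the sum of the squares of \<open>sinh x\<close> and
  \<open>sin y\<close>.\<close>

lemma norm_exp_diff_squared:
  fixes z w :: complex
  shows "(norm (exp (- z) - exp (- w)))\<^sup>2 =
    4 * exp (- Re z - Re w) * ((sinh ((Re w - Re z) / 2))\<^sup>2 + (sin ((Im w - Im z) / 2))\<^sup>2)"
proof -
  define M where "M = exp (- (Re z + Re w) / 2)"
  define x where "x = (Re w - Re z) / 2"
  have P: "exp (- Re z) = M * exp x" and Q: "exp (- Re w) = M * exp (- x)"
    by (simp_all add: M_def x_def field_simps flip: exp_add)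
  have PQ: "exp (- Re z - Re w) = M * M"
    by (simp add: M_def field_simps flip: exp_add)
  have "(norm (exp (- z) - exp (- w)))\<^sup>2 =
      (exp (- Re z) * cos (Im z) - exp (- Re w) * cos (Im w))\<^sup>2 +
      (exp (- Re z) * sin (Im z) - exp (- Re w) * sin (Im w))\<^sup>2"
    unfolding cmod_power2 by (simp add: Re_exp Im_exp power2_commute)
  also have "\<dots> = (exp (- Re z))\<^sup>2 * ((cos (Im z))\<^sup>2 + (sin (Im z))\<^sup>2)
      + (exp (- Re w))\<^sup>2 * ((cos (Im w))\<^sup>2 + (sin (Im w))\<^sup>2)
      - 2 * exp (- Re z) * exp (- Re w) * cos (Im w - Im z)"
    unfolding cos_diff by algebra
  also have "cos (Im w - Im z) = 1 - 2 * (sin ((Im w - Im z) / 2))\<^sup>2"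
  proof -
    define t where "t = (Im w - Im z) / 2"
    then have "Im w - Im z = 2 * t" by simp
    then show ?thesis using cos_double_sin[of t] by simp
  qed
  also have "(exp (- Re z))\<^sup>2 * ((cos (Im z))\<^sup>2 + (sin (Im z))\<^sup>2)
      + (exp (- Re w))\<^sup>2 * ((cos (Im w))\<^sup>2 + (sin (Im w))\<^sup>2)
      - 2 * exp (- Re z) * exp (- Re w) * (1 - 2 * (sin ((Im w - Im z) / 2))\<^sup>2)
      = (exp (- Re z) - exp (- Re w))\<^sup>2 +
        4 * (exp (- Re z) * exp (- Re w)) * (sin ((Im w - Im z) / 2))\<^sup>2"
    unfolding sin_cos_squared_add sin_cos_squared_add2 by (simp add: power2_eq_square algebra_simps)
  also have "(exp (- Re z) - exp (- Re w))\<^sup>2 = 4 * (M * M) * (sinh x)\<^sup>2"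
    unfolding P Q by (simp add: sinh_field_def power2_eq_square algebra_simps)
  also have "exp (- Re z) * exp (- Re w) = M * M"
    unfolding P Q by (simp add: field_simps flip: exp_add)
  finally show ?thesis
    unfolding PQ x_def by (simp add: algebra_simps)
qed

text \<open>Solving the modulus equation for \<open>n\<close>, the square of
  \<open>norm (z - b)\<close>, gives
  \<open>n * (1 - exp (- (2 * s))) = (- a - b) * (2 * s + (a - b))\<close>; dropping the negative
  \<open>a - b\<close> yields the bound. The shape with \<open>sinh s / s\<close> is the one that,
  multiplied over two roots, meets the estimate of \<open>exp (- z) - exp (- w)\<close>. The case
  \<open>z = b\<close> is impossible since it would force \<open>z = - a\<close> as well.\<close>

lemma char_root_norm_bound:
  assumes "- a > \<bar>b\<bar>" "z \<in> char_roots a b" "Re z \<ge> 0"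
  shows "Re z > 0" "(norm (z - b))\<^sup>2 * (exp (- Re z) * (sinh (Re z) / Re z)) < - a - b"
    "z \<noteq> b"
proof -
  define s where "s = Re z"
  define n where "n = (norm (z - b))\<^sup>2"
  have "(norm (z + a))\<^sup>2 = n + (a + b) * (2 * s + (a - b))"
    using norm_shift_diff[of z a b] by (simp add: s_def n_def)
  then have n: "exp (2 * s) * (n + (a + b) * (2 * s + (a - b))) = n"
    using char_root_norm_eq[OF assms(2)] by (simp add: s_def n_def)
  have "a - b < 0" "a + b < 0" using assms(1) by auto
  show "z \<noteq> b"
  proof
    assume "z = b"
    then have "z + a = 0"
      using assms(2) by (simp add: char_root_iff)
    then have "b + a = (0::real)"
      using \<open>z = b\<close> by (metis of_real_0 of_real_add of_real_eq_iff)
    then show False using \<open>a + b < 0\<close> by simp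
  qed
  then have "n > 0" by (simp add: n_def)
  have "s \<noteq> 0"
    using n \<open>a - b < 0\<close> \<open>a + b < 0\<close> by auto
  then have s: "s > 0" using assms(3) s_def by simp
  then show "Re z > 0" by (simp add: s_def)
  have "exp (- (2 * s)) * n = n + (a + b) * (2 * s + (a - b))"
    using n by (simp add: exp_minus field_simps)
  then have "n * (1 - exp (- (2 * s))) = (- a - b) * (2 * s + (a - b))"
    by (simp add: algebra_simps)
  also have "\<dots> < (- a - b) * (2 * s)"
    using \<open>a - b < 0\<close> \<open>a + b < 0\<close> by (intro mult_strict_left_mono) auto
  also have "1 - exp (- (2 * s)) = 2 * exp (- s) * sinh s"
    by (simp add: sinh_field_def right_diff_distrib mult.assoc flip: exp_add)
  finally have "n * (exp (- s) * sinh s) < (- a - b) * s" by simp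
  then show "(norm (z - b))\<^sup>2 * (exp (- Re z) * (sinh (Re z) / Re z)) < - a - b"
    using s by (simp add: n_def s_def field_simps)
qed

text \<open>The two root equations give an exact value for
  \<open>norm (exp (- z) - exp (- w))\<close> times the moduli of \<open>z - b\<close> and
  \<open>w - b\<close>. Bounding the difference of exponentials by \<open>norm (z - w)\<close> times
  the weights of the two roots, and then using the strict bound for each root, makes the same
  quantity strictly smaller.\<close>

lemma char_root_unique_aux:
  assumes ab: "- a > \<bar>b\<bar>" and z: "z \<in> char_roots a b" "Re z \<ge> 0"
    and w: "w \<in> char_roots a b" "Re w \<ge> 0" and le: "Re z \<le> Re w"
  shows "z = w"
proof (rule ccontr)
  assume "z \<noteq> w"
  note zb = char_root_norm_bound[OF ab z] and wb = char_root_norm_bound[OF ab w]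
  define x where "x = (Re w - Re z) / 2"
  define y where "y = (Im w - Im z) / 2"
  define S where "S = (\<lambda>s::real. sinh s / s)"
  define n where "n = (norm (z - b))\<^sup>2"
  define m where "m = (norm (w - b))\<^sup>2"
  have S1: "S (Re z) \<ge> 1" "S (Re w) \<ge> 1"
    unfolding S_def using sinh_over_self_ge_1 zb(1) wb(1) by blast+
  have nm: "n > 0" "m > 0" using zb(3) wb(3) by (auto simp: n_def m_def)
  have "Re w - Re z = 2 * x" "Im w - Im z = 2 * y"
    by (simp_all add: x_def y_def)
  then have "(norm (z - w))\<^sup>2 = (2 * x)\<^sup>2 + (2 * y)\<^sup>2"
    unfolding cmod_power2 by (simp add: power2_commute[of "Re z"] power2_commute[of "Im z"])
  then have xy: "x\<^sup>2 + y\<^sup>2 > 0" "(norm (z - w))\<^sup>2 = 4 * (x\<^sup>2 + y\<^sup>2)"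
    using \<open>z \<noteq> w\<close> by (auto simp: sum_power2_gt_zero_iff complex_eq_iff power_mult_distrib)
  have "x \<ge> 0" using le by (simp add: x_def)
  \<comment> \<open>Half-angle step: \<open>sinh x \<le> x * cosh x\<close> and
    \<open>sinh (2 * x) = 2 * sinh x * cosh x\<close> produce \<open>S (2 * x)\<close>. Since
    \<open>2 * x = Re w - Re z\<close> is at most \<open>Re w\<close>, monotonicity of
    \<open>S\<close> finishes; this uses \<open>Re z > 0\<close> and the ordering of the real
    parts.\<close>
  have "(sinh x)\<^sup>2 \<le> x\<^sup>2 * S (Re w)"
  proof (cases "x = 0")
    case False
    then have "x > 0" using \<open>x \<ge> 0\<close> by simp
    have "sinh x * sinh x \<le> sinh x * (x * cosh x)"
      using sinh_le_mult_cosh[OF \<open>x \<ge> 0\<close>] \<open>x \<ge> 0\<close> by (intro mult_left_mono) auto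
    also have "\<dots> = x\<^sup>2 * S (2 * x)"
      using \<open>x > 0\<close> by (simp add: S_def sinh_double power2_eq_square)
    also have "\<dots> \<le> x\<^sup>2 * S (Re w)"
      unfolding S_def using \<open>x > 0\<close> zb(1)
      by (intro mult_left_mono sinh_over_self_mono) (auto simp: x_def)
    finally show ?thesis by (simp add: power2_eq_square)
  qed auto
  moreover have "(sin y)\<^sup>2 \<le> y\<^sup>2 * S (Re w)"
  proof -
    have "(sin y)\<^sup>2 \<le> y\<^sup>2 * 1"
      using abs_sin_x_le_abs_x[of y] by (simp add: abs_le_square_iff)
    also have "\<dots> \<le> y\<^sup>2 * S (Re w)" using S1 by (intro mult_left_mono) auto
    finally show ?thesis .
  qed
  ultimately have "(sinh x)\<^sup>2 + (sin y)\<^sup>2 \<le> (x\<^sup>2 + y\<^sup>2) * S (Re w)" by (simp add: algebra_simps)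
  \<comment> \<open>The factor \<open>S (Re z) \<ge> 1\<close> is inserted so that each root
    contributes its own weight and the two root bounds can be multiplied.\<close>
  also have "\<dots> \<le> (x\<^sup>2 + y\<^sup>2) * S (Re w) * S (Re z)"
    using mult_left_mono[OF S1(1), of "(x\<^sup>2 + y\<^sup>2) * S (Re w)"] xy S1 by auto
  finally have le1: "(sinh x)\<^sup>2 + (sin y)\<^sup>2 \<le> (x\<^sup>2 + y\<^sup>2) * (S (Re w) * S (Re z))" by (simp add: ac_simps)
  have ez: "exp (- z) * (z - b) = z + a" and ew: "exp (- w) * (w - b) = w + a"
    using z(1) w(1) by (auto simp: char_root_iff exp_minus field_simps)
  have "(exp (- z) - exp (- w)) * ((z - b) * (w - b)) =
      (exp (- z) * (z - b)) * (w - b) - (exp (- w) * (w - b)) * (z - b)"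
    by (simp add: algebra_simps)
  also have "\<dots> = of_real (- a - b) * (z - w)"
    unfolding ez ew by (simp add: algebra_simps)
  finally have "(norm ((exp (- z) - exp (- w)) * ((z - b) * (w - b))))\<^sup>2 = (norm (of_real (- a - b) * (z - w)))\<^sup>2"
    by simp
  then have "(norm (exp (- z) - exp (- w)))\<^sup>2 * (n * m) = (- a - b)\<^sup>2 * (4 * (x\<^sup>2 + y\<^sup>2))"
    unfolding norm_mult power_mult_distrib norm_of_real power2_abs xy(2) n_def m_def by simp
  moreover have "(norm (exp (- z) - exp (- w)))\<^sup>2 * (n * m) \<le>
      4 * exp (- Re z - Re w) * ((x\<^sup>2 + y\<^sup>2) * (S (Re w) * S (Re z))) * (n * m)"
    unfolding norm_exp_diff_squared x_def[symmetric] y_def[symmetric]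
    using le1 nm by (intro mult_right_mono mult_left_mono) auto
  moreover have "4 * exp (- Re z - Re w) * ((x\<^sup>2 + y\<^sup>2) * (S (Re w) * S (Re z))) * (n * m) =
      (4 * (x\<^sup>2 + y\<^sup>2)) * ((n * (exp (- Re z) * S (Re z))) * (m * (exp (- Re w) * S (Re w))))"
    by (simp add: exp_diff exp_minus field_simps)
  moreover have "(4 * (x\<^sup>2 + y\<^sup>2)) * ((n * (exp (- Re z) * S (Re z))) * (m * (exp (- Re w) * S (Re w))))
      < (4 * (x\<^sup>2 + y\<^sup>2)) * ((- a - b) * (- a - b))"
  proof (intro mult_strict_left_mono mult_strict_mono)
    show "n * (exp (- Re z) * S (Re z)) < - a - b" "m * (exp (- Re w) * S (Re w)) < - a - b"
      using zb(2) wb(2) by (simp_all add: n_def m_def S_def)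
    show "0 \<le> m * (exp (- Re w) * S (Re w))"
      using nm S1 by (intro mult_nonneg_nonneg) auto
  qed (use ab xy in auto)
  ultimately show False by (simp add: power2_eq_square algebra_simps)
qed

lemma char_root_unique:
  assumes "- a > \<bar>b\<bar>" "z \<in> char_roots a b" "Re z \<ge> 0" "w \<in> char_roots a b" "Re w \<ge> 0"
  shows "z = w"
  using char_root_unique_aux[of b a z w] char_root_unique_aux[of b a w z] assms linear by metis

section \<open>Existence of roots\<close>

lemma char_root_pos_real:
  assumes "- a > \<bar>b\<bar>"
  obtains x :: real where "x > 0" "complex_of_real x \<in> char_roots a b"
proof -
  define f where "f = (\<lambda>x::real. x * (exp x - 1) + a * exp x + b)"
  have "\<forall>x. 0 \<le> x \<and> x \<le> 1 - a \<longrightarrow> isCont f x" by (auto simp: f_def intro!: continuous_intros)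
  moreover have "f 0 \<le> 0" using assms by (auto simp: f_def)
  \<comment> \<open>The endpoint is chosen so that \<open>x + a = 1\<close>, which turns
    \<open>f x = (x + a) * exp x - x + b\<close> into \<open>exp (1 - a) - (1 - a) + b\<close>. The
    quadratic Taylor term beats \<open>- b\<close> because \<open>(1 + a)^2 \<ge> 0\<close> means
    \<open>(1 - a)^2 \<ge> - 4 * a\<close>.\<close>
  moreover have "f (1 - a) \<ge> 0"
  proof -
    have "exp (1 - a) \<ge> 1 + (1 - a) + (1 - a)\<^sup>2 / 2"
      using assms by (intro exp_lower_Taylor_quadratic) auto
    moreover have "(1 - a)\<^sup>2 \<ge> - 4 * a"
      using zero_le_power2[of "1 + a"] by (simp add: power2_eq_square algebra_simps)
    moreover have "f (1 - a) = exp (1 - a) - (1 - a) + b"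
      by (simp add: f_def algebra_simps)
    ultimately show ?thesis using assms by linarith
  qed
  ultimately obtain x where x: "0 \<le> x" "x \<le> 1 - a" "f x = 0"
    using IVT[of f 0 0 "1 - a"] assms by (auto simp: abs_less_iff)
  have "x \<noteq> 0" using x(3) assms by (auto simp: f_def)
  moreover have "char_fun a b x = of_real (f x)" by (simp add: char_fun_def f_def exp_of_real)
  ultimately show ?thesis using that[of x] x by (auto simp: char_roots_def)
qed

text \<open>Brouwer's theorem applies to \<open>z \<mapsto> 2\<pi>ki + Ln ((z - b) / (z + a))\<close> on a unit disc, for large \<open>k\<close>.\<close>

lemma char_root_nonreal:
  obtains z where "z \<in> char_roots a b" "Im z > 0"
proof -
  obtain k :: nat where "max 1 (2 * (1 + \<bar>a\<bar> + \<bar>a + b\<bar>) + 1) < real k"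
    using reals_Archimedean2 by blast
  then have k: "2 * (1 + \<bar>a\<bar> + \<bar>a + b\<bar>) + 1 < real k" "1 < real k" by (simp_all only: max_less_iff_conj)
  define c where "c = \<i> * of_real (2 * pi * k)"
  \<comment> \<open>\<open>1 + q z\<close> is the quotient of \<open>z - b\<close> by
    \<open>z + a\<close>. The size of \<open>k\<close> forces \<open>norm (q z) < 1 / 2\<close> on
    the disc, so that the logarithm has modulus at most \<open>2 * norm (q z) < 1\<close> and the
    map keeps the disc; \<open>k > 1\<close> keeps the disc away from the real axis.\<close>
  define q where "q = (\<lambda>z::complex. - of_real (a + b) / (z + of_real a))"
  have kc: "norm c > 2 * (1 + \<bar>a\<bar> + \<bar>a + b\<bar>) + 1"
  proof -
    have "norm c = 2 * pi * k" by (simp add: c_def norm_mult)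
    moreover have "2 * pi * k \<ge> 1 * real k" using pi_gt3 by (intro mult_right_mono) auto
    ultimately show ?thesis using k(1) by linarith
  qed
  have za: "norm (z + a) > 1 + \<bar>a\<bar> + 2 * \<bar>a + b\<bar>" if "z \<in> cball c 1" for z
  proof -
    have "norm c \<le> norm (z + a) + norm (c - z) + norm (complex_of_real a)"
      using norm_triangle_ineq[of "z + a + (c - z)" "- of_real a"] norm_triangle_ineq[of "z + a" "c - z"]
      by (simp add: algebra_simps)
    moreover have "norm (c - z) \<le> 1" using that by (simp add: dist_norm)
    ultimately show ?thesis using kc by simp
  qed
  have za0: "z + of_real a \<noteq> 0" if "z \<in> cball c 1" for z
    using za[OF that] add_pos_nonneg[of 1 "\<bar>a\<bar> + 2 * \<bar>a + b\<bar>"] by auto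
  have q: "norm (q z) < 1 / 2" if "z \<in> cball c 1" for z
  proof -
    have "0 < norm (z + a)" "2 * \<bar>a + b\<bar> < norm (z + a)" using za[OF that] abs_ge_zero[of a] abs_ge_zero[of "a + b"] by (auto simp del: abs_ge_zero)
    then show ?thesis by (simp add: q_def norm_divide divide_simps flip: of_real_add)
  qed
  have "continuous_on (cball c 1) (\<lambda>z. c + Ln (1 + q z))"
  proof (intro continuous_intros)
    fix z assume z: "z \<in> cball c 1"
    have "\<bar>Re (q z)\<bar> < 1 / 2" using q[OF z] abs_Re_le_cmod[of "q z"] by linarith
    then show "1 + q z \<notin> \<real>\<^sub>\<le>\<^sub>0" by (auto simp: complex_nonpos_Reals_iff)
  next
    show "continuous_on (cball c 1) q"
      unfolding q_def using za0 by (intro continuous_intros) auto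
  qed
  moreover have "(\<lambda>z. c + Ln (1 + q z)) \<in> cball c 1 \<rightarrow> cball c 1"
  proof
    fix z assume z: "z \<in> cball c 1"
    have "norm (Ln (1 + q z)) \<le> 2 * norm (q z)"
      using norm_Ln_le[of "q z"] q[OF z] by simp
    then show "c + Ln (1 + q z) \<in> cball c 1" using q[OF z] by (simp add: dist_norm)
  qed
  ultimately obtain z where z: "z \<in> cball c 1" "c + Ln (1 + q z) = z"
    using brouwer_ball[of 1 c "\<lambda>z. c + Ln (1 + q z)"] by auto
  have "q z \<noteq> - 1" using q[OF z(1)] by auto
  then have "1 + q z \<noteq> 0" by (simp add: add_eq_0_iff)
  then have "exp z = exp c * (1 + q z)" using z(2) by (metis exp_Ln exp_add)
  also have "exp c = 1" unfolding c_def using exp_eq_1 by (simp add: mult_ac)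
  finally have "exp z * (z + a) = z - b"
    using za0[OF z(1)] by (simp add: q_def divide_simps)
  moreover have "Im z > 0"
  proof -
    have "Im c = 2 * pi * k" by (simp add: c_def)
    moreover have "2 * pi * k \<ge> 1 * real k" using pi_gt3 by (intro mult_right_mono) auto
    moreover have "\<bar>Im c - Im z\<bar> \<le> 1" using z(1) abs_Im_le_cmod[of "c - z"] by (simp add: dist_norm)
    ultimately show ?thesis using k(2) by linarith
  qed
  ultimately show ?thesis using that by (simp add: char_root_iff)
qed

text \<open>This settles the edges with \<open>b = - a\<close> at once: besides \<open>- a\<close>
  only the imaginary zeros of \<open>exp z - 1\<close> remain, and for \<open>a = 0\<close> the two
  factors share the zero 0, which becomes double.\<close>

lemma char_fun_opposite: "char_fun a (- a) z = (z + a) * (exp z - 1)"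
  by (simp add: char_fun_def algebra_simps)

lemma exp_eq_1_imp_Re: "exp z = 1 \<Longrightarrow> Re z = 0"
  by (auto simp: exp_eq_1)

lemma zorder_char_fun_0:
  shows "zorder (char_fun 0 0) 0 = 2"
    and "z \<in> char_roots 0 0 - {0} \<Longrightarrow> zorder (char_fun 0 0) z = 1"
proof -
  have eq: "char_fun 0 0 = (\<lambda>z. z * (exp z - 1))" by (auto simp: char_fun_def)
  have d1: "deriv (\<lambda>z::complex. z * (exp z - 1)) = (\<lambda>z. exp z - 1 + z * exp z)"
    by (auto intro!: ext DERIV_imp_deriv derivative_eq_intros)
  have d2: "deriv (\<lambda>z::complex. exp z - 1 + z * exp z) = (\<lambda>z. 2 * exp z + z * exp z)"
    by (auto intro!: ext DERIV_imp_deriv derivative_eq_intros)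
  have "zorder (\<lambda>z::complex. z * (exp z - 1)) 0 = int 2"
  proof (rule zorder_zero_eqI[where S = UNIV])
    show "(deriv ^^ i) (\<lambda>z::complex. z * (exp z - 1)) 0 = 0" if "i < nat (int 2)" for i
      using that by (cases i) (auto simp: d1 less_Suc_eq)
  qed (auto simp: numeral_2_eq_2 d1 d2 intro!: holomorphic_intros)
  then show "zorder (char_fun 0 0) 0 = 2" by (simp add: eq)
  assume "z \<in> char_roots 0 0 - {0}"
  then have z: "exp z = 1" "z \<noteq> 0" by (auto simp: char_roots_def eq)
  have "zorder (\<lambda>z::complex. z * (exp z - 1)) z = int 1"
    by (rule zorder_zero_eqI[where S = UNIV]) (use z in \<open>auto simp: d1 intro!: holomorphic_intros\<close>)
  then show "zorder (char_fun 0 0) z = 1" by (simp add: eq)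
qed

subsection \<open>Weak derivatives\<close>

text \<open>Antiderivatives on the whole line turn integrals over moving windows into differences
  such as \<open>F t - F (t - 1)\<close>, so that estimates in time reduce to the signs of pointwise
  derivatives.\<close>

lemma continuous_antiderivative:
  fixes f :: "real \<Rightarrow> 'a::euclidean_space"
  assumes "continuous_on UNIV f"
  obtains F where "\<And>x. (F has_vector_derivative f x) (at x)"
proof -
  have "\<exists>F. \<forall>x. - \<infinity> < ereal x \<longrightarrow> ereal x < \<infinity> \<longrightarrow> (F has_vector_derivative f x) (at x)"
    using assms by (intro einterval_antiderivative) (auto simp: continuous_on_eq_continuous_within)
  then show ?thesis using that by auto
qed

lemma continuous_antiderivative_real:
  fixes f :: "real \<Rightarrow> real"
  assumes "continuous_on UNIV f"
  obtains F where "\<And>x. (F has_real_derivative f x) (at x)"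
  using continuous_antiderivative[OF assms] unfolding has_real_derivative_iff_has_vector_derivative by blast

lemma L1_loc_Icc: "L1_loc I u \<Longrightarrow> {p..q} \<subseteq> I \<Longrightarrow> set_integrable lebesgue {p..q} u"
  by (simp add: L1_loc_def)

lemma indicator_scaleR_support:
  assumes "K \<subseteq> I" "\<And>x. x \<notin> K \<Longrightarrow> (\<psi> x :: real) = 0"
  shows "indicator I x *\<^sub>R (\<psi> x *\<^sub>R u x) = \<psi> x *\<^sub>R (indicator K x *\<^sub>R (u x :: complex))"
  using assms by (auto simp: indicator_def)

text \<open>Dominated convergence needs \<open>u\<close> to be integrable on the common support
  \<open>K\<close> only, which is all that local integrability provides; off \<open>K\<close> the
  integrands vanish.\<close>

lemma lim_set_integral_scaleR:
  fixes \<psi> :: "nat \<Rightarrow> real \<Rightarrow> real" and u :: "real \<Rightarrow> complex"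
  assumes u: "set_integrable lebesgue K u" and K: "K \<subseteq> I"
    and m: "\<And>n. \<psi> n \<in> borel_measurable lebesgue"
    and supp: "\<And>n x. x \<notin> K \<Longrightarrow> \<psi> n x = 0"
    and bd: "\<And>n x. \<bar>\<psi> n x\<bar> \<le> B"
    and lim: "\<And>x. (\<lambda>n. \<psi> n x) \<longlonglongrightarrow> \<psi>' x"
  shows "(\<lambda>n. LINT x:I|lebesgue. \<psi> n x *\<^sub>R u x) \<longlonglongrightarrow> (LINT x:I|lebesgue. \<psi>' x *\<^sub>R u x)"
proof -
  have supp': "\<psi>' x = 0" if "x \<notin> K" for x
    using LIMSEQ_unique[OF lim[of x]] supp[OF that] by simp
  have [measurable]: "\<psi>' \<in> borel_measurable lebesgue"
    using lim m by (rule borel_measurable_LIMSEQ_real)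
  have [measurable]: "(\<lambda>x. indicator K x *\<^sub>R u x) \<in> borel_measurable lebesgue"
    using u by (simp add: set_integrable_def borel_measurable_integrable)
  note [measurable] = m
  have "(\<lambda>n. LINT x|lebesgue. \<psi> n x *\<^sub>R (indicator K x *\<^sub>R u x)) \<longlonglongrightarrow>
        (LINT x|lebesgue. \<psi>' x *\<^sub>R (indicator K x *\<^sub>R u x))"
  proof (rule integral_dominated_convergence[where w = "\<lambda>x. B * norm (indicator K x *\<^sub>R u x)"])
    show "integrable lebesgue (\<lambda>x. B * norm (indicator K x *\<^sub>R u x))"
      using u by (intro integrable_mult_right integrable_norm) (simp add: set_integrable_def)
    show "AE x in lebesgue. norm (\<psi> n x *\<^sub>R (indicator K x *\<^sub>R u x)) \<le> B * norm (indicator K x *\<^sub>R u x)" for n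
      unfolding norm_scaleR[of "\<psi> n _"] using bd[of n] by (intro AE_I2 mult_right_mono) auto
    show "AE x in lebesgue. (\<lambda>n. \<psi> n x *\<^sub>R (indicator K x *\<^sub>R u x)) \<longlonglongrightarrow> \<psi>' x *\<^sub>R (indicator K x *\<^sub>R u x)"
      using lim by (intro AE_I2 tendsto_intros)
  qed measurable
  moreover have "indicator I x *\<^sub>R (\<psi> n x *\<^sub>R u x) = \<psi> n x *\<^sub>R (indicator K x *\<^sub>R u x)" for n x
    using K supp by (rule indicator_scaleR_support)
  moreover have "indicator I x *\<^sub>R (\<psi>' x *\<^sub>R u x) = \<psi>' x *\<^sub>R (indicator K x *\<^sub>R u x)" for x
    using K supp' by (rule indicator_scaleR_support)
  ultimately show ?thesis
    unfolding set_lebesgue_integral_def by (simp only:)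
qed

text \<open>The Steklov means \<open>x \<mapsto> (\<Phi> (x + h) - \<Phi> x) / h\<close>, with \<open>\<Phi>\<close> an antiderivative of \<open>\<phi>\<close>, are
  admissible test functions, so that \<open>\<phi>\<close> itself only needs to be Lipschitz.\<close>

lemma weak_deriv_lipschitz_test:
  fixes \<phi> \<psi> :: "real \<Rightarrow> real"
  assumes w: "has_weak_deriv I u g" and I: "open I" "{\<alpha>..\<beta>} \<subseteq> I" "\<alpha> \<le> \<beta>"
    and lip: "\<And>x y. \<bar>\<phi> x - \<phi> y\<bar> \<le> L * \<bar>x - y\<bar>"
    and supp: "\<And>x. x \<notin> {\<alpha>..\<beta>} \<Longrightarrow> \<phi> x = 0"
    and lim: "\<And>x. (\<lambda>n. real (Suc n) * (\<phi> (x + inverse (real (Suc n))) - \<phi> x)) \<longlonglongrightarrow> \<psi> x"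
  shows "(LINT x:I|lebesgue. \<psi> x *\<^sub>R u x) = - (LINT x:I|lebesgue. \<phi> x *\<^sub>R g x)"
proof -
  have "\<alpha> \<in> I" using I by auto
  then obtain e where e: "e > 0" "ball \<alpha> e \<subseteq> I" using I(1) openE by blast
  obtain m where m: "inverse (real (Suc m)) < e" using reals_Archimedean[OF e(1)] by blast
  define h where "h n = inverse (real (Suc (n + m)))" for n
  have h: "h n > 0" "h n \<le> h 0" "h n < e" for n
  proof -
    show "h n > 0" by (simp add: h_def)
    show "h n \<le> h 0" by (simp add: h_def)
    moreover have "h 0 < e" using m by (simp add: h_def)
    ultimately show "h n < e" by linarith
  qed
  \<comment> \<open>A forward mean at \<open>x\<close> sees \<open>\<phi>\<close> on
    \<open>{x..x + h}\<close>, so its support grows to the left only. The index shift in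
    \<open>h\<close> keeps the enlarged interval inside the open set.\<close>
  define K where "K = {\<alpha> - h 0..\<beta>}"
  have KI: "K \<subseteq> I"
  proof
    fix x assume "x \<in> K"
    then have "x \<in> ball \<alpha> e \<or> x \<in> {\<alpha>..\<beta>}" using h(3)[of 0] by (auto simp: K_def dist_real_def)
    then show "x \<in> I" using e I by blast
  qed
  have L: "L \<ge> 0" using lip[of 0 1] by auto
  have cont: "continuous_on UNIV \<phi>"
    using lip L by (intro lipschitz_on_continuous_on[of L] lipschitz_onI) (auto simp: dist_real_def)
  then obtain \<Phi> where \<Phi>: "\<And>x. (\<Phi> has_real_derivative \<phi> x) (at x)"
    using continuous_antiderivative_real by blast
  define s where "s n x = (\<Phi> (x + h n) - \<Phi> x) / h n" for n x
  define s' where "s' n x = (\<phi> (x + h n) - \<phi> x) / h n" for n x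
  have s': "(s n has_real_derivative s' n x) (at x)" for n x
    unfolding s_def[abs_def] s'_def
    using less_imp_neq[OF h(1)[of n]]
    by (auto intro!: derivative_eq_intros DERIV_chain2[OF \<Phi>] \<Phi>)
  \<comment> \<open>A mean is a value of \<open>\<phi>\<close> at an intermediate point. Support,
    bound and uniform convergence of \<open>s n\<close> all follow from this.\<close>
  have mvt: "\<exists>c. x < c \<and> c < x + h n \<and> s n x = \<phi> c" for n x
  proof -
    have "\<exists>c. x < c \<and> c < x + h n \<and> \<Phi> (x + h n) - \<Phi> x = (x + h n - x) * \<phi> c"
      using h(1)[of n] \<Phi> by (intro MVT2) auto
    then show ?thesis using h(1)[of n] by (auto simp: s_def)
  qed
  have s0: "s n x = 0" if "x \<notin> K" for n x
    using mvt[of x n] that h(2)[of n] supp by (force simp: K_def)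
  have s'0: "s' n x = 0" if "x \<notin> K" for n x
    using that h(2)[of n] h(1)[of n] supp[of x] supp[of "x + h n"] by (auto simp: K_def s'_def)
  have contM: "continuous_on UNIV (s n)" "continuous_on UNIV (s' n)" for n
  proof -
    show "continuous_on UNIV (s n)"
      using s' by (auto simp: continuous_on_eq_continuous_within intro!: DERIV_isCont)
    show "continuous_on UNIV (s' n)"
      unfolding s'_def[abs_def] using h(1)[of n]
      by (intro continuous_intros continuous_on_compose2[OF cont]) auto
  qed
  have tf: "test_function I (s n)" for n
    unfolding test_function_def
  proof
    show "s n C1_differentiable_on UNIV"
      unfolding C1_differentiable_on_def
      using s' contM(2) by (intro exI[of _ "s' n"]) (auto simp: has_real_derivative_iff_has_vector_derivative)
    show "\<exists>K. compact K \<and> K \<subseteq> I \<and> (\<forall>x. x \<notin> K \<longrightarrow> s n x = 0)"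
      using KI s0 by (intro exI[of _ K]) (auto simp: K_def)
  qed
  have deriv: "deriv (s n) x = s' n x" for n x using s' by (rule DERIV_imp_deriv)
  have eq: "(LINT x:I|lebesgue. s' n x *\<^sub>R u x) = - (LINT x:I|lebesgue. s n x *\<^sub>R g x)" for n
  proof -
    have "(LINT x:I|lebesgue. deriv (s n) x *\<^sub>R u x) = - (LINT x:I|lebesgue. s n x *\<^sub>R g x)"
      using w tf[of n] unfolding has_weak_deriv_def by blast
    then show ?thesis unfolding deriv .
  qed
  have hlim: "h \<longlonglongrightarrow> 0"
    unfolding h_def[abs_def] using LIMSEQ_inverse_real_of_nat by (rule LIMSEQ_ignore_initial_segment)
  have uK: "set_integrable lebesgue K u" and gK: "set_integrable lebesgue K g"
    using w KI by (auto simp: has_weak_deriv_def L1_loc_def K_def)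
  have sb: "\<bar>s n x - \<phi> x\<bar> \<le> L * h n" for n x
  proof -
    obtain c where c: "x < c" "c < x + h n" "s n x = \<phi> c" using mvt[of x n] by blast
    have "\<bar>\<phi> c - \<phi> x\<bar> \<le> L * \<bar>c - x\<bar>" by (rule lip)
    also have "\<dots> \<le> L * h n" using c L by (intro mult_left_mono) auto
    finally show ?thesis using c by simp
  qed
  have \<phi>b: "\<bar>\<phi> x\<bar> \<le> L * (\<beta> - \<alpha> + 1)" for x
  proof (cases "x \<in> {\<alpha>..\<beta>}")
    case True
    have "\<bar>\<phi> x - \<phi> (\<beta> + 1)\<bar> \<le> L * \<bar>x - (\<beta> + 1)\<bar>" by (rule lip)
    also have "\<dots> \<le> L * (\<beta> - \<alpha> + 1)" using True L by (intro mult_left_mono) auto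
    finally show ?thesis using supp[of "\<beta> + 1"] by simp
  qed (use supp L I in auto)
  have "(\<lambda>n. LINT x:I|lebesgue. s' n x *\<^sub>R u x) \<longlonglongrightarrow> (LINT x:I|lebesgue. \<psi> x *\<^sub>R u x)"
  proof (rule lim_set_integral_scaleR[OF uK KI _ s'0])
    show "s' n \<in> borel_measurable lebesgue" for n
      using contM(2)[of n] by (intro measurable_completion) (simp add: borel_measurable_continuous_onI)
    show "\<bar>s' n x\<bar> \<le> L" for n x
      using lip[of "x + h n" x] h(1)[of n] by (simp add: s'_def field_simps)
    have "(\<lambda>n. real (Suc (n + m)) * (\<phi> (x + inverse (real (Suc (n + m)))) - \<phi> x)) \<longlonglongrightarrow> \<psi> x" for x
      using lim[of x] by (rule LIMSEQ_ignore_initial_segment)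
    then show "(\<lambda>n. s' n x) \<longlonglongrightarrow> \<psi> x" for x
      by (simp only: s'_def h_def divide_inverse inverse_inverse_eq mult.commute)
  qed
  moreover have "(\<lambda>n. LINT x:I|lebesgue. s n x *\<^sub>R g x) \<longlonglongrightarrow> (LINT x:I|lebesgue. \<phi> x *\<^sub>R g x)"
  proof (rule lim_set_integral_scaleR[OF gK KI _ s0])
    show "s n \<in> borel_measurable lebesgue" for n
      using contM(1)[of n] by (intro measurable_completion) (simp add: borel_measurable_continuous_onI)
    show "\<bar>s n x\<bar> \<le> L * (\<beta> - \<alpha> + 1)" for n x
      using mvt[of x n] \<phi>b by auto
    have "(\<lambda>n. s n x - \<phi> x) \<longlonglongrightarrow> 0" for x
      by (rule Lim_null_comparison[where g = "\<lambda>n. L * h n"])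
         (use sb tendsto_mult_right_zero[OF hlim] in auto)
    then show "(\<lambda>n. s n x) \<longlonglongrightarrow> \<phi> x" for x
      by (simp add: LIM_zero_iff)
  qed
  ultimately show ?thesis
    using LIMSEQ_unique tendsto_minus by (metis (no_types, lifting) eq ext)
qed

text \<open>A Lipschitz approximation of the indicator of the positive half-line. The difference of
  two translates is a trapezoid, and testing with it replaces the point values of a weakly
  differentiable function by averages.\<close>

definition ramp :: "real \<Rightarrow> real \<Rightarrow> real" where
  "ramp h x = max 0 (min 1 (x / h))"

lemma ramp_lipschitz: "h > 0 \<Longrightarrow> \<bar>ramp h x - ramp h y\<bar> \<le> inverse h * \<bar>x - y\<bar>"
proof -
  assume h: "h > 0"
  have "\<bar>ramp h x - ramp h y\<bar> \<le> \<bar>x / h - y / h\<bar>" by (auto simp: ramp_def)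
  also have "\<dots> = inverse h * \<bar>x - y\<bar>" using h by (simp add: abs_mult divide_inverse flip: left_diff_distrib)
  finally show ?thesis .
qed

lemma ramp_eq_0: "h > 0 \<Longrightarrow> x \<le> 0 \<Longrightarrow> ramp h x = 0"
  by (simp add: ramp_def divide_nonpos_pos min_le_iff_disj max_absorb1)

lemma ramp_eq_1: "h > 0 \<Longrightarrow> x \<ge> h \<Longrightarrow> ramp h x = 1"
  by (simp add: ramp_def min_absorb1)

text \<open>Right difference quotients settle the two corners: slope \<open>1 / h\<close> at 0 and
  slope 0 at \<open>h\<close>. Hence the half-open interval, and a limit at every point rather than
  almost everywhere.\<close>

lemma ramp_right_deriv:
  assumes h: "h > 0"
  shows "(\<lambda>n. real (Suc n) * (ramp h (x + inverse (real (Suc n))) - ramp h x)) \<longlonglongrightarrow> indicator {0..<h} x / h"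
proof -
  have lim: "(\<lambda>n. x + inverse (real (Suc n))) \<longlonglongrightarrow> x + 0"
    by (intro tendsto_add tendsto_const LIMSEQ_inverse_real_of_nat)
  have "\<forall>\<^sub>F n in sequentially. real (Suc n) * (ramp h (x + inverse (real (Suc n))) - ramp h x) = indicator {0..<h} x / h"
  proof -
    consider "x < 0" | "0 \<le> x" "x < h" | "h \<le> x" by linarith
    then show ?thesis
    proof cases
      case 1
      then have "\<forall>\<^sub>F n in sequentially. x + inverse (real (Suc n)) < 0"
        using order_tendstoD(2)[OF lim, of 0] by simp
      then show ?thesis
        by eventually_elim (use 1 h in \<open>auto simp: ramp_def divide_less_0_iff max_def min_def not_le zero_le_divide_iff\<close>)
    next
      case 2
      then have "\<forall>\<^sub>F n in sequentially. x + inverse (real (Suc n)) < h"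
        using order_tendstoD(2)[OF lim, of h] by simp
      then show ?thesis
      proof eventually_elim
        case (elim n)
        define d where "d = inverse (real (Suc n))"
        have d: "d > 0" "real (Suc n) * d = 1" by (simp_all add: d_def)
        have "ramp h (x + d) = (x + d) / h" "ramp h x = x / h"
          using 2 h elim[folded d_def] d(1) by (auto simp: ramp_def max_def min_def)
        then have "real (Suc n) * (ramp h (x + d) - ramp h x) = (real (Suc n) * d) / h"
          by (simp add: add_divide_distrib)
        then show ?case unfolding d_def[symmetric] using d(2) 2 by (simp del: of_nat_Suc)
      qed
    next
      case 3
      then have "ramp h (x + inverse (real (Suc n))) = 1" "ramp h x = 1" for n
        using h 3 by (auto intro!: ramp_eq_1 add_increasing2)
      then show ?thesis using 3 by simp
    qed
  qed
  then show ?thesis by (rule tendsto_eventually)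
qed

lemma ramp_lim: "(\<lambda>n. ramp (inverse (real (Suc n))) x) \<longlonglongrightarrow> indicator {0<..} x"
proof (cases "x \<le> 0")
  case True
  then have "ramp (inverse (real (Suc n))) x = 0" for n
    by (intro ramp_eq_0) auto
  then show ?thesis using True by simp
next
  case False
  then obtain m where m: "inverse (real (Suc m)) < x" using reals_Archimedean by (metis not_le)
  have "\<forall>\<^sub>F n in sequentially. ramp (inverse (real (Suc n))) x = 1"
  proof (rule eventually_sequentiallyI[of m])
    fix n assume "n \<ge> m"
    then have "inverse (real (Suc n)) < x" using m by (intro le_less_trans[OF _ m]) auto
    then have "1 \<le> x / inverse (real (Suc n))" by (simp add: field_simps)
    then show "ramp (inverse (real (Suc n))) x = 1" by (simp only: ramp_def)
  qed
  then show ?thesis using False by (simp add: tendsto_eventually)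
qed

lemma ramp_bounds: "0 \<le> ramp h x" "ramp h x \<le> 1"
  by (auto simp: ramp_def)

text \<open>Test with the trapezoid that rises on \<open>{p..p + h}\<close> and falls on
  \<open>{q..q + h}\<close>: its slopes produce the averages of \<open>u\<close> over the two
  flanks, its values the weight on \<open>g\<close>.\<close>

lemma weak_deriv_trapezoid:
  assumes w: "has_weak_deriv I u g" and I: "open I" "{p..q + h} \<subseteq> I" "p \<le> q" "h > 0"
  shows "(LINT x:{q..<q + h}|lebesgue. u x) - (LINT x:{p..<p + h}|lebesgue. u x) =
    h *\<^sub>R (LINT x:I|lebesgue. (ramp h (x - p) - ramp h (x - q)) *\<^sub>R g x)"
proof -
  define \<psi> where "\<psi> x = indicator {0..<h} (x - p) / h - indicator {0..<h} (x - q) / h" for x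
  have "(LINT x:I|lebesgue. \<psi> x *\<^sub>R u x) = - (LINT x:I|lebesgue. (ramp h (x - p) - ramp h (x - q)) *\<^sub>R g x)"
  proof (rule weak_deriv_lipschitz_test[OF w I(1,2)])
    show "p \<le> q + h" using I by simp
    fix x y
    show "\<bar>ramp h (x - p) - ramp h (x - q) - (ramp h (y - p) - ramp h (y - q))\<bar> \<le> (2 * inverse h) * \<bar>x - y\<bar>"
      using ramp_lipschitz[of h "x - p" "y - p"] ramp_lipschitz[of h "x - q" "y - q"] I
      by (auto simp: abs_le_iff)
    show "ramp h (x - p) - ramp h (x - q) = 0" if "x \<notin> {p..q + h}"
    proof (cases "x < p")
      case True
      then show ?thesis using I by (simp add: ramp_eq_0)
    next
      case False
      then show ?thesis using I that by (simp add: ramp_eq_1)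
    qed
    have "(\<lambda>n. real (Suc n) * (ramp h ((x - p) + inverse (real (Suc n))) - ramp h (x - p))
            - real (Suc n) * (ramp h ((x - q) + inverse (real (Suc n))) - ramp h (x - q))) \<longlonglongrightarrow> \<psi> x"
      unfolding \<psi>_def using I by (intro tendsto_diff ramp_right_deriv) auto
    then show "(\<lambda>n. real (Suc n) * (ramp h (x + inverse (real (Suc n)) - p) - ramp h (x + inverse (real (Suc n)) - q)
        - (ramp h (x - p) - ramp h (x - q)))) \<longlonglongrightarrow> \<psi> x"
      by (simp add: algebra_simps)
  qed
  moreover have "(LINT x:I|lebesgue. \<psi> x *\<^sub>R u x) =
      inverse h *\<^sub>R ((LINT x:{p..<p + h}|lebesgue. u x) - (LINT x:{q..<q + h}|lebesgue. u x))"
  proof -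
    have int: "set_integrable lebesgue {r..<r + h} u" if "r \<in> {p, q}" for r
      by (rule set_integrable_subset[OF L1_loc_Icc[of I u p "q + h"]])
         (use w I that in \<open>auto simp: has_weak_deriv_def\<close>)
    have "(LINT x:I|lebesgue. \<psi> x *\<^sub>R u x) = (LINT x|lebesgue. inverse h *\<^sub>R
        (indicator {p..<p + h} x *\<^sub>R u x - indicator {q..<q + h} x *\<^sub>R u x))"
      unfolding set_lebesgue_integral_def
      by (intro Bochner_Integration.integral_cong)
         (use I in \<open>auto simp: \<psi>_def indicator_def divide_inverse algebra_simps subset_iff\<close>)
    also have "\<dots> = inverse h *\<^sub>R ((LINT x:{p..<p + h}|lebesgue. u x) - (LINT x:{q..<q + h}|lebesgue. u x))"
      unfolding set_lebesgue_integral_def using int[of p] int[of q]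
      by (subst Bochner_Integration.integral_scaleR_right)
         (simp_all add: set_integrable_def)
    finally show ?thesis .
  qed
  ultimately have "inverse h *\<^sub>R ((LINT x:{p..<p + h}|lebesgue. u x) - (LINT x:{q..<q + h}|lebesgue. u x)) =
     - (LINT x:I|lebesgue. (ramp h (x - p) - ramp h (x - q)) *\<^sub>R g x)" by simp
  then have "h *\<^sub>R inverse h *\<^sub>R ((LINT x:{p..<p + h}|lebesgue. u x) - (LINT x:{q..<q + h}|lebesgue. u x)) =
     h *\<^sub>R - (LINT x:I|lebesgue. (ramp h (x - p) - ramp h (x - q)) *\<^sub>R g x)" by (rule arg_cong)
  then show ?thesis using I(4) by (simp add: algebra_simps)
qed

lemma set_integral_lebesgue_eq_integral_closure:
  fixes u :: "real \<Rightarrow> complex"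
  assumes "set_integrable lebesgue {p..q} u"
  shows "(LINT x:{p..<q}|lebesgue. u x) = integral {p..q} u"
    and "(LINT x:{p<..q}|lebesgue. u x) = integral {p..q} u"
proof -
  have "set_integrable lebesgue {p..<q} u" "set_integrable lebesgue {p<..q} u"
    using assms by (auto intro: set_integrable_subset)
  then have 1: "(LINT x:{p..<q}|lebesgue. u x) = integral {p..<q} u"
       and 2: "(LINT x:{p<..q}|lebesgue. u x) = integral {p<..q} u"
    by (auto intro: set_lebesgue_integral_eq_integral)
  have n: "negligible {r}" for r :: real by simp
  show "(LINT x:{p..<q}|lebesgue. u x) = integral {p..q} u"
    unfolding 1 by (rule integral_spike_set; rule negligible_subset[OF n[of q]]) auto
  show "(LINT x:{p<..q}|lebesgue. u x) = integral {p..q} u"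
    unfolding 2 by (rule integral_spike_set; rule negligible_subset[OF n[of p]]) auto
qed

text \<open>An averaged fundamental theorem, from trapezoids with flanks shrinking to zero. It holds
  for every \<open>p\<close> and \<open>q\<close>, because no value of \<open>u\<close> at a point
  is involved.\<close>

lemma weak_deriv_increment_lim:
  assumes w: "has_weak_deriv I u g" and I: "open I" "{p..q} \<subseteq> I" "p \<le> q"
  shows "(\<lambda>n. real (Suc n) *\<^sub>R (integral {q..q + inverse (real (Suc n))} u - integral {p..p + inverse (real (Suc n))} u))
    \<longlonglongrightarrow> integral {p..q} g"
proof -
  have "q \<in> I" using I by auto
  then obtain e where e: "e > 0" "ball q e \<subseteq> I" using I(1) openE by blast
  obtain m where m: "inverse (real (Suc m)) < e" using reals_Archimedean[OF e(1)] by blast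
  define h where "h n = inverse (real (Suc (n + m)))" for n
  have h: "h n > 0" "h n \<le> h 0" "h n < e" for n
  proof -
    show "h n > 0" by (simp add: h_def)
    show "h n \<le> h 0" by (simp add: h_def)
    moreover have "h 0 < e" using m by (simp add: h_def)
    ultimately show "h n < e" by linarith
  qed
  define K where "K = {p..q + h 0}"
  have KI: "K \<subseteq> I"
  proof
    fix x assume "x \<in> K"
    then have "x \<in> ball q e \<or> x \<in> {p..q}" using h(3)[of 0] by (auto simp: K_def dist_real_def)
    then show "x \<in> I" using e I by blast
  qed
  have KI': "{p..q + h n} \<subseteq> I" for n using KI h(2)[of n] by (auto simp: K_def)
  have uK: "set_integrable lebesgue K u" and gK: "set_integrable lebesgue K g"
    using w KI by (auto simp: has_weak_deriv_def L1_loc_def K_def)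
  have eq: "inverse (h n) *\<^sub>R (integral {q..q + h n} u - integral {p..p + h n} u) =
      (LINT x:I|lebesgue. (ramp (h n) (x - p) - ramp (h n) (x - q)) *\<^sub>R g x)" for n
  proof -
    have "set_integrable lebesgue {q..q + h n} u" "set_integrable lebesgue {p..p + h n} u"
      using I(3) h(2)[of n] by (auto intro!: set_integrable_subset[OF uK] simp: K_def)
    then show ?thesis
      using weak_deriv_trapezoid[OF w I(1) KI' I(3) h(1), of n] h(1)[of n]
      by (simp add: set_integral_lebesgue_eq_integral_closure(1))
  qed
  have "(\<lambda>n. LINT x:I|lebesgue. (ramp (h n) (x - p) - ramp (h n) (x - q)) *\<^sub>R g x) \<longlonglongrightarrow>
        (LINT x:I|lebesgue. (indicator {0<..} (x - p) - indicator {0<..} (x - q)) *\<^sub>R g x)"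
  proof (rule lim_set_integral_scaleR[OF gK KI])
    show "(\<lambda>x. ramp (h n) (x - p) - ramp (h n) (x - q)) \<in> borel_measurable lebesgue" for n
      unfolding ramp_def by (intro measurable_completion) simp
    show "ramp (h n) (x - p) - ramp (h n) (x - q) = 0" if "x \<notin> K" for n x
    proof (cases "x < p")
      case True
      then show ?thesis using I h(1)[of n] by (simp add: ramp_eq_0)
    next
      case False
      then show ?thesis using I that h(2)[of n] h(1)[of n] by (simp add: ramp_eq_1 K_def)
    qed
    show "\<bar>ramp (h n) (x - p) - ramp (h n) (x - q)\<bar> \<le> 1" for n x
      using ramp_bounds[of "h n" "x - p"] ramp_bounds[of "h n" "x - q"] by auto
    show "(\<lambda>n. ramp (h n) (x - p) - ramp (h n) (x - q)) \<longlonglongrightarrow> indicator {0<..} (x - p) - indicator {0<..} (x - q)" for x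
      unfolding h_def
      by (intro tendsto_diff LIMSEQ_ignore_initial_segment[OF ramp_lim])
  qed
  also have "(LINT x:I|lebesgue. (indicator {0<..} (x - p) - indicator {0<..} (x - q)) *\<^sub>R g x) =
      (LINT x:{p<..q}|lebesgue. g x)"
    unfolding set_lebesgue_integral_def
    by (intro Bochner_Integration.integral_cong) (use I in \<open>auto simp: indicator_def subset_iff\<close>)
  also have "\<dots> = integral {p..q} g"
    using h(1)[of 0] by (intro set_integral_lebesgue_eq_integral_closure(2) set_integrable_subset[OF gK]) (auto simp: K_def)
  finally have "(\<lambda>n. inverse (h n) *\<^sub>R (integral {q..q + h n} u - integral {p..p + h n} u)) \<longlonglongrightarrow> integral {p..q} g"
    unfolding eq .
  then have "(\<lambda>n. real (Suc (n + m)) *\<^sub>R (integral {q..q + inverse (real (Suc (n + m)))} u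
      - integral {p..p + inverse (real (Suc (n + m)))} u)) \<longlonglongrightarrow> integral {p..q} g"
    unfolding h_def inverse_inverse_eq .
  then show ?thesis
    by (rule LIMSEQ_offset)
qed

text \<open>Lebesgue differentiation is applied to \<open>u\<close> cut off to a compact interval
  inside \<open>I\<close>. Intervals with rational endpoints suffice to reach every point of
  \<open>I\<close>, so only countably many exceptional sets are united.\<close>

lemma AE_lebesgue_point:
  fixes u :: "real \<Rightarrow> complex"
  assumes u: "L1_loc I u" and I: "open I"
  shows "AE x in lebesgue. x \<in> I \<longrightarrow>
    (\<lambda>n. real (Suc n) *\<^sub>R integral {x..x + inverse (real (Suc n))} u) \<longlonglongrightarrow> u x"
proof -
  define P where "P x \<longleftrightarrow> (\<lambda>n. real (Suc n) *\<^sub>R integral {x..x + inverse (real (Suc n))} u) \<longlonglongrightarrow> u x" for x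
  have *: "AE x in lebesgue. {r..s} \<subseteq> I \<and> r < x \<and> x < s \<longrightarrow> P x" for r s :: real
  proof (cases "{r..s} \<subseteq> I")
    case True
    define v where "v x = (if x \<in> {r..s} then u x else 0)" for x
    have "v integrable_on cbox a b" for a b
    proof -
      have "u integrable_on {r..s}"
        using L1_loc_Icc[OF u True] by (rule set_lebesgue_integral_eq_integral(1))
      then have "v integrable_on UNIV"
        unfolding v_def by (simp only: integrable_restrict_UNIV)
      then show ?thesis by (rule integrable_on_subcbox) auto
    qed
    then obtain N where N: "negligible N" and
      conv: "\<And>x e. x \<notin> N \<Longrightarrow> 0 < e \<Longrightarrow> \<exists>d>0. \<forall>h. 0 < h \<and> h < d \<longrightarrow>
        norm (integral (cbox x (x + h *\<^sub>R One)) v /\<^sub>R h ^ DIM(real) - v x) < e"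
      by (rule integrable_ccontinuous_explicit) blast
    have "P x" if x: "x \<notin> N" "r < x" "x < s" for x
      unfolding P_def
    proof (rule LIMSEQ_I)
      fix e :: real assume "e > 0"
      then obtain d where d: "d > 0" "\<And>h. 0 < h \<Longrightarrow> h < d \<Longrightarrow> norm (integral (cbox x (x + h *\<^sub>R One)) v /\<^sub>R h ^ DIM(real) - v x) < e"
        using conv[OF x(1)] by blast
      obtain m where m: "inverse (real (Suc m)) < min d (s - x)"
        using reals_Archimedean[of "min d (s - x)"] d x by auto
      have "norm (real (Suc n) *\<^sub>R integral {x..x + inverse (real (Suc n))} u - u x) < e" if "n \<ge> m" for n
      proof -
        define h where "h = inverse (real (Suc n))"
        have h: "h > 0" "h < d" "h < s - x"
        proof -
          have "h \<le> inverse (real (Suc m))" using that by (simp add: h_def)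
          then show "h < d" "h < s - x" using m by auto
        qed (simp add: h_def)
        have "integral {x..x + h} v = integral {x..x + h} u"
          by (rule integral_cong) (use x h in \<open>auto simp: v_def\<close>)
        then show ?thesis
          using d(2)[OF h(1,2)] x by (simp add: h_def v_def)
      qed
      then show "\<exists>no. \<forall>n\<ge>no. norm (real (Suc n) *\<^sub>R integral {x..x + inverse (real (Suc n))} u - u x) < e"
        by blast
    qed
    moreover have "AE x in lebesgue. x \<notin> N"
      using N by (intro AE_not_in) (simp add: negligible_iff_null_sets)
    ultimately show ?thesis by (auto elim!: eventually_mono)
  qed auto
  have "AE x in lebesgue. \<forall>r s::rat. {of_rat r..of_rat s} \<subseteq> I \<and> of_rat r < x \<and> x < of_rat s \<longrightarrow> P x"
    unfolding AE_all_countable using * by blast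
  then show ?thesis
  proof (rule eventually_mono)
    fix x :: real
    assume H: "\<forall>r s::rat. {of_rat r..of_rat s} \<subseteq> I \<and> of_rat r < x \<and> x < of_rat s \<longrightarrow> P x"
    have "P x" if "x \<in> I"
    proof -
      obtain e where e: "e > 0" "ball x e \<subseteq> I" using I \<open>x \<in> I\<close> openE by blast
      obtain r :: rat where r: "x - e < of_rat r" "of_rat r < x" using of_rat_dense[of "x - e" x] e by auto
      obtain s :: rat where s: "x < of_rat s" "of_rat s < x + e" using of_rat_dense[of x "x + e"] e by auto
      have "{of_rat r..of_rat s} \<subseteq> ball x e" using r s by (auto simp: dist_real_def)
      then show ?thesis using H r s e by blast
    qed
    then show "x \<in> I \<longrightarrow> (\<lambda>n. real (Suc n) *\<^sub>R integral {x..x + inverse (real (Suc n))} u) \<longlonglongrightarrow> u x"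
      by (simp add: P_def)
  qed
qed

lemma is_interval_Icc_subset: "is_interval (I::real set) \<Longrightarrow> p \<in> I \<Longrightarrow> q \<in> I \<Longrightarrow> {p..q} \<subseteq> I"
  unfolding is_interval_1 by (meson atLeastAtMost_iff subsetI)

text \<open>The increment limit depends on \<open>u\<close> alone, so \<open>g\<close> and
  \<open>g'\<close> have equal integrals over short intervals to the right of \<open>x\<close>; at a
  common Lebesgue point their values agree.\<close>

lemma has_weak_deriv_unique:
  assumes w: "has_weak_deriv I u g" "has_weak_deriv I u g'" and I: "open I" "is_interval I"
  shows "AE x in lebesgue. x \<in> I \<longrightarrow> g x = g' x"
proof -
  have "L1_loc I g" "L1_loc I g'"
    using w by (auto simp: has_weak_deriv_def)
  from this[THEN AE_lebesgue_point, OF I(1)] show ?thesis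
  proof eventually_elim
    case (elim x)
    show ?case
    proof
      assume x: "x \<in> I"
      then obtain e where e: "e > 0" "ball x e \<subseteq> I" using I openE by blast
      obtain m where m: "inverse (real (Suc m)) < e" using reals_Archimedean[OF e(1)] by blast
      have "\<forall>\<^sub>F n in sequentially. real (Suc n) *\<^sub>R integral {x..x + inverse (real (Suc n))} g =
              real (Suc n) *\<^sub>R integral {x..x + inverse (real (Suc n))} g'"
      proof (rule eventually_sequentiallyI[of m])
        fix n assume "n \<ge> m"
        then have "inverse (real (Suc n)) < e" by (intro le_less_trans[OF _ m]) auto
        then have sub: "{x..x + inverse (real (Suc n))} \<subseteq> I" using e by (auto simp: dist_real_def subset_iff)
        show "real (Suc n) *\<^sub>R integral {x..x + inverse (real (Suc n))} g =
              real (Suc n) *\<^sub>R integral {x..x + inverse (real (Suc n))} g'"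
          using LIMSEQ_unique[OF weak_deriv_increment_lim[OF w(1) I(1) sub] weak_deriv_increment_lim[OF w(2) I(1) sub]]
          by simp
      qed
      then have "(\<lambda>n. real (Suc n) *\<^sub>R integral {x..x + inverse (real (Suc n))} g') \<longlonglongrightarrow> g x"
        by (rule Lim_transform_eventually[rotated]) (use elim x in blast)
      then show "g x = g' x"
        by (rule LIMSEQ_unique) (use elim x in blast)
    qed
  qed
qed

lemma weak_deriv_AE_eq:
  assumes "has_weak_deriv I u g" "open I" "is_interval I"
  shows "AE x in lebesgue. x \<in> I \<longrightarrow> weak_deriv I u x = g x"
proof -
  have "has_weak_deriv I u (weak_deriv I u)"
    unfolding weak_deriv_def by (rule someI[where P = "has_weak_deriv I u", OF assms(1)])
  from has_weak_deriv_unique[OF this assms] show ?thesis .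
qed

text \<open>At Lebesgue points the averages in the increment limit converge to values of
  \<open>u\<close>, so \<open>u - G\<close> takes the same value at all of them.\<close>

lemma has_weak_deriv_representative:
  assumes w: "has_weak_deriv I u g" and I: "open I" "is_interval I" "I \<noteq> {}"
    and G: "\<And>p q. p \<in> I \<Longrightarrow> q \<in> I \<Longrightarrow> p \<le> q \<Longrightarrow> G q - G p = integral {p..q} g"
  obtains C where "AE x in lebesgue. x \<in> I \<longrightarrow> u x = C + G x"
proof -
  have AE: "AE x in lebesgue. x \<in> I \<longrightarrow> (\<lambda>n. real (Suc n) *\<^sub>R integral {x..x + inverse (real (Suc n))} u) \<longlonglongrightarrow> u x"
    using w I(1) unfolding has_weak_deriv_def by (intro AE_lebesgue_point) blast+
  have inc: "u q - u p = G q - G p"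
    if "p \<in> I" "q \<in> I" "p \<le> q"
      "(\<lambda>n. real (Suc n) *\<^sub>R integral {p..p + inverse (real (Suc n))} u) \<longlonglongrightarrow> u p"
      "(\<lambda>n. real (Suc n) *\<^sub>R integral {q..q + inverse (real (Suc n))} u) \<longlonglongrightarrow> u q" for p q
  proof -
    have "(\<lambda>n. real (Suc n) *\<^sub>R (integral {q..q + inverse (real (Suc n))} u - integral {p..p + inverse (real (Suc n))} u))
        \<longlonglongrightarrow> u q - u p"
      using tendsto_diff[OF that(5,4)] by (simp add: algebra_simps)
    then have "u q - u p = integral {p..q} g"
      by (rule LIMSEQ_unique)
         (rule weak_deriv_increment_lim[OF w I(1) is_interval_Icc_subset[OF I(2) that(1,2)] that(3)])
    then show ?thesis using G[OF that(1-3)] by simp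
  qed
  \<comment> \<open>Some Lebesgue point must exist to serve as an anchor; otherwise the nonempty
    open set \<open>I\<close> would be a null set.\<close>
  obtain p where p: "p \<in> I" "(\<lambda>n. real (Suc n) *\<^sub>R integral {p..p + inverse (real (Suc n))} u) \<longlonglongrightarrow> u p"
  proof (rule ccontr)
    assume *: "\<not> thesis"
    have "AE x in lebesgue. x \<notin> I" using AE by eventually_elim (use * that in blast)
    then have "I \<in> null_sets lebesgue"
      using I by (subst (asm) AE_iff_null) (auto simp: borel_open)
    then show False using I open_not_negligible negligible_iff_null_sets by blast
  qed
  have "AE x in lebesgue. x \<in> I \<longrightarrow> u x = (u p - G p) + G x"
    using AE
  proof eventually_elim
    case (elim x)
    then show ?case
      using inc[of p x] inc[of x p] p by (cases "p \<le> x") (auto simp: algebra_simps)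
  qed
  then show ?thesis by (rule that)
qed

subsection \<open>Steklov means\<close>

text \<open>The window looks ahead, so that the averaged equation at a time \<open>t \<ge> 0\<close>
  uses the original one only at later times.\<close>

definition steklov :: "real \<Rightarrow> (real \<Rightarrow> complex) \<Rightarrow> real \<Rightarrow> complex" where
  "steklov h f x = (LBINT t:{x..x + h}. f t) /\<^sub>R h"

text \<open>Borel functions on the whole line are used instead of functions on the half-line beyond
  -1: translates and means then need no conditions on domains, and Tonelli's theorem applies
  directly.\<close>

definition L2_loc :: "(real \<Rightarrow> complex) \<Rightarrow> bool" where
  "L2_loc f \<longleftrightarrow> f \<in> borel_measurable borel \<and> (\<forall>p q. set_integrable lborel {p..q} (\<lambda>x. (norm (f x))\<^sup>2))"

lemma L2_loc_measurable: "L2_loc f \<Longrightarrow> f \<in> borel_measurable borel"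
  by (simp add: L2_loc_def)

lemma L2_loc_square: "L2_loc f \<Longrightarrow> set_integrable lborel {p..q} (\<lambda>x. (norm (f x))\<^sup>2)"
  by (simp add: L2_loc_def)

lemma set_integrable_const_Icc: "set_integrable lborel {p..q::real} (\<lambda>x. c::real)"
  by (intro borel_integrable_atLeastAtMost' continuous_intros)

lemma L2_loc_set_integrable:
  assumes "L2_loc f"
  shows "set_integrable lborel {p..q} f"
proof (rule set_integrable_bound[OF set_integral_add(1)])
  show "set_integrable lborel {p..q} (\<lambda>x. 1::real)" by (rule set_integrable_const_Icc)
  show "set_integrable lborel {p..q} (\<lambda>x. (norm (f x))\<^sup>2)" using assms by (rule L2_loc_square)
  show "set_borel_measurable lborel {p..q} f"
    using L2_loc_measurable[OF assms] unfolding set_borel_measurable_def by measurable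
  have "norm w \<le> norm (1 + (norm w)\<^sup>2)" for w :: complex
    using zero_le_power2[of "norm w - 1/2"] by (simp add: power2_eq_square algebra_simps)
  then show "AE x in lborel. x \<in> {p..q} \<longrightarrow> norm (f x) \<le> norm (1 + (norm (f x))\<^sup>2)" by simp
qed

lemma compact_subset_Icc:
  assumes "compact (K :: real set)"
  obtains p q where "K \<subseteq> {p..q}"
proof -
  have "bounded K" using assms by (rule compact_imp_bounded)
  then obtain r where "\<forall>x\<in>K. \<bar>x\<bar> \<le> r" unfolding bounded_real by auto
  then have "K \<subseteq> {- r..r}" by (auto simp: abs_le_iff minus_le_iff)
  then show ?thesis by (rule that)
qed

lemma L2_loc_L1_loc:
  assumes f: "L2_loc f"
  shows "L1_loc I f"
  unfolding L1_loc_def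
proof (intro allI impI, elim conjE)
  fix K :: "real set" assume "compact K"
  then obtain p q where r: "K \<subseteq> {p..q}" by (rule compact_subset_Icc)
  have "set_integrable lebesgue {p..q} f"
    using L2_loc_set_integrable[OF f] by (simp add: set_integrable_def integrable_completion)
  then show "set_integrable lebesgue K f"
    by (rule set_integrable_subset) (use r \<open>compact K\<close> in \<open>auto simp: borel_compact\<close>)
qed

lemma continuous_L2_loc:
  assumes "continuous_on UNIV f"
  shows "L2_loc f"
  unfolding L2_loc_def
proof (intro conjI allI)
  show "f \<in> borel_measurable borel" using assms by (rule borel_measurable_continuous_onI)
  show "set_integrable lborel {p..q} (\<lambda>x. (norm (f x))\<^sup>2)" for p q
    by (intro borel_integrable_atLeastAtMost' continuous_intros continuous_on_subset[OF assms]) auto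
qed

lemma norm_add_squared_le:
  fixes u v :: "'a::real_normed_vector"
  shows "(norm (u + v))\<^sup>2 \<le> 2 * (norm u)\<^sup>2 + 2 * (norm v)\<^sup>2"
proof -
  have "(norm (u + v))\<^sup>2 \<le> (norm u + norm v)\<^sup>2"
    by (intro power_mono norm_triangle_ineq) simp
  also have "\<dots> \<le> 2 * (norm u)\<^sup>2 + 2 * (norm v)\<^sup>2"
    using zero_le_power2[of "norm u - norm v"] by (simp add: power2_eq_square algebra_simps)
  finally show ?thesis .
qed

lemma norm_diff_squared_le:
  fixes u v :: "'a::real_normed_vector"
  shows "(norm (u - v))\<^sup>2 \<le> 2 * (norm u)\<^sup>2 + 2 * (norm v)\<^sup>2"
  using norm_add_squared_le[of u "- v"] by simp

lemma L2_loc_add: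
  assumes "L2_loc f" "L2_loc g"
  shows "L2_loc (\<lambda>x. f x + g x)"
  unfolding L2_loc_def
proof (intro conjI allI)
  note [measurable] = L2_loc_measurable[OF assms(1)] L2_loc_measurable[OF assms(2)]
  show "(\<lambda>x. f x + g x) \<in> borel_measurable borel" by measurable
  show "set_integrable lborel {p..q} (\<lambda>x. (norm (f x + g x))\<^sup>2)" for p q
  proof (rule set_integrable_bound)
    show "set_integrable lborel {p..q} (\<lambda>x. 2 * (norm (f x))\<^sup>2 + 2 * (norm (g x))\<^sup>2)"
      using assms by (intro set_integral_add(1) set_integrable_mult_right L2_loc_square)
    show "set_borel_measurable lborel {p..q} (\<lambda>x. (norm (f x + g x))\<^sup>2)"
      unfolding set_borel_measurable_def by measurable
  qed (use norm_add_squared_le[of "f _" "g _"] in auto)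
qed

lemma L2_loc_minus: "L2_loc f \<Longrightarrow> L2_loc (\<lambda>x. - f x)"
  unfolding L2_loc_def by simp

lemma L2_loc_diff: "L2_loc f \<Longrightarrow> L2_loc g \<Longrightarrow> L2_loc (\<lambda>x. f x - g x)"
  using L2_loc_add[OF _ L2_loc_minus, of f g] by simp

lemma L2_loc_integrable:
  assumes "f \<in> borel_measurable borel" "integrable lborel (\<lambda>x. (norm (f x))\<^sup>2)"
  shows "L2_loc f"
  using assms by (auto simp: L2_loc_def set_integrable_def simp del: real_scaleR_def intro!: integrable_mult_indicator)

text \<open>The Cauchy--Schwarz inequality against the constant function, by expanding the variance.\<close>

lemma norm_set_integral_squared_le:
  assumes f: "L2_loc f" and pq: "p < q"
  shows "(norm (LBINT t:{p..q}. f t))\<^sup>2 \<le> (q - p) * (LBINT t:{p..q}. (norm (f t))\<^sup>2)"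
proof -
  define A where "A = (LBINT t:{p..q}. norm (f t))"
  define B where "B = (LBINT t:{p..q}. (norm (f t))\<^sup>2)"
  define c where "c = A / (q - p)"
  have i1: "set_integrable lborel {p..q} (\<lambda>t. norm (f t))"
    by (rule set_integrable_norm[OF L2_loc_set_integrable[OF f]])
  have i2: "set_integrable lborel {p..q} (\<lambda>t. (norm (f t))\<^sup>2)"
    by (rule L2_loc_square[OF f])
  have "norm (LBINT t:{p..q}. f t) \<le> A"
    unfolding A_def by (rule set_integral_norm_bound[OF L2_loc_set_integrable[OF f]])
  then have 1: "(norm (LBINT t:{p..q}. f t))\<^sup>2 \<le> A\<^sup>2" by (intro power_mono) auto
  have "0 \<le> (LBINT t:{p..q}. (norm (f t) - c)\<^sup>2)"
    unfolding set_lebesgue_integral_def by (intro integral_nonneg_AE AE_I2) simp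
  also have "(LBINT t:{p..q}. (norm (f t) - c)\<^sup>2) = (LBINT t:{p..q}. (norm (f t))\<^sup>2 - (2 * c) * norm (f t) + c\<^sup>2)"
    by (intro arg_cong[where f = "set_lebesgue_integral lborel _"] ext) (simp add: power2_eq_square algebra_simps)
  also have "\<dots> = B - 2 * c * A + c\<^sup>2 * (q - p)"
    using i1 i2 pq set_integrable_const_Icc[of p q "c\<^sup>2"]
    by (simp add: A_def B_def set_integral_add set_integral_diff set_integrable_mult_right set_lebesgue_integral_def[of _ _ "\<lambda>_. c\<^sup>2"])
  also have "c\<^sup>2 * (q - p) = c * A" using pq by (simp add: c_def power2_eq_square)
  finally have "0 \<le> B - A\<^sup>2 / (q - p)" by (simp add: c_def power2_eq_square)
  then have "A\<^sup>2 \<le> (q - p) * B" using pq by (simp add: field_simps)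
  then show ?thesis using 1 by (simp add: B_def)
qed

section \<open>Averaging as an approximate identity on L^2\<close>

lemma steklov_measurable:
  assumes [measurable]: "f \<in> borel_measurable borel"
  shows "steklov h f \<in> borel_measurable borel"
proof -
  have "(\<lambda>(x, t). if x \<le> t \<and> t \<le> x + h then f t else 0) \<in> borel_measurable (borel \<Otimes>\<^sub>M lborel)"
    by measurable
  then have "(\<lambda>x. LBINT t. if x \<le> t \<and> t \<le> x + h then f t else 0) \<in> borel_measurable borel"
    by (rule lborel.borel_measurable_lebesgue_integral)
  moreover have "(LBINT t:{x..x + h}. f t) = (LBINT t. if x \<le> t \<and> t \<le> x + h then f t else 0)" for x
    unfolding set_lebesgue_integral_def by (intro Bochner_Integration.integral_cong) (auto simp: indicator_def)
  ultimately show ?thesis unfolding steklov_def[abs_def] by simp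
qed

text \<open>Cauchy--Schwarz on each window, then Tonelli: a point \<open>t\<close> belongs exactly
  to the windows that start in \<open>{t - h..t}\<close>, a set of length \<open>h\<close>, which
  cancels the normalisation. With nonnegative integrals, global square integrability is not
  presupposed.\<close>

lemma steklov_L2_bound:
  assumes f: "L2_loc f" and h: "h > 0"
  shows "(\<integral>\<^sup>+x. ennreal ((norm (steklov h f x))\<^sup>2) \<partial>lborel) \<le> (\<integral>\<^sup>+x. ennreal ((norm (f x))\<^sup>2) \<partial>lborel)"
proof -
  note [measurable] = L2_loc_measurable[OF f]
  define a where "a t = ennreal ((norm (f t))\<^sup>2)" for t
  have [measurable]: "a \<in> borel_measurable borel" unfolding a_def[abs_def] by measurable
  define k where "k x t = (if x \<le> t \<and> t \<le> x + h then a t else 0)" for x t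
  have [measurable]: "(\<lambda>(x, t). k x t) \<in> borel_measurable (lborel \<Otimes>\<^sub>M lborel)"
    unfolding k_def by measurable
  have "ennreal ((norm (steklov h f x))\<^sup>2) \<le> ennreal (inverse h) * (\<integral>\<^sup>+t. k x t \<partial>lborel)" for x
  proof -
    have "(norm (LBINT t:{x..x + h}. f t))\<^sup>2 \<le> h * (LBINT t:{x..x + h}. (norm (f t))\<^sup>2)"
      using norm_set_integral_squared_le[OF f, of x "x + h"] h by simp
    then have "(norm (steklov h f x))\<^sup>2 \<le> inverse h * (LBINT t:{x..x + h}. (norm (f t))\<^sup>2)"
      using h by (simp add: steklov_def power_mult_distrib power2_eq_square field_simps)
    then have "ennreal ((norm (steklov h f x))\<^sup>2) \<le> ennreal (inverse h * (LBINT t:{x..x + h}. (norm (f t))\<^sup>2))"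
      by (rule ennreal_leI)
    also have "\<dots> = ennreal (inverse h) * ennreal (LBINT t:{x..x + h}. (norm (f t))\<^sup>2)"
      using h by (intro ennreal_mult') simp
    also have "ennreal (LBINT t:{x..x + h}. (norm (f t))\<^sup>2) = (\<integral>\<^sup>+t. k x t \<partial>lborel)"
      unfolding set_lebesgue_integral_def
      using L2_loc_square[OF f, of x "x + h"]
      by (subst nn_integral_eq_integral[symmetric])
         (auto simp: set_integrable_def k_def a_def indicator_def intro!: nn_integral_cong)
    finally show ?thesis .
  qed
  then have "(\<integral>\<^sup>+x. ennreal ((norm (steklov h f x))\<^sup>2) \<partial>lborel) \<le> (\<integral>\<^sup>+x. ennreal (inverse h) * (\<integral>\<^sup>+t. k x t \<partial>lborel) \<partial>lborel)"
    by (intro nn_integral_mono) simp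
  also have "\<dots> = ennreal (inverse h) * (\<integral>\<^sup>+x. (\<integral>\<^sup>+t. k x t \<partial>lborel) \<partial>lborel)"
    by (intro nn_integral_cmult) measurable
  also have "(\<integral>\<^sup>+x. (\<integral>\<^sup>+t. k x t \<partial>lborel) \<partial>lborel) = (\<integral>\<^sup>+t. (\<integral>\<^sup>+x. k x t \<partial>lborel) \<partial>lborel)"
    by (rule lborel_pair.Fubini'[symmetric]) measurable
  also have "\<dots> = (\<integral>\<^sup>+t. ennreal h * a t \<partial>lborel)"
  proof (rule nn_integral_cong)
    fix t
    have "(\<integral>\<^sup>+x. k x t \<partial>lborel) = (\<integral>\<^sup>+x. a t * indicator {t - h..t} x \<partial>lborel)"
      by (intro nn_integral_cong) (auto simp: k_def indicator_def)
    also have "\<dots> = ennreal h * a t"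
      using h by (simp add: nn_integral_cmult_indicator mult.commute)
    finally show "(\<integral>\<^sup>+x. k x t \<partial>lborel) = ennreal h * a t" .
  qed
  also have "\<dots> = ennreal h * (\<integral>\<^sup>+t. a t \<partial>lborel)"
    by (intro nn_integral_cmult) measurable
  also have "ennreal (inverse h) * \<dots> = (\<integral>\<^sup>+t. a t \<partial>lborel)"
    using h by (simp add: mult.assoc[symmetric] flip: ennreal_mult')
  finally show ?thesis by (simp add: a_def)
qed

lemma L2_steklov:
  assumes f: "f \<in> borel_measurable borel" "integrable lborel (\<lambda>x. (norm (f x))\<^sup>2)" and h: "h > 0"
  shows "integrable lborel (\<lambda>x. (norm (steklov h f x))\<^sup>2)"
    and "(LBINT x. (norm (steklov h f x))\<^sup>2) \<le> (LBINT x. (norm (f x))\<^sup>2)"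
proof -
  note [measurable] = f(1) steklov_measurable[OF f(1), of h]
  have le: "(\<integral>\<^sup>+x. ennreal ((norm (steklov h f x))\<^sup>2) \<partial>lborel) \<le> ennreal (LBINT x. (norm (f x))\<^sup>2)"
    using steklov_L2_bound[OF L2_loc_integrable[OF f] h] f(2) by (simp add: nn_integral_eq_integral)
  then show int: "integrable lborel (\<lambda>x. (norm (steklov h f x))\<^sup>2)"
    using order_le_less_trans[OF le ennreal_less_top] by (intro integrableI_bounded) auto
  have "ennreal (LBINT x. (norm (steklov h f x))\<^sup>2) \<le> ennreal (LBINT x. (norm (f x))\<^sup>2)"
    using le nn_integral_eq_integral[OF int] by simp
  then show "(LBINT x. (norm (steklov h f x))\<^sup>2) \<le> (LBINT x. (norm (f x))\<^sup>2)"
    by (subst (asm) ennreal_le_iff) (auto intro: integral_nonneg_AE)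
qed

lemma AE_steklov_lim:
  assumes f: "L2_loc f"
  shows "AE x in lborel. (\<lambda>n. steklov (inverse (real (Suc n))) f x) \<longlonglongrightarrow> f x"
proof -
  have "L1_loc UNIV f" by (rule L2_loc_L1_loc[OF f])
  then have "AE x in lebesgue. (\<lambda>n. real (Suc n) *\<^sub>R integral {x..x + inverse (real (Suc n))} f) \<longlonglongrightarrow> f x"
    using AE_lebesgue_point[of UNIV f] by simp
  moreover have "real (Suc n) *\<^sub>R integral {x..x + inverse (real (Suc n))} f = steklov (inverse (real (Suc n))) f x" for x n
    unfolding steklov_def by (simp add: set_borel_integral_eq_integral(2)[OF L2_loc_set_integrable[OF f]])
  ultimately show ?thesis by (simp only: AE_completion_iff)
qed

text \<open>Almost everywhere convergence without loss of norm is convergence in \<open>L\<^sup>2\<close>, by Fatou's lemma.\<close>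

lemma L2_steklov_lim:
  assumes f: "f \<in> borel_measurable borel" "integrable lborel (\<lambda>x. (norm (f x))\<^sup>2)"
  shows "(\<lambda>n. LBINT x. (norm (steklov (inverse (real (Suc n))) f x - f x))\<^sup>2) \<longlonglongrightarrow> 0"
proof -
  define S where "S n = steklov (inverse (real (Suc n))) f" for n
  define A where "A = (LBINT x. (norm (f x))\<^sup>2)"
  define B where "B n = (LBINT x. (norm (S n x - f x))\<^sup>2)" for n
  \<comment> \<open>This is the function for Fatou's lemma: it is nonnegative, tends to
    \<open>4 * (norm (f x))^2\<close> almost everywhere, and has integral at most
    \<open>4 * A - B n\<close> since averaging does not increase the norm. Thus \<open>B\<close>
    tends to 0 without a dominating function.\<close>
  define d where "d n x = 2 * (norm (S n x))\<^sup>2 + 2 * (norm (f x))\<^sup>2 - (norm (S n x - f x))\<^sup>2" for n x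
  note [measurable] = f(1)
  have [measurable]: "S n \<in> borel_measurable borel" for n
    unfolding S_def by (rule steklov_measurable[OF f(1)])
  have iS: "integrable lborel (\<lambda>x. (norm (S n x))\<^sup>2)" and SA: "(LBINT x. (norm (S n x))\<^sup>2) \<le> A" for n
    unfolding S_def A_def by (intro L2_steklov f; simp)+
  have iB: "integrable lborel (\<lambda>x. (norm (S n x - f x))\<^sup>2)" for n
  proof (rule Bochner_Integration.integrable_bound)
    show "integrable lborel (\<lambda>x. 2 * (norm (S n x))\<^sup>2 + 2 * (norm (f x))\<^sup>2)"
      using iS f(2) by simp
    show "AE x in lborel. norm ((norm (S n x - f x))\<^sup>2) \<le> norm (2 * (norm (S n x))\<^sup>2 + 2 * (norm (f x))\<^sup>2)"
      using norm_diff_squared_le[of "S n _" "f _"] by auto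
  qed measurable
  have d0: "d n x \<ge> 0" for n x
    using norm_diff_squared_le[of "S n x" "f x"] by (simp add: d_def)
  have id: "integrable lborel (d n)" for n
    unfolding d_def using iS iB f(2) by simp
  have Id: "(LBINT x. d n x) \<le> 4 * A - B n" for n
    unfolding d_def using iS iB f(2) SA[of n] by (simp add: A_def[symmetric] B_def[symmetric])
  have "AE x in lborel. (\<lambda>n. S n x) \<longlonglongrightarrow> f x"
    unfolding S_def by (rule AE_steklov_lim[OF L2_loc_integrable[OF f]])
  then have "AE x in lborel. liminf (\<lambda>n. ennreal (d n x)) = ennreal (4 * (norm (f x))\<^sup>2)"
  proof eventually_elim
    case (elim x)
    have "(\<lambda>n. d n x) \<longlonglongrightarrow> 2 * (norm (f x))\<^sup>2 + 2 * (norm (f x))\<^sup>2 - (norm (f x - f x))\<^sup>2"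
      unfolding d_def using elim by (intro tendsto_intros)
    then have "(\<lambda>n. ennreal (d n x)) \<longlonglongrightarrow> ennreal (4 * (norm (f x))\<^sup>2)"
      by (intro tendsto_ennrealI) simp
    then show ?case by (rule lim_imp_Liminf[rotated]) simp
  qed
  then have "(\<integral>\<^sup>+x. ennreal (4 * (norm (f x))\<^sup>2) \<partial>lborel) = (\<integral>\<^sup>+x. liminf (\<lambda>n. ennreal (d n x)) \<partial>lborel)"
    by (intro nn_integral_cong_AE) (auto elim: eventually_mono)
  also have "\<dots> \<le> liminf (\<lambda>n. \<integral>\<^sup>+x. ennreal (d n x) \<partial>lborel)"
    using id by (intro nn_integral_liminf) auto
  also have "\<dots> \<le> liminf (\<lambda>n. ennreal (4 * A - B n))"
  proof (intro Liminf_mono always_eventually allI)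
    fix n
    show "(\<integral>\<^sup>+x. ennreal (d n x) \<partial>lborel) \<le> ennreal (4 * A - B n)"
      using d0 Id[of n] by (subst nn_integral_eq_integral[OF id]) (auto intro: ennreal_leI)
  qed
  also have "(\<integral>\<^sup>+x. ennreal (4 * (norm (f x))\<^sup>2) \<partial>lborel) = ennreal (4 * A)"
    using f(2) by (subst nn_integral_eq_integral) (auto simp: A_def)
  finally have lim: "ennreal (4 * A) \<le> liminf (\<lambda>n. ennreal (4 * A - B n))" .
  have B0: "B n \<ge> 0" for n unfolding B_def by (intro integral_nonneg_AE) simp
  have B4: "B n \<le> 4 * A" for n
  proof -
    have "0 \<le> (LBINT x. d n x)" by (intro integral_nonneg_AE) (simp add: d0)
    then show ?thesis using Id[of n] by simp
  qed
  have A0: "A \<ge> 0" unfolding A_def by (intro integral_nonneg_AE) simp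
  have "B \<longlonglongrightarrow> 0"
  proof (rule LIMSEQ_I)
    fix e :: real assume e: "e > 0"
    \<comment> \<open>The case split avoids truncation in the extended nonnegative reals:
      \<open>ennreal (4 * A - e)\<close> is informative only if \<open>e \<le> 4 * A\<close>, and
      otherwise \<open>B n \<le> 4 * A < e\<close> already.\<close>
    show "\<exists>no. \<forall>n\<ge>no. norm (B n - 0) < e"
    proof (cases "4 * A < e")
      case True
      then show ?thesis using B4 B0 by (auto intro!: exI[of _ 0] intro: le_less_trans)
    next
      case False
      then have "ennreal (4 * A - e) < ennreal (4 * A)"
        using e by (intro ennreal_lessI) auto
      then have "\<forall>\<^sub>F n in sequentially. ennreal (4 * A - e) < ennreal (4 * A - B n)"
        using lim unfolding le_Liminf_iff by blast
      then have "\<forall>\<^sub>F n in sequentially. B n < e"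
        by eventually_elim (use False B4 in \<open>auto simp: ennreal_less_iff\<close>)
      then show ?thesis using B0 by (auto simp: eventually_sequentially)
    qed
  qed
  then show ?thesis unfolding B_def[abs_def] S_def .
qed

lemma L2_loc_steklov_lim:
  assumes f: "L2_loc f"
  shows "(\<lambda>n. LBINT x:{p..q}. (norm (steklov (inverse (real (Suc n))) f x - f x))\<^sup>2) \<longlonglongrightarrow> 0"
proof -
  \<comment> \<open>The cut-off extends to \<open>q + 1\<close> because windows of length at most 1
    starting in \<open>{p..q}\<close> reach that far; on \<open>{p..q}\<close> the means of
    \<open>f\<close> and of \<open>g\<close> coincide.\<close>
  define g where "g x = indicator {p..q + 1} x *\<^sub>R f x" for x
  note [measurable] = L2_loc_measurable[OF f]
  have g: "g \<in> borel_measurable borel" unfolding g_def[abs_def] by measurable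
  have "(\<lambda>x. (norm (g x))\<^sup>2) = (\<lambda>x. indicator {p..q + 1} x *\<^sub>R (norm (f x))\<^sup>2)"
    by (auto simp: g_def indicator_def)
  then have ig: "integrable lborel (\<lambda>x. (norm (g x))\<^sup>2)"
    using L2_loc_square[OF f, of p "q + 1"] by (simp add: set_integrable_def)
  show ?thesis
  proof (rule tendsto_sandwich[OF _ _ tendsto_const L2_steklov_lim[OF g ig]])
    show "\<forall>\<^sub>F n in sequentially. 0 \<le> (LBINT x:{p..q}. (norm (steklov (inverse (real (Suc n))) f x - f x))\<^sup>2)"
      unfolding set_lebesgue_integral_def by (intro always_eventually allI integral_nonneg_AE AE_I2) simp
    show "\<forall>\<^sub>F n in sequentially. (LBINT x:{p..q}. (norm (steklov (inverse (real (Suc n))) f x - f x))\<^sup>2)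
        \<le> (LBINT x. (norm (steklov (inverse (real (Suc n))) g x - g x))\<^sup>2)"
    proof (intro always_eventually allI)
      fix n
      define h where "h = inverse (real (Suc n))"
      have h: "0 < h" "h \<le> 1" by (auto simp: h_def inverse_le_1_iff)
      have "steklov h f x = steklov h g x" if "x \<in> {p..q}" for x
        unfolding steklov_def set_lebesgue_integral_def
        by (intro arg_cong[where f = "\<lambda>u. u /\<^sub>R h"] Bochner_Integration.integral_cong)
           (use h that in \<open>auto simp: g_def indicator_def\<close>)
      then have le: "indicator {p..q} x *\<^sub>R (norm (steklov h f x - f x))\<^sup>2 \<le> (norm (steklov h g x - g x))\<^sup>2" for x
        by (auto simp: indicator_def g_def)
      have [measurable]: "steklov h f \<in> borel_measurable borel" "steklov h g \<in> borel_measurable borel"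
        using steklov_measurable g L2_loc_measurable[OF f] by auto
      note [measurable] = g
      have int: "integrable lborel (\<lambda>x. (norm (steklov h g x - g x))\<^sup>2)"
      proof (rule Bochner_Integration.integrable_bound)
        show "integrable lborel (\<lambda>x. 2 * (norm (steklov h g x))\<^sup>2 + 2 * (norm (g x))\<^sup>2)"
          using L2_steklov(1)[OF g ig h(1)] ig by simp
        show "AE x in lborel. norm ((norm (steklov h g x - g x))\<^sup>2) \<le> norm (2 * (norm (steklov h g x))\<^sup>2 + 2 * (norm (g x))\<^sup>2)"
          using norm_diff_squared_le[of "steklov h g _" "g _"] by auto
      qed measurable
      have "(LBINT x:{p..q}. (norm (steklov h f x - f x))\<^sup>2) \<le> (LBINT x. (norm (steklov h g x - g x))\<^sup>2)"
        unfolding set_lebesgue_integral_def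
      proof (rule integral_mono)
        show "integrable lborel (\<lambda>x. indicator {p..q} x *\<^sub>R (norm (steklov h f x - f x))\<^sup>2)"
          by (rule Bochner_Integration.integrable_bound[OF int]) (use le in \<open>measurable, auto\<close>)
      qed (use int le in auto)
      then show "(LBINT x:{p..q}. (norm (steklov (inverse (real (Suc n))) f x - f x))\<^sup>2)
        \<le> (LBINT x. (norm (steklov (inverse (real (Suc n))) g x - g x))\<^sup>2)" by (simp add: h_def)
    qed
  qed
qed

subsection \<open>Energy estimate\<close>

lemma integral_antiderivative:
  fixes f :: "real \<Rightarrow> real"
  assumes "\<And>x. (F has_real_derivative f x) (at x)" "p \<le> q"
  shows "integral {p..q} f = F q - F p"
  by (intro integral_unique fundamental_theorem_of_calculus assms(2))
     (use assms(1) in \<open>auto simp: has_real_derivative_iff_has_vector_derivative intro: has_vector_derivative_at_within\<close>)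

lemma DERIV_le_increment:
  fixes F G :: "real \<Rightarrow> real"
  assumes "p \<le> q" "\<And>x. p \<le> x \<Longrightarrow> x \<le> q \<Longrightarrow> (F has_real_derivative f x) (at x)"
    "\<And>x. p \<le> x \<Longrightarrow> x \<le> q \<Longrightarrow> (G has_real_derivative g x) (at x)"
    "\<And>x. p \<le> x \<Longrightarrow> x \<le> q \<Longrightarrow> f x \<le> g x"
  shows "F q - F p \<le> G q - G p"
proof -
  have "G p - F p \<le> G q - F q"
  proof (rule DERIV_nonneg_imp_nondecreasing[OF assms(1)])
    fix x assume "p \<le> x" "x \<le> q"
    then show "\<exists>y. ((\<lambda>x. G x - F x) has_real_derivative y) (at x) \<and> 0 \<le> y"
      using assms(2-4)[of x] by (intro exI[of _ "g x - f x"] conjI DERIV_diff) auto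
  qed
  then show ?thesis by simp
qed

text \<open>The identity behind the modulus comparison of roots, homogenised: \<open>v\<close>
  stands for the derivative and \<open>u\<close> for the value, and
  \<open>2 * (u \<bullet> v)\<close> is the derivative of the squared norm.\<close>

lemma energy_identity:
  fixes u v :: complex and a b :: real
  shows "(norm (v - b * u))\<^sup>2 - (norm (v + a * u))\<^sup>2 + (a + b) * (2 * (u \<bullet> v)) = (b\<^sup>2 - a\<^sup>2) * (norm u)\<^sup>2"
  unfolding cmod_power2 inner_complex_def by (simp add: power2_eq_square algebra_simps)

lemma norm_square_DERIV:
  assumes "(z has_vector_derivative z') (at t)"
  shows "((\<lambda>t. (norm (z t :: complex))\<^sup>2) has_real_derivative 2 * (z t \<bullet> z')) (at t)"
proof -
  have D: "((\<lambda>t. Re (z t)) has_real_derivative Re z') (at t)" "((\<lambda>t. Im (z t)) has_real_derivative Im z') (at t)"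
    using bounded_linear.has_vector_derivative[OF bounded_linear_Re assms]
      bounded_linear.has_vector_derivative[OF bounded_linear_Im assms]
    by (simp_all add: has_real_derivative_iff_has_vector_derivative)
  show ?thesis
    unfolding cmod_power2 inner_complex_def
    by (rule DERIV_cong[OF DERIV_add[OF DERIV_power[OF D(1), of 2] DERIV_power[OF D(2), of 2]]]) simp
qed

lemma two_inner_le:
  fixes u v :: complex
  assumes "c > 0"
  shows "2 * (u \<bullet> v) \<le> c * (norm u)\<^sup>2 + (norm v)\<^sup>2 / c"
proof -
  have "0 \<le> (norm (c *\<^sub>R u - v))\<^sup>2 / c" using assms by simp
  also have "(norm (c *\<^sub>R u - v))\<^sup>2 = c\<^sup>2 * (norm u)\<^sup>2 - c * (2 * (u \<bullet> v)) + (norm v)\<^sup>2"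
    unfolding cmod_power2 inner_complex_def by (simp add: power2_eq_square algebra_simps)
  also have "\<dots> / c = c * (norm u)\<^sup>2 - 2 * (u \<bullet> v) + (norm v)\<^sup>2 / c"
    using assms by (simp add: power2_eq_square field_simps)
  finally show ?thesis by simp
qed

lemma norm_lin_comb_squared_le:
  fixes u v :: complex and b :: real
  shows "(norm (v - b * u))\<^sup>2 \<le> 2 * (norm v)\<^sup>2 + 2 * b\<^sup>2 * (norm u)\<^sup>2"
    and "(norm v)\<^sup>2 \<le> 2 * (norm (v - b * u))\<^sup>2 + 2 * b\<^sup>2 * (norm u)\<^sup>2"
proof -
  have *: "(norm (x + y))\<^sup>2 \<le> 2 * (norm x)\<^sup>2 + 2 * (norm y)\<^sup>2" for x y :: complex
    using two_inner_le[of 1 x y] by (simp add: power2_norm_eq_inner inner_add_left inner_add_right inner_commute)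
  show "(norm (v - b * u))\<^sup>2 \<le> 2 * (norm v)\<^sup>2 + 2 * b\<^sup>2 * (norm u)\<^sup>2"
    using *[of v "- (b * u)"] by (simp add: norm_mult power_mult_distrib)
  show "(norm v)\<^sup>2 \<le> 2 * (norm (v - b * u))\<^sup>2 + 2 * b\<^sup>2 * (norm u)\<^sup>2"
    using *[of "v - b * u" "b * u"] by (simp add: norm_mult power_mult_distrib)
qed

text \<open>Along classical solutions the energy
  \<open>e t = \<integral>\<^bsub>t-1\<^esub>\<^bsup>t\<^esup> \<bar>z' - b z\<bar>\<^sup>2 + \<kappa> \<bar>z\<bar>\<^sup>2 + (a + b) \<bar>z t\<bar>\<^sup>2\<close>
  satisfies \<open>e' t = - \<kappa> (\<bar>z t\<bar>\<^sup>2 + \<bar>z (t - 1)\<bar>\<^sup>2)\<close>. It controls the forcing term of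
  \<open>z' t + a z t = (z' - b z) (t - 1)\<close>, which in turn bounds \<open>z\<close>.\<close>

lemma classical_energy_estimate:
  fixes a b :: real and z z' :: "real \<Rightarrow> complex"
  defines "\<kappa> \<equiv> (a\<^sup>2 - b\<^sup>2) / 2"
  defines "c2 \<equiv> 2 + 2 * b\<^sup>2 + \<kappa> + 2 * (a + b)"
  defines "c3 \<equiv> 2 + c2 / (a * (1 - exp (- a)))"
  assumes a: "a > 0" and ab: "a + b \<ge> 0" and k: "\<kappa> \<ge> 0"
    and dz: "\<And>t. (z has_vector_derivative z' t) (at t)" and cz': "continuous_on UNIV z'"
    and eq: "\<And>t. t \<ge> 0 \<Longrightarrow> z' t - z' (t - 1) + of_real a * z t + of_real b * z (t - 1) = 0"
    and t: "t \<ge> 0"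
  shows "\<kappa> * integral {0..t} (\<lambda>s. (norm (z s))\<^sup>2) \<le> c2 * integral {-1..0} (\<lambda>s. (norm (z s))\<^sup>2 + (norm (z' s))\<^sup>2)"
    and "integral {t - 1..t} (\<lambda>s. (norm (z s))\<^sup>2 + (norm (z' s))\<^sup>2) \<le>
      ((1 + 2 * b\<^sup>2) * (c3 + 1) + 2 * c2) * integral {-1..0} (\<lambda>s. (norm (z s))\<^sup>2 + (norm (z' s))\<^sup>2)"
proof -
  define m where "m s = (norm (z s))\<^sup>2" for s
  define n where "n s = (norm (z s))\<^sup>2 + (norm (z' s))\<^sup>2" for s
  define v where "v s = (norm (z' s - of_real b * z s))\<^sup>2" for s
  have m0: "m s \<ge> 0" and v0: "v s \<ge> 0" and mn: "m s \<le> n s" for s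
    by (simp_all add: m_def v_def n_def)
  have cz: "continuous_on UNIV z"
    using dz by (meson continuous_at_imp_continuous_on has_vector_derivative_continuous)
  have "continuous_on UNIV m" "continuous_on UNIV n" "continuous_on UNIV v"
    unfolding m_def[abs_def] n_def[abs_def] v_def[abs_def] using cz cz' by (auto intro!: continuous_intros)
  then obtain M N V where M: "\<And>x. (M has_real_derivative m x) (at x)"
    and N: "\<And>x. (N has_real_derivative n x) (at x)" and V: "\<And>x. (V has_real_derivative v x) (at x)"
    by (metis continuous_antiderivative_real)
  define N0 where "N0 = N 0 - N (-1)"
  have dm: "(m has_real_derivative 2 * (z s \<bullet> z' s)) (at s)" for s
    unfolding m_def[abs_def] by (rule norm_square_DERIV[OF dz])
  have mono: "V p \<le> V q" "M p \<le> M q" "N p \<le> N q" if "p \<le> q" for p q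
    using DERIV_le_increment[OF that DERIV_const[of 0] V] DERIV_le_increment[OF that DERIV_const[of 0] M]
      DERIV_le_increment[OF that DERIV_const[of 0] N] v0 m0 order_trans[OF m0 mn] by auto
  have N0: "N0 \<ge> 0" unfolding N0_def using mono(3)[of "-1" 0] by simp
  have M0: "M 0 - M (-1) \<le> N0"
    unfolding N0_def by (rule DERIV_le_increment[OF _ M N mn]) simp
  \<comment> \<open>A one-dimensional Sobolev bound: \<open>m 0 - m s \<le> N0\<close> throughout
    the unit interval, and integrating over \<open>s\<close> bounds \<open>m 0\<close> by
    \<open>N0\<close> plus the integral of \<open>m\<close>.\<close>
  have m_0: "m 0 \<le> 2 * N0"
  proof -
    have "m 0 - N0 \<le> m s" if "-1 \<le> s" "s \<le> 0" for s
    proof -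
      have "m 0 - m s \<le> N 0 - N s"
        using two_inner_le[of 1] by (intro DERIV_le_increment[OF that(2) dm N]) (auto simp: n_def)
      also have "\<dots> \<le> N0" unfolding N0_def using mono(3)[OF that(1)] by simp
      finally show ?thesis by simp
    qed
    then have "(m 0 - N0) * 0 - (m 0 - N0) * (-1) \<le> M 0 - M (-1)"
      by (intro DERIV_le_increment[OF _ _ M]) (auto intro!: derivative_eq_intros)
    then show ?thesis using M0 by simp
  qed
  define e where "e s = V s - V (s - 1) + \<kappa> * (M s - M (s - 1)) + (a + b) * m s" for s
  \<comment> \<open>Of the dissipation \<open>\<kappa> * (m r + m (r - 1))\<close> the first part is
    moved to the left, where it will bound the square integral of \<open>z\<close>; the second is
    discarded.\<close>
  have energy: "e s + \<kappa> * (M s - M 0) \<le> e 0" if "s \<ge> 0" for s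
  proof -
    have "e s + \<kappa> * M s \<le> e 0 + \<kappa> * M 0"
    proof (rule DERIV_nonpos_imp_nonincreasing[OF that])
      fix r :: real assume r: "0 \<le> r"
      have "v (r - 1) = (norm (z' r + of_real a * z r))\<^sup>2"
        unfolding v_def using eq[OF r] by (intro arg_cong[where f = "\<lambda>x. (norm x)\<^sup>2"]) (simp add: algebra_simps)
      then have h1: "v r - v (r - 1) + (a + b) * (2 * (z r \<bullet> z' r)) = - 2 * \<kappa> * m r"
        unfolding v_def m_def using energy_identity[of "z' r" b "z r" a] by (simp add: \<kappa>_def field_simps)
      have D: "((\<lambda>s. e s + \<kappa> * M s) has_real_derivative
          v r - v (r - 1) + \<kappa> * (m r - m (r - 1)) + (a + b) * (2 * (z r \<bullet> z' r)) + \<kappa> * m r) (at r)"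
        unfolding e_def[abs_def]
        by (rule derivative_eq_intros V M dm DERIV_chain2[where g = "\<lambda>s. s - 1"] refl | simp)+
      have h3: "0 \<le> \<kappa> * m (r - 1)" using k m0 by simp
      show "\<exists>y. ((\<lambda>s. e s + \<kappa> * M s) has_real_derivative y) (at r) \<and> y \<le> 0"
        by (rule exI, rule conjI, rule D) (use h1 h3 in \<open>simp add: algebra_simps\<close>)
    qed
    then show ?thesis by (simp add: algebra_simps)
  qed
  \<comment> \<open>Origin of \<open>c2\<close>: the window of \<open>v\<close> contributes
    \<open>2 + 2 * b^2\<close>, the window of \<open>m\<close> contributes \<open>\<kappa>\<close>,
    and the point value contributes \<open>2 * (a + b)\<close> through
    \<open>m 0 \<le> 2 * N0\<close>.\<close>
  have e0: "e 0 \<le> c2 * N0"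
  proof -
    have "V 0 - V (-1) \<le> (2 + 2 * b\<^sup>2) * N 0 - (2 + 2 * b\<^sup>2) * N (-1)"
    proof (rule DERIV_le_increment[OF _ V])
      show "((\<lambda>x. (2 + 2 * b\<^sup>2) * N x) has_real_derivative (2 + 2 * b\<^sup>2) * n x) (at x)" for x
        by (intro DERIV_cmult N)
      show "v x \<le> (2 + 2 * b\<^sup>2) * n x" for x
      proof -
        have "v x \<le> 2 * (norm (z' x))\<^sup>2 + 2 * b\<^sup>2 * (norm (z x))\<^sup>2"
          unfolding v_def by (rule norm_lin_comb_squared_le)
        also have "\<dots> \<le> (2 + 2 * b\<^sup>2) * n x"
          by (simp add: n_def algebra_simps)
        finally show ?thesis .
      qed
    qed simp
    moreover have "\<kappa> * (M 0 - M (-1)) \<le> \<kappa> * N0" using M0 k by (intro mult_left_mono)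
    moreover have "(a + b) * m 0 \<le> (a + b) * (2 * N0)" using m_0 ab by (intro mult_left_mono)
    ultimately show ?thesis by (simp add: e_def c2_def N0_def algebra_simps)
  qed
  have Me: "\<kappa> * (M s - M (s - 1)) \<ge> 0" "(a + b) * m s \<ge> 0" "\<kappa> * (M s - M 0) \<ge> 0" if "s \<ge> 0" for s
    using mono(2)[of "s - 1" s] mono(2)[of 0 s] k ab m0 that by auto
  have VE: "V s - V (s - 1) \<le> c2 * N0" if "s \<ge> 0" for s
    using energy[OF that] e0 Me[OF that] by (simp add: e_def)
  have "\<kappa> * (M t - M 0) \<le> c2 * N0"
    using energy[OF t] e0 Me[OF t] mono(1)[of "t - 1" t] by (simp add: e_def)
  then show "\<kappa> * integral {0..t} (\<lambda>s. (norm (z s))\<^sup>2) \<le> c2 * integral {-1..0} (\<lambda>s. (norm (z s))\<^sup>2 + (norm (z' s))\<^sup>2)"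
    using integral_antiderivative[OF M t] integral_antiderivative[OF N, of "-1" 0] unfolding m_def n_def N0_def by simp
  define E where "E = c2 * N0"
  \<comment> \<open>Variation of constants for \<open>z' + a z = w\<close>, where the squared norm
    of \<open>w\<close> is \<open>v\<close> one unit earlier. Young's inequality with weight
    \<open>a\<close> spends half of the damping \<open>2 * a * m\<close> on the forcing; the other
    half remains as the factor \<open>exp (- a * (q - p))\<close>.\<close>
  have step: "m q \<le> exp (- a * (q - p)) * m p + (V (q - 1) - V (p - 1)) / a" if "0 \<le> p" "p \<le> q" for p q
  proof -
    have "exp (a * q) * m q - exp (a * p) * m p \<le> exp (a * q) * (V (q - 1) / a) - exp (a * q) * (V (p - 1) / a)"
    proof (rule DERIV_le_increment[OF that(2)])
      fix s assume s: "p \<le> s" "s \<le> q"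
      show "((\<lambda>s. exp (a * s) * m s) has_real_derivative exp (a * s) * (a * m s + 2 * (z s \<bullet> z' s))) (at s)"
        by (rule derivative_eq_intros dm refl | simp add: algebra_simps)+
      show "((\<lambda>s. exp (a * q) * (V (s - 1) / a)) has_real_derivative exp (a * q) * (v (s - 1) / a)) (at s)"
        by (rule derivative_eq_intros V DERIV_chain2[where g = "\<lambda>s. s - 1"] refl | simp add: a less_imp_neq[OF a, symmetric])+
      define w where "w = z' s + of_real a * z s"
      have "0 \<le> s" using s that by simp
      then have vw: "v (s - 1) = (norm w)\<^sup>2"
        unfolding v_def w_def using eq by (intro arg_cong[where f = "\<lambda>x. (norm x)\<^sup>2"]) (simp add: algebra_simps)
      have "a * m s + 2 * (z s \<bullet> z' s) = 2 * (z s \<bullet> w) - a * m s"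
        unfolding w_def m_def cmod_power2 inner_complex_def by (simp add: power2_eq_square algebra_simps)
      also have "\<dots> \<le> v (s - 1) / a"
        using two_inner_le[OF a, of "z s" w] by (simp add: vw m_def)
      finally have "exp (a * s) * (a * m s + 2 * (z s \<bullet> z' s)) \<le> exp (a * s) * (v (s - 1) / a)"
        by (intro mult_left_mono) auto
      also have "\<dots> \<le> exp (a * q) * (v (s - 1) / a)"
        using s a v0 by (intro mult_right_mono) auto
      finally show "exp (a * s) * (a * m s + 2 * (z s \<bullet> z' s)) \<le> exp (a * q) * (v (s - 1) / a)" .
    qed
    then have "exp (a * q) * m q \<le> exp (a * q) * (exp (- a * (q - p)) * m p + (V (q - 1) - V (p - 1)) / a)"
      by (simp add: algebra_simps diff_divide_distrib flip: exp_add)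
    then show ?thesis by simp
  qed
  \<comment> \<open>The second summand is the fixed point of
    \<open>x \<mapsto> exp (- a) * x + E / a\<close>, the recursion over one unit of time;
    \<open>2 * N0\<close> makes room for \<open>m 0\<close>. Over a unit step the forcing is a
    single window of \<open>v\<close>, hence at most \<open>E\<close>, which is why the induction
    proceeds by unit intervals.\<close>
  define K where "K = 2 * N0 + E / (a * (1 - exp (- a)))"
  have ea: "0 < 1 - exp (- a)" "1 - exp (- a) \<le> 1" using a by auto
  have "c2 \<ge> 0" using k ab by (simp add: c2_def)
  then have E0: "E \<ge> 0" using N0 by (simp add: E_def)
  have EK: "E / a \<le> E / (a * (1 - exp (- a)))"
    using ea a E0 by (intro divide_left_mono) (auto intro: mult_left_le)
  have K: "exp (- a) * K + E / a \<le> K"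
  proof -
    have "E / a = (1 - exp (- a)) * (E / (a * (1 - exp (- a))))" using ea a by simp
    also have "\<dots> \<le> (1 - exp (- a)) * K" using ea N0 by (intro mult_left_mono) (auto simp: K_def)
    finally show ?thesis by (simp add: algebra_simps)
  qed
  have mK: "\<forall>s. 0 \<le> s \<and> s \<le> real (Suc i) \<longrightarrow> m s \<le> K" for i
  proof (induction i)
    case 0
    show ?case
    proof (intro allI impI)
      fix s :: real assume s: "0 \<le> s \<and> s \<le> real (Suc 0)"
      have "m s \<le> exp (- a * (s - 0)) * m 0 + (V (s - 1) - V (0 - 1)) / a"
        using s by (intro step) auto
      also have "\<dots> \<le> 1 * m 0 + E / a"
      proof (intro add_mono mult_right_mono divide_right_mono)
        show "V (s - 1) - V (0 - 1) \<le> E"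
          using mono(1)[of "s - 1" 0] VE[of 0] s by (simp add: E_def)
      qed (use s a m0 in auto)
      also have "\<dots> \<le> K" using m_0 EK by (simp add: K_def)
      finally show "m s \<le> K" .
    qed
  next
    case (Suc i)
    show ?case
    proof (intro allI impI)
      fix s :: real assume s: "0 \<le> s \<and> s \<le> real (Suc (Suc i))"
      show "m s \<le> K"
      proof (cases "s \<le> 1")
        case True
        then show ?thesis using s Suc.IH by auto
      next
        case False
        have "m s \<le> exp (- a * (s - (s - 1))) * m (s - 1) + (V (s - 1) - V (s - 1 - 1)) / a"
          using False by (intro step) auto
        also have "\<dots> \<le> exp (- a) * K + E / a"
          using Suc.IH s False VE[of "s - 1"] a
          by (intro add_mono divide_right_mono) (auto simp: E_def)
        finally show ?thesis using K by linarith
      qed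
    qed
  qed
  have mK: "m s \<le> K" if "s \<ge> 0" for s
  proof -
    obtain i where "s \<le> real i" using real_arch_simple by blast
    then show ?thesis using mK[of i] that by auto
  qed
  have K0: "K \<ge> 0" using mK[of 0] m0[of 0] by simp
  have Mt: "M t - M (t - 1) \<le> K + N0"
  proof -
    \<comment> \<open>For \<open>t < 1\<close> the window straddles 0: its part in the history is
      controlled by \<open>N0\<close>, the rest by \<open>K\<close>.\<close>
    define r where "r = max 0 (t - 1)"
    have r: "0 \<le> r" "r \<le> t" "t - r \<le> 1" using t by (auto simp: r_def)
    have "M t - M r \<le> K * t - K * r"
      using r mK by (intro DERIV_le_increment[OF _ M]) (auto intro!: derivative_eq_intros)
    also have "\<dots> \<le> K" using mult_left_mono[OF r(3) K0] by (simp add: algebra_simps)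
    finally have "M t - M r \<le> K" .
    moreover have "M r - M (t - 1) \<le> N0"
    proof (cases "t \<ge> 1")
      case False
      then have "M (-1) \<le> M (t - 1)" "r = 0" using t mono(2)[of "-1" "t - 1"] by (auto simp: r_def)
      then show ?thesis using M0 by simp
    qed (use N0 in \<open>auto simp: r_def\<close>)
    ultimately show ?thesis by simp
  qed
  have "K = c3 * N0" by (simp add: K_def c3_def E_def algebra_simps)
  have "N t - N (t - 1) \<le> ((1 + 2 * b\<^sup>2) * M t + 2 * V t) - ((1 + 2 * b\<^sup>2) * M (t - 1) + 2 * V (t - 1))"
  proof (rule DERIV_le_increment[OF _ N])
    show "((\<lambda>t. (1 + 2 * b\<^sup>2) * M t + 2 * V t) has_real_derivative (1 + 2 * b\<^sup>2) * m s + 2 * v s) (at s)" for s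
      by (intro DERIV_add DERIV_cmult M V)
    show "n s \<le> (1 + 2 * b\<^sup>2) * m s + 2 * v s" for s
      using norm_lin_comb_squared_le(2)[of "z' s" b "z s"] by (simp add: n_def m_def v_def algebra_simps)
  qed simp
  also have "\<dots> = (1 + 2 * b\<^sup>2) * (M t - M (t - 1)) + 2 * (V t - V (t - 1))"
    by (simp add: algebra_simps)
  also have "\<dots> \<le> (1 + 2 * b\<^sup>2) * (K + N0) + 2 * (c2 * N0)"
    using Mt VE[OF t] by (intro add_mono mult_left_mono) auto
  also have "\<dots> = ((1 + 2 * b\<^sup>2) * (c3 + 1) + 2 * c2) * N0"
    unfolding \<open>K = c3 * N0\<close> by (simp add: algebra_simps)
  finally show "integral {t - 1..t} (\<lambda>s. (norm (z s))\<^sup>2 + (norm (z' s))\<^sup>2) \<le>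
      ((1 + 2 * b\<^sup>2) * (c3 + 1) + 2 * c2) * integral {-1..0} (\<lambda>s. (norm (z s))\<^sup>2 + (norm (z' s))\<^sup>2)"
    using integral_antiderivative[OF N, of "t - 1" t] integral_antiderivative[OF N, of "-1" 0] unfolding n_def N0_def by simp
qed

subsection \<open>Absolutely continuous solutions\<close>

definition is_primitive :: "(real \<Rightarrow> complex) \<Rightarrow> (real \<Rightarrow> complex) \<Rightarrow> bool" where
  "is_primitive Y g \<longleftrightarrow> (\<forall>p q. p \<le> q \<longrightarrow> Y q - Y p = (LBINT s:{p..q}. g s))"

lemma is_primitiveD: "is_primitive Y g \<Longrightarrow> p \<le> q \<Longrightarrow> Y q - Y p = (LBINT s:{p..q}. g s)"
  by (simp add: is_primitive_def)

text \<open>The density \<open>g\<close> is carried along as data, so that differences, translates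
  and means act on the pair and no derivative has to be chosen again.\<close>

definition ac_solution :: "real \<Rightarrow> real \<Rightarrow> (real \<Rightarrow> complex) \<Rightarrow> (real \<Rightarrow> complex) \<Rightarrow> bool" where
  "ac_solution a b Y g \<longleftrightarrow> L2_loc g \<and> is_primitive Y g \<and>
     (AE t in lborel. t \<ge> 0 \<longrightarrow> g t - g (t - 1) + of_real a * Y t + of_real b * Y (t - 1) = 0)"

definition H1sq :: "real \<Rightarrow> real \<Rightarrow> (real \<Rightarrow> complex) \<Rightarrow> (real \<Rightarrow> complex) \<Rightarrow> real" where
  "H1sq p q Y g = (LBINT s:{p..q}. (norm (Y s))\<^sup>2 + (norm (g s))\<^sup>2)"

lemma increment_continuous:
  assumes g: "L2_loc g" and inc: "is_primitive Y g"
  shows "continuous_on UNIV Y"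
proof -
  have "isCont Y x" for x
  proof -
    have "continuous_on {x - 1..x + 1} (\<lambda>t. Y (x - 1) + integral {x - 1..t} g)"
      using set_borel_integral_eq_integral(1)[OF L2_loc_set_integrable[OF g]]
      by (intro continuous_intros indefinite_integral_continuous_1)
    also have "?this \<longleftrightarrow> continuous_on {x - 1..x + 1} Y"
    proof (rule continuous_on_cong)
      fix t assume "t \<in> {x - 1..x + 1}"
      then have "Y t - Y (x - 1) = integral {x - 1..t} g"
        using is_primitiveD[OF inc, of "x - 1" t] by (simp add: set_borel_integral_eq_integral(2)[OF L2_loc_set_integrable[OF g]])
      then show "Y (x - 1) + integral {x - 1..t} g = Y t" by (simp add: algebra_simps)
    qed simp
    finally show "isCont Y x" by (rule continuous_on_interior) (simp add: interior_atLeastAtMost_real)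
  qed
  then show ?thesis by (simp add: continuous_on_eq_continuous_at)
qed

lemma ac_solutionD:
  assumes "ac_solution a b Y g"
  shows "L2_loc g" "L2_loc Y" "continuous_on UNIV Y" "is_primitive Y g"
    "AE t in lborel. t \<ge> 0 \<longrightarrow> g t - g (t - 1) + of_real a * Y t + of_real b * Y (t - 1) = 0"
proof -
  show 1: "L2_loc g" and 2: "is_primitive Y g"
    and "AE t in lborel. t \<ge> 0 \<longrightarrow> g t - g (t - 1) + of_real a * Y t + of_real b * Y (t - 1) = 0"
    using assms by (auto simp: ac_solution_def)
  show "continuous_on UNIV Y" by (rule increment_continuous[OF 1 2])
  then show "L2_loc Y" by (rule continuous_L2_loc)
qed

lemma ac_solution_diff:
  assumes "ac_solution a b Y g" "ac_solution a b Z k"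
  shows "ac_solution a b (\<lambda>t. Y t - Z t) (\<lambda>t. g t - k t)"
  unfolding ac_solution_def
proof (intro conjI allI impI)
  note Y = ac_solutionD[OF assms(1)] and Z = ac_solutionD[OF assms(2)]
  show "L2_loc (\<lambda>t. g t - k t)" by (rule L2_loc_diff[OF Y(1) Z(1)])
  have "Y q - Z q - (Y p - Z p) = (LBINT s:{p..q}. g s - k s)" if "p \<le> q" for p q
    using is_primitiveD[OF Y(4) that] is_primitiveD[OF Z(4) that]
    by (simp add: set_integral_diff(2)[OF L2_loc_set_integrable[OF Y(1)] L2_loc_set_integrable[OF Z(1)]] algebra_simps)
  then show "is_primitive (\<lambda>t. Y t - Z t) (\<lambda>t. g t - k t)" by (simp add: is_primitive_def)
  show "AE t in lborel. 0 \<le> t \<longrightarrow> g t - k t - (g (t - 1) - k (t - 1)) + of_real a * (Y t - Z t)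
      + of_real b * (Y (t - 1) - Z (t - 1)) = 0"
    using Y(5) Z(5)
  proof eventually_elim
    case (elim t)
    show ?case
    proof
      assume "0 \<le> t"
      have "g t - k t - (g (t - 1) - k (t - 1)) + of_real a * (Y t - Z t) + of_real b * (Y (t - 1) - Z (t - 1)) =
        (g t - g (t - 1) + of_real a * Y t + of_real b * Y (t - 1)) -
        (k t - k (t - 1) + of_real a * Z t + of_real b * Z (t - 1))"
        by (simp add: algebra_simps)
      then show "g t - k t - (g (t - 1) - k (t - 1)) + of_real a * (Y t - Z t) + of_real b * (Y (t - 1) - Z (t - 1)) = 0"
        using elim \<open>0 \<le> t\<close> by simp
    qed
  qed
qed

lemma set_integral_translation:
  fixes f :: "real \<Rightarrow> 'a::{banach, second_countable_topology}"
  shows "(LBINT s:{p..q}. f (c + s)) = (LBINT s:{c + p..c + q}. f s)"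
proof -
  have "(LBINT s:{c + p..c + q}. f s) = (LBINT s. indicator {c + p..c + q} (c + 1 * s) *\<^sub>R f (c + 1 * s))"
    unfolding set_lebesgue_integral_def by (subst lborel_integral_real_affine[of 1 _ c]) auto
  also have "\<dots> = (LBINT s:{p..q}. f (c + s))"
    unfolding set_lebesgue_integral_def
    by (intro Bochner_Integration.integral_cong) (auto simp: indicator_def algebra_simps)
  finally show ?thesis by simp
qed

lemma L2_loc_shift:
  assumes f: "L2_loc f"
  shows "L2_loc (\<lambda>s. f (c + s))"
  unfolding L2_loc_def
proof (intro conjI allI)
  note [measurable] = L2_loc_measurable[OF f]
  show "(\<lambda>s. f (c + s)) \<in> borel_measurable borel" by measurable
  fix p q
  have "integrable lborel (\<lambda>s. indicator {p + c..q + c} s *\<^sub>R (norm (f s))\<^sup>2)"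
    using L2_loc_square[OF f] by (simp add: set_integrable_def)
  then have "integrable lborel (\<lambda>s. indicator {p + c..q + c} (c + 1 * s) *\<^sub>R (norm (f (c + 1 * s)))\<^sup>2)"
    by (rule lborel_integrable_real_affine) simp
  also have "(\<lambda>s. indicator {p + c..q + c} (c + 1 * s) *\<^sub>R (norm (f (c + 1 * s)))\<^sup>2) =
      (\<lambda>s. indicator {p..q} s *\<^sub>R (norm (f (c + s)))\<^sup>2)"
    by (auto simp: indicator_def)
  finally show "set_integrable lborel {p..q} (\<lambda>s. (norm (f (c + s)))\<^sup>2)"
    by (simp add: set_integrable_def)
qed

lemma steklov_increment:
  assumes inc: "is_primitive Y g" and h: "h > 0"
  shows "steklov h g t = (Y (t + h) - Y t) /\<^sub>R h"
  unfolding steklov_def using is_primitiveD[OF inc, of t "t + h"] h by simp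

lemma steklov_has_vector_derivative:
  assumes g: "L2_loc g" and inc: "is_primitive Y g" and h: "h > 0"
  shows "(steklov h Y has_vector_derivative steklov h g t) (at t)"
    and "continuous_on UNIV (steklov h g)"
proof -
  have c: "continuous_on UNIV Y" by (rule increment_continuous[OF g inc])
  then obtain F where F: "\<And>x. (F has_vector_derivative Y x) (at x)"
    using continuous_antiderivative by blast
  have "steklov h Y = (\<lambda>x. (F (x + h) - F x) /\<^sub>R h)"
  proof
    fix x
    have "(LBINT s:{x..x + h}. Y s) = integral {x..x + h} Y"
      by (intro set_borel_integral_eq_integral(2) L2_loc_set_integrable continuous_L2_loc c)
    also have "\<dots> = F (x + h) - F x"
      using h F by (intro integral_unique fundamental_theorem_of_calculus) (auto intro: has_vector_derivative_at_within)
    finally show "steklov h Y x = (F (x + h) - F x) /\<^sub>R h" by (simp add: steklov_def)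
  qed
  moreover have "((\<lambda>x. F (x + h)) has_vector_derivative Y (t + h)) (at t)"
  proof -
    have "((F \<circ> (\<lambda>x. x + h)) has_vector_derivative 1 *\<^sub>R Y (t + h)) (at t)"
      by (rule vector_diff_chain_at[OF _ F]) (auto intro!: derivative_eq_intros)
    then show ?thesis by (simp add: o_def)
  qed
  then have "((\<lambda>x. (F (x + h) - F x) /\<^sub>R h) has_vector_derivative (Y (t + h) - Y t) /\<^sub>R h) (at t)"
    by (auto intro!: derivative_eq_intros F)
  ultimately show "(steklov h Y has_vector_derivative steklov h g t) (at t)"
    by (simp add: steklov_increment[OF inc h])
  show "continuous_on UNIV (steklov h g)"
    unfolding ext[OF steklov_increment[OF inc h]]
    by (intro continuous_intros continuous_on_compose2[OF c]) auto
qed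

text \<open>The coefficients and the delay are constant, so integrating the equation over
  \<open>{t..t + h}\<close> gives the same equation for the means, now at every time and not just
  almost everywhere.\<close>

lemma ac_solution_steklov_equation:
  assumes S: "ac_solution a b Y g" and h: "h > 0" and t: "t \<ge> 0"
  shows "steklov h g t - steklov h g (t - 1) + of_real a * steklov h Y t + of_real b * steklov h Y (t - 1) = 0"
proof -
  note Y = ac_solutionD[OF S]
  let ?A = "{t..t + h}"
  have i: "set_integrable lborel ?A g" "set_integrable lborel ?A Y"
    "set_integrable lborel ?A (\<lambda>s. g (s - 1))" "set_integrable lborel ?A (\<lambda>s. Y (s - 1))"
    using Y(1,2) L2_loc_shift[OF Y(1), of "-1"] L2_loc_shift[OF Y(2), of "-1"]
    by (auto intro!: L2_loc_set_integrable)
  have "(LBINT s:?A. g s - g (s - 1) + of_real a * Y s + of_real b * Y (s - 1)) = 0"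
    unfolding set_lebesgue_integral_def
    by (rule integral_eq_zero_AE) (use Y(5) t in \<open>auto elim!: eventually_mono simp: indicator_def\<close>)
  moreover have "(LBINT s:?A. g s - g (s - 1) + of_real a * Y s + of_real b * Y (s - 1)) =
      (LBINT s:?A. g s) - (LBINT s:?A. g (s - 1)) + of_real a * (LBINT s:?A. Y s) + of_real b * (LBINT s:?A. Y (s - 1))"
    using i by (simp add: set_integral_add set_integral_diff set_integrable_mult_right)
  moreover have "(LBINT s:?A. f (s - 1)) = (LBINT s:{t - 1..t - 1 + h}. f s)" for f :: "real \<Rightarrow> complex"
    using set_integral_translation[of t "t + h" f "-1"] by (simp add: algebra_simps)
  ultimately have "((LBINT s:?A. g s) - (LBINT s:{t - 1..t - 1 + h}. g s) + of_real a * (LBINT s:?A. Y s)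
      + of_real b * (LBINT s:{t - 1..t - 1 + h}. Y s)) /\<^sub>R h = 0" by simp
  then show ?thesis
    by (simp add: steklov_def scaleR_right_diff_distrib scaleR_right_distrib)
qed

lemma ac_solution_steklov:
  assumes S: "ac_solution a b Y g" and h: "h > 0"
  shows "ac_solution a b (steklov h Y) (steklov h g)"
  unfolding ac_solution_def
proof (intro conjI allI impI)
  note Y = ac_solutionD[OF S]
  note D = steklov_has_vector_derivative[OF Y(1,4) h]
  show L: "L2_loc (steklov h g)" by (rule continuous_L2_loc[OF D(2)])
  have "steklov h Y q - steklov h Y p = (LBINT s:{p..q}. steklov h g s)" if "p \<le> q" for p q
  proof -
    have "integral {p..q} (steklov h g) = steklov h Y q - steklov h Y p"
      using that D(1) by (intro integral_unique fundamental_theorem_of_calculus) (auto intro: has_vector_derivative_at_within)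
    then show ?thesis by (simp add: set_borel_integral_eq_integral(2)[OF L2_loc_set_integrable[OF L]])
  qed
  then show "is_primitive (steklov h Y) (steklov h g)" by (simp add: is_primitive_def)
  show "AE t in lborel. 0 \<le> t \<longrightarrow> steklov h g t - steklov h g (t - 1) + of_real a * steklov h Y t
      + of_real b * steklov h Y (t - 1) = 0"
    using ac_solution_steklov_equation[OF S h] by simp
qed

lemma H1sq_integrable:
  assumes "L2_loc Y" "L2_loc g"
  shows "set_integrable lborel {p..q} (\<lambda>s. (norm (Y s))\<^sup>2 + (norm (g s))\<^sup>2)"
  using assms by (intro set_integral_add(1) L2_loc_square)

lemma H1sq_eq:
  assumes "L2_loc Y" "L2_loc g"
  shows "H1sq p q Y g = (LBINT s:{p..q}. (norm (Y s))\<^sup>2) + (LBINT s:{p..q}. (norm (g s))\<^sup>2)"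
  unfolding H1sq_def using assms by (intro set_integral_add(2) L2_loc_square)

lemma H1sq_nonneg: "H1sq p q Y g \<ge> 0"
  unfolding H1sq_def set_lebesgue_integral_def by (intro integral_nonneg_AE AE_I2) simp

lemma H1sq_le_diff:
  assumes "L2_loc Y" "L2_loc g" "L2_loc Z" "L2_loc k"
  shows "H1sq p q Y g \<le> 2 * H1sq p q (\<lambda>s. Y s - Z s) (\<lambda>s. g s - k s) + 2 * H1sq p q Z k"
proof -
  have i: "set_integrable lborel {p..q} (\<lambda>s. (norm (Y s - Z s))\<^sup>2 + (norm (g s - k s))\<^sup>2)"
    "set_integrable lborel {p..q} (\<lambda>s. (norm (Z s))\<^sup>2 + (norm (k s))\<^sup>2)"
    using assms by (auto intro!: H1sq_integrable L2_loc_diff)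
  have "H1sq p q Y g \<le> (LBINT s:{p..q}. 2 * ((norm (Y s - Z s))\<^sup>2 + (norm (g s - k s))\<^sup>2)
      + 2 * ((norm (Z s))\<^sup>2 + (norm (k s))\<^sup>2))"
    unfolding H1sq_def
  proof (rule set_integral_mono)
    show "set_integrable lborel {p..q} (\<lambda>s. 2 * ((norm (Y s - Z s))\<^sup>2 + (norm (g s - k s))\<^sup>2)
      + 2 * ((norm (Z s))\<^sup>2 + (norm (k s))\<^sup>2))"
      by (rule set_integral_add(1)[OF set_integrable_mult_right[OF i(1)] set_integrable_mult_right[OF i(2)]])
    show "(norm (Y s))\<^sup>2 + (norm (g s))\<^sup>2 \<le> 2 * ((norm (Y s - Z s))\<^sup>2 + (norm (g s - k s))\<^sup>2)
      + 2 * ((norm (Z s))\<^sup>2 + (norm (k s))\<^sup>2)" for s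
      using norm_add_squared_le[of "Y s - Z s" "Z s"] norm_add_squared_le[of "g s - k s" "k s"] by simp
  qed (use assms in \<open>intro H1sq_integrable\<close>)
  also have "\<dots> = 2 * H1sq p q (\<lambda>s. Y s - Z s) (\<lambda>s. g s - k s) + 2 * H1sq p q Z k"
    unfolding H1sq_def
    by (subst set_integral_add(2)[OF set_integrable_mult_right[OF i(1)] set_integrable_mult_right[OF i(2)]])
       (simp only: set_integral_mult_right)
  finally show ?thesis .
qed

lemma H1sq_commute: "H1sq p q (\<lambda>s. Y s - Z s) (\<lambda>s. g s - k s) = H1sq p q (\<lambda>s. Z s - Y s) (\<lambda>s. k s - g s)"
  by (simp add: H1sq_def norm_minus_commute)

lemma H1sq_steklov_lim:
  assumes S: "ac_solution a b Y g"
  shows "(\<lambda>n. H1sq p q (\<lambda>s. Y s - steklov (inverse (real (Suc n))) Y s) (\<lambda>s. g s - steklov (inverse (real (Suc n))) g s)) \<longlonglongrightarrow> 0"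
proof -
  note Y = ac_solutionD[OF S]
  have L: "L2_loc (steklov (inverse (real (Suc n))) Y)" "L2_loc (steklov (inverse (real (Suc n))) g)" for n
    using ac_solutionD(1,2)[OF ac_solution_steklov[OF S, of "inverse (real (Suc n))"]] by simp_all
  have "(\<lambda>n. (LBINT s:{p..q}. (norm (steklov (inverse (real (Suc n))) Y s - Y s))\<^sup>2) +
      (LBINT s:{p..q}. (norm (steklov (inverse (real (Suc n))) g s - g s))\<^sup>2)) \<longlonglongrightarrow> 0 + 0"
    using Y(1,2) by (intro tendsto_add L2_loc_steklov_lim)
  moreover have "H1sq p q (\<lambda>s. Y s - steklov (inverse (real (Suc n))) Y s) (\<lambda>s. g s - steklov (inverse (real (Suc n))) g s) =
      (LBINT s:{p..q}. (norm (steklov (inverse (real (Suc n))) Y s - Y s))\<^sup>2) +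
      (LBINT s:{p..q}. (norm (steklov (inverse (real (Suc n))) g s - g s))\<^sup>2)" for n
    unfolding H1sq_commute[of p q Y] by (intro H1sq_eq L2_loc_diff L Y(1,2))
  ultimately show ?thesis by (simp only: add_0_left)
qed

lemma H1sq_continuous:
  assumes "continuous_on UNIV z" "continuous_on UNIV z'"
  shows "H1sq p q z z' = integral {p..q} (\<lambda>s. (norm (z s))\<^sup>2 + (norm (z' s))\<^sup>2)"
  unfolding H1sq_def using assms by (intro set_borel_integral_eq_integral H1sq_integrable continuous_L2_loc)

lemma norm_squared_le_diff:
  fixes y z w :: complex
  shows "(norm y)\<^sup>2 \<le> 2 * ((norm (y - z))\<^sup>2 + (norm w)\<^sup>2) + 2 * (norm z)\<^sup>2"
proof -
  have "(norm y)\<^sup>2 \<le> 2 * (norm (y - z))\<^sup>2 + 2 * (norm z)\<^sup>2"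
    using norm_add_squared_le[of "y - z" z] by simp
  also have "\<dots> \<le> 2 * ((norm (y - z))\<^sup>2 + (norm w)\<^sup>2) + 2 * (norm z)\<^sup>2"
    by (intro add_mono mult_left_mono) auto
  finally show ?thesis .
qed

text \<open>The constant depends on \<open>a\<close> and \<open>b\<close> alone. This uniformity is
  what later allows the estimate to be applied to the difference of a solution and its
  means.\<close>

lemma ac_solution_estimate:
  assumes a: "a > 0" "a + b \<ge> 0" "b\<^sup>2 \<le> a\<^sup>2"
  obtains C where "C \<ge> 0"
    "\<And>Y g t. ac_solution a b Y g \<Longrightarrow> t \<ge> 0 \<Longrightarrow> H1sq (t - 1) t Y g \<le> C * H1sq (-1) 0 Y g"
    "\<And>Y g t. ac_solution a b Y g \<Longrightarrow> t \<ge> 0 \<Longrightarrow>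
      (a\<^sup>2 - b\<^sup>2) / 2 * (LBINT s:{0..t}. (norm (Y s))\<^sup>2) \<le> C * H1sq (-1) 0 Y g"
proof -
  define \<kappa> where "\<kappa> = (a\<^sup>2 - b\<^sup>2) / 2"
  have k: "\<kappa> \<ge> 0" using a by (simp add: \<kappa>_def)
  define c2 where "c2 = 2 + 2 * b\<^sup>2 + \<kappa> + 2 * (a + b)"
  define c3 where "c3 = 2 + c2 / (a * (1 - exp (- a)))"
  define c where "c = (1 + 2 * b\<^sup>2) * (c3 + 1) + 2 * c2"
  have c2: "c2 \<ge> 0" using k a by (simp add: c2_def)
  then have c3: "c3 \<ge> 0" using a by (auto simp: c3_def intro!: add_nonneg_nonneg divide_nonneg_nonneg mult_nonneg_nonneg)
  have c: "c \<ge> 0" using c2 c3 by (simp add: c_def)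
  \<comment> \<open>The limit passage shared by both estimates: \<open>Q\<close> is the controlled
    quantity and \<open>K\<close> weights the approximation error. The 4 is the product of two
    factors 2, one for passing from \<open>Y\<close> to its mean and one for passing back in the
    initial norm.\<close>
  have bound: "Q Y g \<le> 4 * d * H1sq (-1) 0 Y g"
    if S: "ac_solution a b Y g" and d: "d \<ge> 0"
      and Q: "\<And>n. Q Y g \<le> K * H1sq p q (\<lambda>s. Y s - steklov (inverse (real (Suc n))) Y s) (\<lambda>s. g s - steklov (inverse (real (Suc n))) g s)
        + 2 * (d * H1sq (-1) 0 (steklov (inverse (real (Suc n))) Y) (steklov (inverse (real (Suc n))) g))"
    for Y g d p q K and Q :: "(real \<Rightarrow> complex) \<Rightarrow> (real \<Rightarrow> complex) \<Rightarrow> real"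
  proof -
    note Y = ac_solutionD[OF S]
    define y where "y n = steklov (inverse (real (Suc n))) Y" for n
    define k where "k n = steklov (inverse (real (Suc n))) g" for n
    have yk: "L2_loc (y n)" "L2_loc (k n)" for n
      using ac_solutionD(1,2)[OF ac_solution_steklov[OF S, of "inverse (real (Suc n))"]] by (simp_all add: y_def k_def)
    have le: "Q Y g \<le> K * H1sq p q (\<lambda>s. Y s - y n s) (\<lambda>s. g s - k n s)
        + 4 * d * H1sq (-1) 0 (\<lambda>s. Y s - y n s) (\<lambda>s. g s - k n s) + 4 * d * H1sq (-1) 0 Y g" for n
    proof -
      have "d * H1sq (-1) 0 (y n) (k n) \<le> d * (2 * H1sq (-1) 0 (\<lambda>s. y n s - Y s) (\<lambda>s. k n s - g s) + 2 * H1sq (-1) 0 Y g)"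
        by (intro mult_left_mono d H1sq_le_diff yk Y(1,2))
      then show ?thesis using Q[of n] unfolding y_def[symmetric] k_def[symmetric]
        by (simp add: H1sq_commute[of "-1" 0 "y n"] algebra_simps)
    qed
    have "(\<lambda>n. K * H1sq p q (\<lambda>s. Y s - y n s) (\<lambda>s. g s - k n s)
        + 4 * d * H1sq (-1) 0 (\<lambda>s. Y s - y n s) (\<lambda>s. g s - k n s) + 4 * d * H1sq (-1) 0 Y g)
        \<longlonglongrightarrow> K * 0 + 4 * d * 0 + 4 * d * H1sq (-1) 0 Y g"
      unfolding y_def k_def by (intro tendsto_intros H1sq_steklov_lim[OF S])
    then show ?thesis by (intro LIMSEQ_le_const[where X = "\<lambda>n. K * H1sq p q (\<lambda>s. Y s - y n s) (\<lambda>s. g s - k n s)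
        + 4 * d * H1sq (-1) 0 (\<lambda>s. Y s - y n s) (\<lambda>s. g s - k n s) + 4 * d * H1sq (-1) 0 Y g"])
      (use le in auto)
  qed
  have cl: "\<kappa> * integral {0..t} (\<lambda>s. (norm (steklov h Y s))\<^sup>2) \<le> c2 * H1sq (-1) 0 (steklov h Y) (steklov h g)"
    "H1sq (t - 1) t (steklov h Y) (steklov h g) \<le> c * H1sq (-1) 0 (steklov h Y) (steklov h g)"
    if S: "ac_solution a b Y g" and h: "h > 0" and t: "t \<ge> 0" for Y g h t
  proof -
    note Y = ac_solutionD[OF S] and Z = ac_solutionD[OF ac_solution_steklov[OF S h]]
    note D = steklov_has_vector_derivative[OF Y(1,4) h]
    note est = classical_energy_estimate[OF a(1,2) k[unfolded \<kappa>_def] D ac_solution_steklov_equation[OF S h] t, folded \<kappa>_def]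
    show "\<kappa> * integral {0..t} (\<lambda>s. (norm (steklov h Y s))\<^sup>2) \<le> c2 * H1sq (-1) 0 (steklov h Y) (steklov h g)"
      using est(1) by (simp add: H1sq_continuous[OF Z(3) D(2)] c2_def)
    show "H1sq (t - 1) t (steklov h Y) (steklov h g) \<le> c * H1sq (-1) 0 (steklov h Y) (steklov h g)"
      using est(2) by (simp add: H1sq_continuous[OF Z(3) D(2)] c_def c3_def c2_def)
  qed
  have 1: "H1sq (t - 1) t Y g \<le> 4 * c * H1sq (-1) 0 Y g" if S: "ac_solution a b Y g" and t: "t \<ge> 0" for Y g t
  proof (rule bound[OF S c, where K = 2 and p = "t - 1" and q = t])
    fix n
    let ?h = "inverse (real (Suc n))"
    have hp: "0 < ?h" by simp
    note Y = ac_solutionD[OF S] and Z = ac_solutionD[OF ac_solution_steklov[OF S hp]]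
    have "H1sq (t - 1) t Y g \<le> 2 * H1sq (t - 1) t (\<lambda>s. Y s - steklov ?h Y s) (\<lambda>s. g s - steklov ?h g s)
        + 2 * H1sq (t - 1) t (steklov ?h Y) (steklov ?h g)"
      by (rule H1sq_le_diff[OF Y(2,1) Z(2,1)])
    moreover have "H1sq (t - 1) t (steklov ?h Y) (steklov ?h g) \<le> c * H1sq (-1) 0 (steklov ?h Y) (steklov ?h g)"
      by (rule cl(2)[OF S _ t]) simp
    ultimately show "H1sq (t - 1) t Y g \<le> 2 * H1sq (t - 1) t (\<lambda>s. Y s - steklov ?h Y s) (\<lambda>s. g s - steklov ?h g s)
        + 2 * (c * H1sq (-1) 0 (steklov ?h Y) (steklov ?h g))" by linarith
  qed
  have 2: "\<kappa> * (LBINT s:{0..t}. (norm (Y s))\<^sup>2) \<le> 4 * c2 * H1sq (-1) 0 Y g" if S: "ac_solution a b Y g" and t: "t \<ge> 0" for Y g t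
  proof (rule bound[OF S c2, where K = "2 * \<kappa>" and p = 0 and q = t and Q = "\<lambda>Y g. \<kappa> * (LBINT s:{0..t}. (norm (Y s))\<^sup>2)"])
    fix n
    let ?h = "inverse (real (Suc n))"
    have hp: "0 < ?h" by simp
    note Y = ac_solutionD[OF S] and Z = ac_solutionD[OF ac_solution_steklov[OF S hp]]
    note Zc = Z(2)
    \<comment> \<open>The derivative error is added to the majorant so that the error is measured by
      \<open>H1sq\<close>, the form required in the limit passage.\<close>
    have "(LBINT s:{0..t}. (norm (Y s))\<^sup>2) \<le> (LBINT s:{0..t}. 2 * ((norm (Y s - steklov ?h Y s))\<^sup>2 + (norm (g s - steklov ?h g s))\<^sup>2)
        + 2 * (norm (steklov ?h Y s))\<^sup>2)"
    proof (rule set_integral_mono)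
      show "(norm (Y s))\<^sup>2 \<le> 2 * ((norm (Y s - steklov ?h Y s))\<^sup>2 + (norm (g s - steklov ?h g s))\<^sup>2)
        + 2 * (norm (steklov ?h Y s))\<^sup>2" for s
        by (rule norm_squared_le_diff)
    qed (use Y Z in \<open>auto intro!: set_integral_add(1) set_integrable_mult_right L2_loc_square H1sq_integrable L2_loc_diff simp del: of_nat_Suc\<close>)
    also have "\<dots> = 2 * H1sq 0 t (\<lambda>s. Y s - steklov ?h Y s) (\<lambda>s. g s - steklov ?h g s) + 2 * (LBINT s:{0..t}. (norm (steklov ?h Y s))\<^sup>2)"
      unfolding H1sq_def
      by (subst set_integral_add(2)[OF set_integrable_mult_right[OF H1sq_integrable[OF L2_loc_diff[OF Y(2) Z(2)] L2_loc_diff[OF Y(1) Z(1)]]]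
            set_integrable_mult_right[OF L2_loc_square[OF Zc]]])
         (simp only: set_integral_mult_right)
    finally have "\<kappa> * (LBINT s:{0..t}. (norm (Y s))\<^sup>2) \<le>
        \<kappa> * (2 * H1sq 0 t (\<lambda>s. Y s - steklov ?h Y s) (\<lambda>s. g s - steklov ?h g s) + 2 * (LBINT s:{0..t}. (norm (steklov ?h Y s))\<^sup>2))"
      using k by (intro mult_left_mono)
    moreover have "(LBINT s:{0..t}. (norm (steklov ?h Y s))\<^sup>2) = integral {0..t} (\<lambda>s. (norm (steklov ?h Y s))\<^sup>2)"
      by (rule set_borel_integral_eq_integral(2)[OF L2_loc_square[OF Zc]])
    moreover have "\<kappa> * integral {0..t} (\<lambda>s. (norm (steklov ?h Y s))\<^sup>2) \<le> c2 * H1sq (-1) 0 (steklov ?h Y) (steklov ?h g)"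
      by (rule cl(1)[OF S _ t]) simp
    ultimately show "\<kappa> * (LBINT s:{0..t}. (norm (Y s))\<^sup>2) \<le> 2 * \<kappa> * H1sq 0 t (\<lambda>s. Y s - steklov ?h Y s) (\<lambda>s. g s - steklov ?h g s)
        + 2 * (c2 * H1sq (-1) 0 (steklov ?h Y) (steklov ?h g))" by (simp only: distrib_left mult.left_commute mult.assoc)
  qed
  define C where "C = max (4 * c) (4 * c2)"
  have *: "d * H1sq (-1) 0 Y g \<le> C * H1sq (-1) 0 Y g" if "d \<le> C" for d Y g
    using that H1sq_nonneg by (intro mult_right_mono)
  show ?thesis
  proof (rule that[of C])
    show "C \<ge> 0" using c by (simp add: C_def)
    show "H1sq (t - 1) t Y g \<le> C * H1sq (-1) 0 Y g" if "ac_solution a b Y g" "t \<ge> 0" for Y g t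
      using 1[OF that] *[of "4 * c" Y g] by (simp add: C_def)
    show "(a\<^sup>2 - b\<^sup>2) / 2 * (LBINT s:{0..t}. (norm (Y s))\<^sup>2) \<le> C * H1sq (-1) 0 Y g" if "ac_solution a b Y g" "t \<ge> 0" for Y g t
      using 2[OF that] *[of "4 * c2" Y g] by (simp add: C_def \<kappa>_def)
  qed
qed

text \<open>Once \<open>J\<close> is within \<open>e\<close> of its supremum, monotonicity leaves
  less than \<open>e\<close> for every later increment.\<close>

lemma bounded_antiderivative_increment_lim:
  fixes J :: "real \<Rightarrow> real"
  assumes mono: "\<And>p q. 0 \<le> p \<Longrightarrow> p \<le> q \<Longrightarrow> J p \<le> J q" and bd: "\<And>t. t \<ge> 0 \<Longrightarrow> J t \<le> B"
  shows "((\<lambda>t. J (t + 1) - J (t - 1)) \<longlongrightarrow> 0) at_top"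
proof (rule tendstoI)
  fix e :: real assume e: "e > 0"
  define L where "L = (SUP t\<in>{0..}. J t)"
  have bdd: "bdd_above (J ` {0..})" using bd by (auto intro!: bdd_aboveI[of _ B])
  have "L - e < (SUP t\<in>{0..}. J t)" using e by (simp add: L_def)
  then obtain T where T: "T \<ge> 0" "L - e < J T"
    by (subst (asm) less_cSUP_iff[OF _ bdd]) auto
  have "\<forall>t\<ge>T + 1. dist (J (t + 1) - J (t - 1)) 0 < e"
  proof (intro allI impI)
    fix t assume t: "t \<ge> T + 1"
    have "J (t + 1) \<le> L" unfolding L_def using t T by (intro cSUP_upper bdd) auto
    moreover have "J T \<le> J (t - 1)" "J (t - 1) \<le> J (t + 1)" using t T by (auto intro!: mono)
    ultimately show "dist (J (t + 1) - J (t - 1)) 0 < e" using T by (simp add: dist_real_def)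
  qed
  then show "\<forall>\<^sub>F t in at_top. dist (J (t + 1) - J (t - 1)) 0 < e"
    by (auto simp: eventually_at_top_linorder)
qed

text \<open>The derivative \<open>(Y (t + h) - Y t) / h\<close> of a Steklov mean vanishes at infinity together with \<open>Y\<close>,
  and by the energy estimate the Steklov means approximate \<open>Y\<close> uniformly in time.\<close>

lemma ac_solution_asymptotic:
  assumes a: "a > \<bar>b\<bar>" and S: "ac_solution a b Y g"
  shows "((\<lambda>t. H1sq (t - 1) t Y g) \<longlongrightarrow> 0) at_top"
proof -
  have ab: "a > 0" "a + b \<ge> 0" "b\<^sup>2 < a\<^sup>2"
    using a by (auto simp: abs_square_less_1 intro: power2_strict_mono)
  then obtain C where C: "C \<ge> 0"
    "\<And>Y g t. ac_solution a b Y g \<Longrightarrow> t \<ge> 0 \<Longrightarrow> H1sq (t - 1) t Y g \<le> C * H1sq (-1) 0 Y g"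
    "\<And>Y g t. ac_solution a b Y g \<Longrightarrow> t \<ge> 0 \<Longrightarrow>
      (a\<^sup>2 - b\<^sup>2) / 2 * (LBINT s:{0..t}. (norm (Y s))\<^sup>2) \<le> C * H1sq (-1) 0 Y g"
    using ac_solution_estimate[of a b] by (auto intro: less_imp_le)
  note Y = ac_solutionD[OF S]
  have "continuous_on UNIV (\<lambda>s. (norm (Y s))\<^sup>2)" by (intro continuous_intros Y(3))
  then obtain J where J: "\<And>x. (J has_real_derivative (norm (Y x))\<^sup>2) (at x)"
    using continuous_antiderivative_real by blast
  have JI: "(LBINT s:{p..q}. (norm (Y s))\<^sup>2) = J q - J p" if "p \<le> q" for p q
    using integral_antiderivative[OF J that] by (simp add: set_borel_integral_eq_integral(2)[OF L2_loc_square[OF Y(2)]])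
  have Jm: "J p \<le> J q" if "p \<le> q" for p q
    using DERIV_le_increment[OF that DERIV_const[of 0] J] by simp
  \<comment> \<open>A window of length 2 contains all \<open>{s..s + h}\<close> with
    \<open>s\<close> in \<open>{t - 1..t}\<close> and \<open>h \<le> 1\<close>, so \<open>W\<close>
    controls both the means and their difference quotients.\<close>
  define W where "W t = J (t + 1) - J (t - 1)" for t
  have W: "(W \<longlongrightarrow> 0) at_top"
    unfolding W_def[abs_def]
  proof (rule bounded_antiderivative_increment_lim[OF Jm])
    show "J t \<le> J 0 + C * H1sq (-1) 0 Y g / ((a\<^sup>2 - b\<^sup>2) / 2)" if "t \<ge> 0" for t
      using C(3)[OF S that] JI[OF that] ab(3) by (simp add: field_simps)
  qed
  have st: "H1sq (t - 1) t (steklov h Y) (steklov h g) \<le> (inverse h + 4 * (inverse h)\<^sup>2) * W t"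
    if h: "0 < h" "h \<le> 1" for h t
  proof -
    have pt: "(norm (steklov h Y s))\<^sup>2 \<le> inverse h * W t" if "s \<in> {t - 1..t}" for s
    proof -
      have "(norm (LBINT r:{s..s + h}. Y r))\<^sup>2 \<le> h * (LBINT r:{s..s + h}. (norm (Y r))\<^sup>2)"
        using norm_set_integral_squared_le[OF Y(2), of s "s + h"] h by simp
      also have "(LBINT r:{s..s + h}. (norm (Y r))\<^sup>2) = J (s + h) - J s" using h by (intro JI) simp
      also have "\<dots> \<le> W t" unfolding W_def using that h by (intro diff_mono Jm) auto
      finally have "(norm (LBINT r:{s..s + h}. Y r))\<^sup>2 \<le> h * W t" using h by simp
      then show ?thesis using h by (simp add: steklov_def power_mult_distrib power2_eq_square field_simps)
    qed
    note Z = ac_solutionD[OF ac_solution_steklov[OF S h(1)]]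
    have "(LBINT s:{t - 1..t}. (norm (steklov h Y s))\<^sup>2) \<le> (LBINT s:{t - 1..t}. inverse h * W t)"
      unfolding set_lebesgue_integral_def
      by (rule integral_mono) (use L2_loc_square[OF Z(2)] set_integrable_const_Icc pt in \<open>auto simp: set_integrable_def indicator_def\<close>)
    also have "\<dots> = inverse h * W t"
      unfolding set_lebesgue_integral_def by simp
    finally have 1: "(LBINT s:{t - 1..t}. (norm (steklov h Y s))\<^sup>2) \<le> inverse h * W t" .
    have "(LBINT s:{t - 1..t}. (norm (steklov h g s))\<^sup>2) = integral {t - 1..t} (\<lambda>s. (norm (steklov h g s))\<^sup>2)"
      by (rule set_borel_integral_eq_integral(2)[OF L2_loc_square[OF Z(1)]])
    also have "continuous_on UNIV (\<lambda>x. (norm (steklov h g x))\<^sup>2)"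
      by (intro continuous_intros steklov_has_vector_derivative(2)[OF Y(1,4) h(1)])
    then obtain G where G: "\<And>x. (G has_real_derivative (norm (steklov h g x))\<^sup>2) (at x)"
      using continuous_antiderivative_real by blast
    have "integral {t - 1..t} (\<lambda>s. (norm (steklov h g s))\<^sup>2) = G t - G (t - 1)"
      by (rule integral_antiderivative[OF G]) simp
    also have "\<dots> \<le> 2 * (inverse h)\<^sup>2 * (J (t + h) + J t) - 2 * (inverse h)\<^sup>2 * (J (t - 1 + h) + J (t - 1))"
    proof (rule DERIV_le_increment[OF _ G])
      fix s
      show "((\<lambda>s. 2 * (inverse h)\<^sup>2 * (J (s + h) + J s)) has_real_derivative
          2 * (inverse h)\<^sup>2 * ((norm (Y (s + h)))\<^sup>2 + (norm (Y s))\<^sup>2)) (at s)"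
        by (rule derivative_eq_intros J DERIV_chain2[where g = "\<lambda>s. s + h"] refl | simp)+
      have "(norm (steklov h g s))\<^sup>2 = (inverse h)\<^sup>2 * (norm (Y (s + h) - Y s))\<^sup>2"
        unfolding steklov_increment[OF Y(4) h(1)] using h by (simp add: power_mult_distrib)
      also have "\<dots> \<le> (inverse h)\<^sup>2 * (2 * (norm (Y (s + h)))\<^sup>2 + 2 * (norm (Y s))\<^sup>2)"
        by (intro mult_left_mono norm_diff_squared_le) simp
      finally show "(norm (steklov h g s))\<^sup>2 \<le> 2 * (inverse h)\<^sup>2 * ((norm (Y (s + h)))\<^sup>2 + (norm (Y s))\<^sup>2)"
        by (simp add: algebra_simps)
    qed simp
    also have "\<dots> = 2 * (inverse h)\<^sup>2 * ((J (t + h) - J (t - 1 + h)) + (J t - J (t - 1)))"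
      by (simp add: algebra_simps)
    also have "\<dots> \<le> 2 * (inverse h)\<^sup>2 * (W t + W t)"
      unfolding W_def using h by (intro mult_left_mono add_mono diff_mono Jm) auto
    finally have 2: "(LBINT s:{t - 1..t}. (norm (steklov h g s))\<^sup>2) \<le> 4 * (inverse h)\<^sup>2 * W t" by simp
    show ?thesis using 1 2 by (simp add: H1sq_eq[OF Z(2,1)] algebra_simps)
  qed
  show ?thesis
  proof (rule tendstoI)
    fix e :: real assume e: "e > 0"
    \<comment> \<open>The order of choices matters: the coefficient of \<open>W t\<close> blows up
      as \<open>h\<close> tends to 0, so \<open>h\<close> is fixed first by an initial error that
      \<open>C\<close> carries to all later times, and only then does \<open>t\<close> grow.\<close>
    have lim: "(\<lambda>n. 2 * (C * H1sq (-1) 0 (\<lambda>s. Y s - steklov (inverse (real (Suc n))) Y s) (\<lambda>s. g s - steklov (inverse (real (Suc n))) g s))) \<longlonglongrightarrow> 2 * (C * 0)"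
      by (intro tendsto_intros H1sq_steklov_lim[OF S])
    then have "\<forall>\<^sub>F n in sequentially. 2 * (C * H1sq (-1) 0 (\<lambda>s. Y s - steklov (inverse (real (Suc n))) Y s) (\<lambda>s. g s - steklov (inverse (real (Suc n))) g s)) < e / 2"
      using order_tendstoD(2)[OF lim, of "e / 2"] e by (simp del: of_nat_Suc)
    then obtain n where n: "2 * (C * H1sq (-1) 0 (\<lambda>s. Y s - steklov (inverse (real (Suc n))) Y s) (\<lambda>s. g s - steklov (inverse (real (Suc n))) g s)) < e / 2"
      by (auto simp: eventually_sequentially simp del: of_nat_Suc)
    define h where "h = inverse (real (Suc n))"
    have h: "0 < h" "h \<le> 1" by (auto simp: h_def inverse_le_1_iff)
    note Z = ac_solutionD[OF ac_solution_steklov[OF S h(1)]]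
    have "((\<lambda>t. 2 * ((inverse h + 4 * (inverse h)\<^sup>2) * W t)) \<longlongrightarrow> 2 * ((inverse h + 4 * (inverse h)\<^sup>2) * 0)) at_top"
      by (intro tendsto_intros W)
    then have "\<forall>\<^sub>F t in at_top. 2 * ((inverse h + 4 * (inverse h)\<^sup>2) * W t) < e / 2"
      using e by (intro order_tendstoD(2)) auto
    then show "\<forall>\<^sub>F t in at_top. dist (H1sq (t - 1) t Y g) 0 < e"
      using eventually_ge_at_top[of 0]
    proof eventually_elim
      case (elim t)
      have "H1sq (t - 1) t Y g \<le> 2 * H1sq (t - 1) t (\<lambda>s. Y s - steklov h Y s) (\<lambda>s. g s - steklov h g s)
          + 2 * H1sq (t - 1) t (steklov h Y) (steklov h g)"
        by (rule H1sq_le_diff[OF Y(2,1) Z(2,1)])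
      moreover have "H1sq (t - 1) t (\<lambda>s. Y s - steklov h Y s) (\<lambda>s. g s - steklov h g s) \<le>
          C * H1sq (-1) 0 (\<lambda>s. Y s - steklov h Y s) (\<lambda>s. g s - steklov h g s)"
        by (rule C(2)[OF ac_solution_diff[OF S ac_solution_steklov[OF S h(1)]] elim(2)])
      ultimately have "H1sq (t - 1) t Y g < e"
        using st[OF h, of t] n[folded h_def] elim(1) by linarith
      then show ?case using H1sq_nonneg[of "t - 1" t Y g] by simp
    qed
  qed
qed

subsection \<open>Representation of weak solutions\<close>

lemma test_functionE:
  assumes "test_function I \<phi>"
  obtains K where "compact K" "K \<subseteq> I" "\<And>x. x \<notin> K \<Longrightarrow> \<phi> x = 0" "\<And>x. x \<notin> K \<Longrightarrow> deriv \<phi> x = 0"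
    "\<And>x. (\<phi> has_real_derivative deriv \<phi> x) (at x)" "continuous_on UNIV (deriv \<phi>)" "continuous_on UNIV \<phi>"
proof -
  obtain D where D: "\<And>x. (\<phi> has_real_derivative D x) (at x)" "continuous_on UNIV D"
    using assms by (auto simp: test_function_def C1_differentiable_on_def has_real_derivative_iff_has_vector_derivative)
  then have "deriv \<phi> = D" by (auto intro: DERIV_imp_deriv)
  obtain K where K: "compact K" "K \<subseteq> I" "\<And>x. x \<notin> K \<Longrightarrow> \<phi> x = 0"
    using assms by (auto simp: test_function_def)
  have "D x = 0" if "x \<notin> K" for x
  proof -
    have "((\<lambda>_. 0) has_real_derivative D x) (at x)"
      by (rule has_field_derivative_transform_within_open[OF D(1), where S = "- K"])
         (use K that in \<open>auto simp: open_Compl compact_imp_closed\<close>)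
    then show ?thesis using DERIV_unique DERIV_const by blast
  qed
  moreover have "continuous_on UNIV \<phi>"
    using D(1) by (auto simp: continuous_on_eq_continuous_at intro: DERIV_isCont)
  ultimately show ?thesis using that K D \<open>deriv \<phi> = D\<close> by metis
qed

lemma L2_loc_scaleR:
  assumes \<psi>: "continuous_on UNIV \<psi>" "\<And>x. \<bar>\<psi> x\<bar> \<le> B" and f: "L2_loc f"
  shows "L2_loc (\<lambda>x. \<psi> x *\<^sub>R f x)"
  unfolding L2_loc_def
proof (intro conjI allI)
  note [measurable] = borel_measurable_continuous_onI[OF \<psi>(1)] L2_loc_measurable[OF f]
  show "(\<lambda>x. \<psi> x *\<^sub>R f x) \<in> borel_measurable borel" by measurable
  fix p q
  show "set_integrable lborel {p..q} (\<lambda>x. (norm (\<psi> x *\<^sub>R f x))\<^sup>2)"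
  proof (rule set_integrable_bound)
    show "set_integrable lborel {p..q} (\<lambda>x. B\<^sup>2 * (norm (f x))\<^sup>2)"
      using f by (intro set_integrable_mult_right L2_loc_square)
    show "set_borel_measurable lborel {p..q} (\<lambda>x. (norm (\<psi> x *\<^sub>R f x))\<^sup>2)"
      unfolding set_borel_measurable_def by measurable
    have "(\<psi> x)\<^sup>2 \<le> B\<^sup>2" for x using \<psi>(2)[of x] by (rule power2_le_iff_abs_le[THEN iffD2, rotated]) (use \<psi>(2)[of 0] in auto)
    then show "AE x in lborel. x \<in> {p..q} \<longrightarrow> norm ((norm (\<psi> x *\<^sub>R f x))\<^sup>2) \<le> norm (B\<^sup>2 * (norm (f x))\<^sup>2)"
      by (auto simp: power_mult_distrib intro!: mult_right_mono)
  qed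
qed

lemma set_integral_scaleR_steklov_lim:
  assumes \<psi>: "continuous_on UNIV \<psi>" "\<And>x. \<bar>\<psi> x\<bar> \<le> B" and f: "L2_loc f"
    and s: "\<And>n. L2_loc (steklov (inverse (real (Suc n))) f)" and pq: "p < q"
  shows "(\<lambda>n. LBINT x:{p..q}. \<psi> x *\<^sub>R steklov (inverse (real (Suc n))) f x) \<longlonglongrightarrow> (LBINT x:{p..q}. \<psi> x *\<^sub>R f x)"
proof -
  define d where "d n x = steklov (inverse (real (Suc n))) f x - f x" for n x
  have d: "L2_loc (d n)" for n unfolding d_def by (rule L2_loc_diff[OF s f])
  have "(\<lambda>n. (q - p) * B\<^sup>2 * (LBINT x:{p..q}. (norm (d n x))\<^sup>2)) \<longlonglongrightarrow> (q - p) * B\<^sup>2 * 0"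
    unfolding d_def by (intro tendsto_intros L2_loc_steklov_lim f)
  then have 0: "(\<lambda>n. (q - p) * B\<^sup>2 * (LBINT x:{p..q}. (norm (d n x))\<^sup>2)) \<longlonglongrightarrow> 0" by simp
  have le: "(norm (LBINT x:{p..q}. \<psi> x *\<^sub>R d n x))\<^sup>2 \<le> (q - p) * B\<^sup>2 * (LBINT x:{p..q}. (norm (d n x))\<^sup>2)" for n
  proof -
    have "(norm (LBINT x:{p..q}. \<psi> x *\<^sub>R d n x))\<^sup>2 \<le> (q - p) * (LBINT x:{p..q}. (norm (\<psi> x *\<^sub>R d n x))\<^sup>2)"
      by (rule norm_set_integral_squared_le[OF L2_loc_scaleR[OF \<psi> d] pq])
    also have "\<dots> \<le> (q - p) * (LBINT x:{p..q}. B\<^sup>2 * (norm (d n x))\<^sup>2)"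
    proof (intro mult_left_mono set_integral_mono L2_loc_square L2_loc_scaleR[OF \<psi> d] set_integrable_mult_right d)
      fix x
      have "\<bar>\<psi> x\<bar>\<^sup>2 \<le> B\<^sup>2" by (intro power_mono \<psi>) simp
      then show "(norm (\<psi> x *\<^sub>R d n x))\<^sup>2 \<le> B\<^sup>2 * (norm (d n x))\<^sup>2"
        by (simp add: power_mult_distrib mult_right_mono)
    qed (use pq in simp)
    also have "\<dots> = (q - p) * B\<^sup>2 * (LBINT x:{p..q}. (norm (d n x))\<^sup>2)"
      by simp
    finally show ?thesis .
  qed
  have "(\<lambda>n. (norm (LBINT x:{p..q}. \<psi> x *\<^sub>R d n x))\<^sup>2) \<longlonglongrightarrow> 0"
    by (rule tendsto_sandwich[OF _ _ tendsto_const 0]) (use le in auto)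
  then have "(\<lambda>n. sqrt ((norm (LBINT x:{p..q}. \<psi> x *\<^sub>R d n x))\<^sup>2)) \<longlonglongrightarrow> sqrt 0"
    by (rule tendsto_real_sqrt)
  then have "(\<lambda>n. LBINT x:{p..q}. \<psi> x *\<^sub>R d n x) \<longlonglongrightarrow> 0"
    by (simp add: tendsto_norm_zero_iff)
  moreover have "(LBINT x:{p..q}. \<psi> x *\<^sub>R d n x) =
      (LBINT x:{p..q}. \<psi> x *\<^sub>R steklov (inverse (real (Suc n))) f x) - (LBINT x:{p..q}. \<psi> x *\<^sub>R f x)" for n
    unfolding d_def scaleR_right_diff_distrib
    by (intro set_integral_diff(2) L2_loc_set_integrable L2_loc_scaleR[OF \<psi>] s f)
  ultimately show ?thesis by (simp only: LIM_zero_iff)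
qed

lemma continuous_compact_support_bounded:
  fixes \<psi> :: "real \<Rightarrow> real"
  assumes "continuous_on UNIV \<psi>" "compact K" "\<And>x. x \<notin> K \<Longrightarrow> \<psi> x = 0"
  obtains B where "\<And>x. \<bar>\<psi> x\<bar> \<le> B"
proof -
  have "compact (\<psi> ` K)" using assms by (intro compact_continuous_image continuous_on_subset[OF assms(1)]) auto
  then have "bounded (\<psi> ` K)" by (rule compact_imp_bounded)
  then obtain B where B: "\<forall>x\<in>K. \<bar>\<psi> x\<bar> \<le> B" unfolding bounded_real by auto
  have "\<bar>\<psi> x\<bar> \<le> max 0 B" for x using B assms(3)[of x] by (cases "x \<in> K") (auto simp: le_max_iff_disj)
  then show ?thesis by (rule that)
qed

lemma test_integral_eq:
  assumes f: "f \<in> borel_measurable borel" and \<psi>: "continuous_on UNIV (\<psi> :: real \<Rightarrow> real)"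
    and supp: "\<And>x. x \<notin> K \<Longrightarrow> \<psi> x = 0" "K \<subseteq> I" "K \<subseteq> {p..q}"
  shows "(LINT x:I|lebesgue. \<psi> x *\<^sub>R f x) = (LBINT x:{p..q}. \<psi> x *\<^sub>R (f x :: complex))"
proof -
  note [measurable] = f borel_measurable_continuous_onI[OF \<psi>]
  have "(\<lambda>x. indicator I x *\<^sub>R (\<psi> x *\<^sub>R f x)) = (\<lambda>x. indicator {p..q} x *\<^sub>R (\<psi> x *\<^sub>R f x))"
  proof
    fix x
    show "indicator I x *\<^sub>R (\<psi> x *\<^sub>R f x) = indicator {p..q} x *\<^sub>R (\<psi> x *\<^sub>R f x)"
      using supp by (cases "x \<in> K") (auto simp: indicator_def subset_iff)
  qed
  moreover have "(LINT x|lebesgue. indicator {p..q} x *\<^sub>R (\<psi> x *\<^sub>R f x)) = (LBINT x. indicator {p..q} x *\<^sub>R (\<psi> x *\<^sub>R f x))"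
    by (rule integral_completion) measurable
  ultimately show ?thesis unfolding set_lebesgue_integral_def by simp
qed

text \<open>The means of \<open>Y\<close> are continuously differentiable, so integration by parts
  is classical for them; L^2 convergence of the means of \<open>Y\<close> and of \<open>g\<close>
  carries the identity over.\<close>

lemma primitive_has_weak_deriv:
  assumes g: "L2_loc g" and Y: "is_primitive Y g"
  shows "has_weak_deriv I Y g"
  unfolding has_weak_deriv_def
proof (intro conjI allI impI)
  have cY: "continuous_on UNIV Y" by (rule increment_continuous[OF g Y])
  then have LY: "L2_loc Y" by (rule continuous_L2_loc)
  show "L1_loc I Y" "L1_loc I g" by (intro L2_loc_L1_loc LY g)+
  fix \<phi> assume "test_function I \<phi>"
  then obtain K where K: "compact K" "K \<subseteq> I" and \<phi>: "\<And>x. x \<notin> K \<Longrightarrow> \<phi> x = 0" "\<And>x. x \<notin> K \<Longrightarrow> deriv \<phi> x = 0"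
    "\<And>x. (\<phi> has_real_derivative deriv \<phi> x) (at x)" "continuous_on UNIV (deriv \<phi>)" "continuous_on UNIV \<phi>"
    by (rule test_functionE) blast
  obtain B B' where B: "\<And>x. \<bar>\<phi> x\<bar> \<le> B" "\<And>x. \<bar>deriv \<phi> x\<bar> \<le> B'"
    using continuous_compact_support_bounded[OF \<phi>(5) K(1) \<phi>(1)] continuous_compact_support_bounded[OF \<phi>(4) K(1) \<phi>(2)]
    by metis
  \<comment> \<open>The radius is taken strictly larger than the support, so that the boundary terms
    in the integration by parts vanish.\<close>
  obtain r p q where K': "K \<subseteq> {p..q}" and r: "r = \<bar>p\<bar> + \<bar>q\<bar> + 1"
    using compact_subset_Icc[OF K(1)] by metis
  then have pq: "- r < p" "q < r" and "r > 0" by auto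
  moreover have "p \<le> x \<and> x \<le> q" if "x \<in> K" for x using K' that by auto
  ultimately have r: "r > 0" "K \<subseteq> {- r..r}" "- r \<notin> K" "r \<notin> K" by force+
  let ?h = "\<lambda>n. inverse (real (Suc n))"
  have D: "(steklov (?h n) Y has_vector_derivative steklov (?h n) g t) (at t)"
    "continuous_on UNIV (steklov (?h n) g)" for n t
    using steklov_has_vector_derivative[OF g Y, of "?h n"] by simp_all
  have cS: "continuous_on UNIV (steklov (?h n) Y)" for n
    using D(1) by (meson continuous_at_imp_continuous_on has_vector_derivative_continuous)
  have L: "L2_loc (steklov (?h n) Y)" "L2_loc (steklov (?h n) g)" for n
    by (intro continuous_L2_loc cS D(2))+
  have ibp: "(LBINT x:{- r..r}. deriv \<phi> x *\<^sub>R steklov (?h n) Y x) = - (LBINT x:{- r..r}. \<phi> x *\<^sub>R steklov (?h n) g x)" for n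
  proof -
    have i: "set_integrable lborel {- r..r} (\<lambda>x. deriv \<phi> x *\<^sub>R steklov (?h n) Y x)"
      "set_integrable lborel {- r..r} (\<lambda>x. \<phi> x *\<^sub>R steklov (?h n) g x)"
      by (intro L2_loc_set_integrable L2_loc_scaleR[OF \<phi>(4) B(2)] L2_loc_scaleR[OF \<phi>(5) B(1)] L)+
    have "((\<lambda>x. deriv \<phi> x *\<^sub>R steklov (?h n) Y x + \<phi> x *\<^sub>R steklov (?h n) g x) has_integral
        \<phi> r *\<^sub>R steklov (?h n) Y r - \<phi> (- r) *\<^sub>R steklov (?h n) Y (- r)) {- r..r}"
    proof (rule fundamental_theorem_of_calculus)
      show "- r \<le> r" using r by simp
      show "((\<lambda>x. \<phi> x *\<^sub>R steklov (?h n) Y x) has_vector_derivative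
          deriv \<phi> x *\<^sub>R steklov (?h n) Y x + \<phi> x *\<^sub>R steklov (?h n) g x) (at x within {- r..r})" for x
        using has_vector_derivative_scaleR[OF has_field_derivative_at_within[OF \<phi>(3)] has_vector_derivative_at_within[OF D(1)]]
        by (simp add: add.commute)
    qed
    then have "integral {- r..r} (\<lambda>x. deriv \<phi> x *\<^sub>R steklov (?h n) Y x + \<phi> x *\<^sub>R steklov (?h n) g x) = 0"
      using \<phi>(1)[OF r(3)] \<phi>(1)[OF r(4)] by (simp add: integral_unique)
    then have "(LBINT x:{- r..r}. deriv \<phi> x *\<^sub>R steklov (?h n) Y x + \<phi> x *\<^sub>R steklov (?h n) g x) = 0"
      by (simp only: set_borel_integral_eq_integral(2)[OF set_integral_add(1)[OF i]])
    then show ?thesis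
      by (simp only: set_integral_add(2)[OF i] add_eq_0_iff2)
  qed
  have "(LBINT x:{- r..r}. deriv \<phi> x *\<^sub>R Y x) = - (LBINT x:{- r..r}. \<phi> x *\<^sub>R g x)"
  proof (rule LIMSEQ_unique)
    show "(\<lambda>n. LBINT x:{- r..r}. deriv \<phi> x *\<^sub>R steklov (?h n) Y x) \<longlonglongrightarrow> (LBINT x:{- r..r}. deriv \<phi> x *\<^sub>R Y x)"
      by (rule set_integral_scaleR_steklov_lim[OF \<phi>(4) B(2) LY L(1)]) (use r in simp)
    show "(\<lambda>n. LBINT x:{- r..r}. deriv \<phi> x *\<^sub>R steklov (?h n) Y x) \<longlonglongrightarrow> - (LBINT x:{- r..r}. \<phi> x *\<^sub>R g x)"
      unfolding ibp
      by (intro tendsto_minus set_integral_scaleR_steklov_lim[OF \<phi>(5) B(1) g L(2)]) (use r in simp)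
  qed
  then show "(LINT x:I|lebesgue. deriv \<phi> x *\<^sub>R Y x) = - (LINT x:I|lebesgue. \<phi> x *\<^sub>R g x)"
    using test_integral_eq[OF L2_loc_measurable[OF LY] \<phi>(4,2) K(2) r(2)]
      test_integral_eq[OF L2_loc_measurable[OF g] \<phi>(5,1) K(2) r(2)] by simp
qed

section \<open>Invariance under changes on null sets, and norms of concrete representatives\<close>

lemma set_integrable_lebesgue_cong_AE:
  fixes f f' :: "real \<Rightarrow> 'a::euclidean_space"
  assumes f: "set_integrable lebesgue A f" and ae: "AE x in lebesgue. x \<in> A \<longrightarrow> f x = f' x"
  shows "set_integrable lebesgue A f'"
    and "(LINT x:A|lebesgue. f x) = (LINT x:A|lebesgue. f' x)"
proof -
  obtain N where N: "N \<in> null_sets lebesgue" "{x. \<not> (x \<in> A \<longrightarrow> f x = f' x)} \<subseteq> N"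
    using ae by (auto simp: eventually_ae_filter)
  then have neg: "negligible N" by (simp add: negligible_iff_null_sets)
  show *: "set_integrable lebesgue A f'"
    by (rule absolutely_integrable_spike[OF f neg]) (use N in auto)
  show "(LINT x:A|lebesgue. f x) = (LINT x:A|lebesgue. f' x)"
    unfolding set_lebesgue_integral_def
    by (rule integral_cong_AE)
       (use f * ae in \<open>auto simp: set_integrable_def indicator_def dest: borel_measurable_integrable elim!: eventually_mono\<close>)
qed

lemma L1_loc_cong_AE:
  assumes "L1_loc I u" "AE x in lebesgue. x \<in> I \<longrightarrow> u x = u' x"
  shows "L1_loc I u'"
  unfolding L1_loc_def
proof (intro allI impI, elim conjE)
  fix K assume K: "compact K" "K \<subseteq> I"
  show "set_integrable lebesgue K u'"
  proof (rule set_integrable_lebesgue_cong_AE(1))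
    show "set_integrable lebesgue K u" using assms(1) K by (simp add: L1_loc_def)
    show "AE x in lebesgue. x \<in> K \<longrightarrow> u x = u' x"
      using assms(2) by eventually_elim (use K in auto)
  qed
qed

lemma test_integral_cong_AE:
  fixes u u' :: "real \<Rightarrow> complex"
  assumes u: "L1_loc I u" and ae: "AE x in lebesgue. x \<in> I \<longrightarrow> u x = u' x"
    and \<psi>: "continuous_on UNIV \<psi>" and K: "compact K" "K \<subseteq> I" "\<And>x. x \<notin> K \<Longrightarrow> \<psi> x = 0"
  shows "(LINT x:I|lebesgue. \<psi> x *\<^sub>R u x) = (LINT x:I|lebesgue. \<psi> x *\<^sub>R u' x)"
proof -
  have u': "L1_loc I u'" by (rule L1_loc_cong_AE[OF u ae])
  have m: "(\<lambda>x. indicator I x *\<^sub>R (\<psi> x *\<^sub>R v x)) \<in> borel_measurable lebesgue" if "L1_loc I v" for v :: "real \<Rightarrow> complex"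
  proof -
    have "(\<lambda>x. indicator K x *\<^sub>R v x) \<in> borel_measurable lebesgue"
      using that K by (simp add: L1_loc_def set_integrable_def borel_measurable_integrable)
    moreover have "\<psi> \<in> borel_measurable lebesgue"
      using \<psi> by (intro measurable_completion) (simp add: borel_measurable_continuous_onI)
    ultimately have "(\<lambda>x. \<psi> x *\<^sub>R (indicator K x *\<^sub>R v x)) \<in> borel_measurable lebesgue" by measurable
    moreover have "indicator I x *\<^sub>R (\<psi> x *\<^sub>R v x) = \<psi> x *\<^sub>R (indicator K x *\<^sub>R v x)" for x
      using K(2,3) by (rule indicator_scaleR_support)
    ultimately show ?thesis by (simp only:)
  qed
  show ?thesis
    unfolding set_lebesgue_integral_def
    by (rule integral_cong_AE[OF m[OF u] m[OF u']]) (use ae in \<open>auto simp: indicator_def elim!: eventually_mono\<close>)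
qed

lemma has_weak_deriv_cong_AE:
  assumes w: "has_weak_deriv I u g" and u: "AE x in lebesgue. x \<in> I \<longrightarrow> u x = u' x"
    and g: "AE x in lebesgue. x \<in> I \<longrightarrow> g x = g' x"
  shows "has_weak_deriv I u' g'"
  unfolding has_weak_deriv_def
proof (intro conjI allI impI)
  have L: "L1_loc I u" "L1_loc I g" using w by (auto simp: has_weak_deriv_def)
  show "L1_loc I u'" "L1_loc I g'" using L1_loc_cong_AE[OF L(1) u] L1_loc_cong_AE[OF L(2) g] by auto
  fix \<phi> assume t: "test_function I \<phi>"
  then obtain K where K: "compact K" "K \<subseteq> I" and \<phi>: "\<And>x. x \<notin> K \<Longrightarrow> \<phi> x = 0" "\<And>x. x \<notin> K \<Longrightarrow> deriv \<phi> x = 0"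
    "continuous_on UNIV (deriv \<phi>)" "continuous_on UNIV \<phi>"
    by (rule test_functionE) blast
  have "(LINT x:I|lebesgue. deriv \<phi> x *\<^sub>R u x) = - (LINT x:I|lebesgue. \<phi> x *\<^sub>R g x)"
    using w t by (simp add: has_weak_deriv_def)
  then show "(LINT x:I|lebesgue. deriv \<phi> x *\<^sub>R u' x) = - (LINT x:I|lebesgue. \<phi> x *\<^sub>R g' x)"
    using test_integral_cong_AE[OF L(1) u \<phi>(3) K \<phi>(2)] test_integral_cong_AE[OF L(2) g \<phi>(4) K \<phi>(1)] by simp
qed

lemma has_weak_deriv_subset:
  assumes w: "has_weak_deriv I u g" and J: "J \<subseteq> I"
  shows "has_weak_deriv J u g"
  unfolding has_weak_deriv_def
proof (intro conjI allI impI)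
  show "L1_loc J u" "L1_loc J g" using w J by (auto simp: has_weak_deriv_def L1_loc_def)
  fix \<phi> assume t: "test_function J \<phi>"
  then obtain K where K: "compact K" "K \<subseteq> J" and \<phi>: "\<And>x. x \<notin> K \<Longrightarrow> \<phi> x = 0" "\<And>x. x \<notin> K \<Longrightarrow> deriv \<phi> x = 0"
    by (rule test_functionE) blast
  have "test_function I \<phi>" using t J by (auto simp: test_function_def)
  then have "(LINT x:I|lebesgue. deriv \<phi> x *\<^sub>R u x) = - (LINT x:I|lebesgue. \<phi> x *\<^sub>R g x)"
    using w by (simp add: has_weak_deriv_def)
  moreover have "indicator I x *\<^sub>R (deriv \<phi> x *\<^sub>R u x) = indicator J x *\<^sub>R (deriv \<phi> x *\<^sub>R u x)"
    "indicator I x *\<^sub>R (\<phi> x *\<^sub>R g x) = indicator J x *\<^sub>R (\<phi> x *\<^sub>R g x)" for x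
    using K(2) J \<phi>(1)[of x] \<phi>(2)[of x] by (auto simp: indicator_def)
  ultimately show "(LINT x:J|lebesgue. deriv \<phi> x *\<^sub>R u x) = - (LINT x:J|lebesgue. \<phi> x *\<^sub>R g x)"
    unfolding set_lebesgue_integral_def by (simp only:)
qed

lemma set_integral_Ioo_lebesgue:
  fixes f F :: "real \<Rightarrow> real"
  assumes F: "set_integrable lborel {p..q} F" and ae: "AE x in lebesgue. x \<in> {p<..<q} \<longrightarrow> f x = F x"
  shows "(LINT x:{p<..<q}|lebesgue. f x) = (LBINT x:{p..q}. F x)"
    and "set_integrable lebesgue {p<..<q} f"
proof -
  have 1: "set_integrable lborel {p<..<q} F" by (rule set_integrable_subset[OF F]) auto
  then have 2: "set_integrable lebesgue {p<..<q} F" by (simp add: set_integrable_def integrable_completion)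
  have ae': "AE x in lebesgue. x \<in> {p<..<q} \<longrightarrow> F x = f x" using ae by (auto elim!: eventually_mono)
  show "set_integrable lebesgue {p<..<q} f" by (rule set_integrable_lebesgue_cong_AE(1)[OF 2 ae'])
  have "(LINT x:{p<..<q}|lebesgue. f x) = (LINT x:{p<..<q}|lebesgue. F x)"
    using set_integrable_lebesgue_cong_AE(2)[OF 2 ae'] by simp
  also have "\<dots> = (LBINT x:{p<..<q}. F x)"
    using 1 unfolding set_lebesgue_integral_def set_integrable_def
    by (intro integral_completion borel_measurable_integrable) auto
  also have "\<dots> = (LBINT x:{p..q}. F x)"
    unfolding set_lebesgue_integral_def
  proof (rule integral_cong_AE)
    show "AE x in lborel. indicator {p<..<q} x *\<^sub>R F x = indicator {p..q} x *\<^sub>R F x"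
      using AE_lborel_singleton[of p] AE_lborel_singleton[of q]
      by eventually_elim (auto simp: indicator_def)
  qed (use F 1 in \<open>auto simp: set_integrable_def dest: borel_measurable_integrable\<close>)
  finally show "(LINT x:{p<..<q}|lebesgue. f x) = (LBINT x:{p..q}. F x)" .
qed

text \<open>Removes the choice hidden in \<open>weak_deriv\<close>: almost everywhere the chosen
  derivative is \<open>g\<close>, and integrals do not see the rest.\<close>

lemma H1_norm_eq:
  assumes g: "L2_loc g" and Y: "is_primitive Y g"
    and ae: "AE x in lebesgue. x \<in> {-1<..<0} \<longrightarrow> u x = Y x"
  shows "H1_norm {-1<..<0} u = sqrt (H1sq (-1) 0 Y g)"
proof -
  have LY: "L2_loc Y" by (intro continuous_L2_loc increment_continuous[OF g Y])
  have "has_weak_deriv {-1<..<0} u g"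
    by (rule has_weak_deriv_cong_AE[OF primitive_has_weak_deriv[OF g Y]]) (use ae in \<open>auto elim!: eventually_mono\<close>)
  then have w: "AE x in lebesgue. x \<in> {-1<..<0} \<longrightarrow> weak_deriv {-1<..<0} u x = g x"
    by (rule weak_deriv_AE_eq) auto
  have "(LINT x:{-1<..<0}|lebesgue. (norm (u x))\<^sup>2) = (LBINT x:{-1..0}. (norm (Y x))\<^sup>2)"
    by (rule set_integral_Ioo_lebesgue[OF L2_loc_square[OF LY]]) (use ae in \<open>auto elim!: eventually_mono\<close>)
  moreover have "(LINT x:{-1<..<0}|lebesgue. (norm (weak_deriv {-1<..<0} u x))\<^sup>2) = (LBINT x:{-1..0}. (norm (g x))\<^sup>2)"
    by (rule set_integral_Ioo_lebesgue[OF L2_loc_square[OF g]]) (use w in \<open>auto elim!: eventually_mono\<close>)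
  ultimately show ?thesis unfolding H1_norm_def H1sq_eq[OF LY g] by simp
qed

lemma AE_lebesgue_shift:
  assumes "AE x in lebesgue. P (x :: real)"
  shows "AE x in lebesgue. P (c + x)"
proof -
  obtain N where N: "N \<in> null_sets lebesgue" "{x. \<not> P x} \<subseteq> N"
    using assms by (auto simp: eventually_ae_filter)
  have "(+) (- c) ` N \<in> null_sets lebesgue"
    using N(1) negligible_translation[of N "- c"] by (simp add: negligible_iff_null_sets)
  moreover have "{x. \<not> P (c + x)} \<subseteq> (+) (- c) ` N"
    using N(2) by (force simp: image_iff)
  ultimately show ?thesis by (auto simp: eventually_ae_filter)
qed

lemma is_primitive_shift:
  assumes "is_primitive Y g"
  shows "is_primitive (\<lambda>s. Y (c + s)) (\<lambda>s. g (c + s))"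
  using assms unfolding is_primitive_def set_integral_translation by simp

lemma state_norm_eq:
  assumes g: "L2_loc g" and Y: "is_primitive Y g"
    and ae: "AE x in lebesgue. -1 < x \<longrightarrow> y x = Y x" and t: "t \<ge> 0"
  shows "state_norm y t = sqrt (H1sq (t - 1) t Y g)"
proof -
  have "state_norm y t = sqrt (H1sq (-1) 0 (\<lambda>s. Y (t + s)) (\<lambda>s. g (t + s)))"
    unfolding state_norm_def
    by (rule H1_norm_eq[OF L2_loc_shift[OF g] is_primitive_shift[OF Y]])
       (use AE_lebesgue_shift[OF ae, of t] t in \<open>auto elim!: eventually_mono\<close>)
  also have "H1sq (-1) 0 (\<lambda>s. Y (t + s)) (\<lambda>s. g (t + s)) = H1sq (t - 1) t Y g"
    unfolding H1sq_def by (subst set_integral_translation) simp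
  finally show ?thesis .
qed

lemma lebesgue_borel_representative:
  fixes f :: "real \<Rightarrow> complex"
  assumes "f \<in> borel_measurable lebesgue"
  obtains f' where "f' \<in> borel_measurable borel" "AE x in lebesgue. f x = f' x"
proof -
  have "(\<lambda>x. Re (f x)) \<in> borel_measurable lebesgue" "(\<lambda>x. Im (f x)) \<in> borel_measurable lebesgue"
    using assms by measurable
  then obtain r i where "r \<in> borel_measurable lborel" "AE x in lborel. Re (f x) = r x"
    and "i \<in> borel_measurable lborel" "AE x in lborel. Im (f x) = i x"
    using completion_ex_borel_measurable_real[of _ lborel] by metis
  then have m: "r \<in> borel_measurable borel" "i \<in> borel_measurable borel"
    and ae: "AE x in lebesgue. Re (f x) = r x" "AE x in lebesgue. Im (f x) = i x"
    by (auto intro: AE_completion)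
  note [measurable] = m
  show ?thesis
  proof (rule that[of "\<lambda>x. Complex (r x) (i x)"])
    have "(\<lambda>x. complex_of_real (r x) + \<i> * complex_of_real (i x)) \<in> borel_measurable borel" by measurable
    then show "(\<lambda>x. Complex (r x) (i x)) \<in> borel_measurable borel" by (simp add: Complex_eq)
    show "AE x in lebesgue. f x = Complex (r x) (i x)"
      using ae by eventually_elim (simp add: complex_eq_iff)
  qed
qed

text \<open>Bridge from the weak formulation to pairs \<open>Y\<close>, \<open>g\<close> on the
  whole line. The delicate point is the end -1: local regularity on the open half-line gives nothing
  uniform there, and square integrability has to come from the initial datum.\<close>

lemma ndde_solution_representation:
  assumes "ndde_solution a b y0 y"
  obtains Y g where "ac_solution a b Y g" "H1_norm {-1<..<0} y0 = sqrt (H1sq (-1) 0 Y g)"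
    "\<And>t. t \<ge> 0 \<Longrightarrow> state_norm y t = sqrt (H1sq (t - 1) t Y g)"
proof -
  define I where "I = {-1::real<..}"
  define J where "J = {-1::real<..<0}"
  have I: "open I" "is_interval I" "I \<noteq> {}" and J: "open J" "is_interval J" "J \<subseteq> I"
    by (auto simp: I_def J_def is_interval_1)
  obtain g0 where g0: "has_weak_deriv J y0 g0" "L2_on J g0"
    using assms by (auto simp: ndde_solution_def H1_on_def J_def)
  obtain G where G: "has_weak_deriv I y G" "\<And>K. compact K \<Longrightarrow> K \<subseteq> I \<Longrightarrow> L2_on K G"
    using assms by (auto simp: ndde_solution_def H1_loc_def I_def)
  have y0: "AE t in lebesgue. t \<in> J \<longrightarrow> y t = y0 t"
    using assms by (auto simp: ndde_solution_def J_def elim!: eventually_mono)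
  have "has_weak_deriv J y0 G"
    by (rule has_weak_deriv_cong_AE[OF has_weak_deriv_subset[OF G(1) J(3)] y0]) simp
  then have Gg0: "AE x in lebesgue. x \<in> J \<longrightarrow> g0 x = G x"
    using has_weak_deriv_unique[OF g0(1) _ J(1,2)] by blast
  \<comment> \<open>By uniqueness the weak derivative of \<open>y\<close> agrees on the history
    interval with that of \<open>y0\<close>, which is square integrable up to -1.\<close>
  have GJ: "set_integrable lebesgue J (\<lambda>x. (norm (G x))\<^sup>2)"
    by (rule set_integrable_lebesgue_cong_AE(1)[of _ "\<lambda>x. (norm (g0 x))\<^sup>2"])
       (use g0(2) Gg0 in \<open>auto simp: L2_on_def elim!: eventually_mono\<close>)
  \<comment> \<open>Measurability is granted on compact subsets only, hence the exhaustion of the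
    half-line by compact intervals.\<close>
  have "(\<lambda>x. indicator I x *\<^sub>R G x) \<in> borel_measurable lebesgue"
  proof (rule borel_measurable_LIMSEQ_metric)
    fix n
    have "{-1 + inverse (real (Suc n))..real n} \<subseteq> I" by (auto simp: I_def intro: less_le_trans[rotated])
    then show "(\<lambda>x. indicator {-1 + inverse (real (Suc n))..real n} x *\<^sub>R G x) \<in> borel_measurable lebesgue"
      using G(2)[of "{-1 + inverse (real (Suc n))..real n}"] by (simp add: L2_on_def set_borel_measurable_def)
  next
    fix x :: real
    have "\<forall>\<^sub>F n in sequentially. indicator {-1 + inverse (real (Suc n))..real n} x *\<^sub>R G x = indicator I x *\<^sub>R G x"
    proof (cases "x \<in> I")
      case True
      then obtain m where m: "inverse (real (Suc m)) < x + 1"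
        using reals_Archimedean[of "x + 1"] by (auto simp: I_def)
      obtain k :: nat where k: "x \<le> real k" using real_arch_simple by blast
      show ?thesis
      proof (rule eventually_sequentiallyI[of "max m k"])
        fix n assume n: "max m k \<le> n"
        have "inverse (real (Suc n)) \<le> inverse (real (Suc m))" using n by simp
        then have "-1 + inverse (real (Suc n)) \<le> x" using m by linarith
        moreover have "x \<le> real n" using k n by simp
        ultimately have "x \<in> {-1 + inverse (real (Suc n))..real n}" by (simp only: atLeastAtMost_iff)
        then show "indicator {-1 + inverse (real (Suc n))..real n} x *\<^sub>R G x = indicator I x *\<^sub>R G x"
          using True by (simp only: indicator_simps)
      qed
    next
      case False
      then have "x \<le> -1" by (simp add: I_def)
      have "x \<notin> {-1 + inverse (real (Suc n))..real n}" for n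
      proof -
        have "0 < inverse (real (Suc n))" by simp
        then have "\<not> -1 + inverse (real (Suc n)) \<le> x" using \<open>x \<le> -1\<close> by linarith
        then show ?thesis by (simp only: atLeastAtMost_iff) simp
      qed
      then show ?thesis
        using False by (intro always_eventually allI) (simp only: indicator_simps not_False_eq_True)
    qed
    then show "(\<lambda>n. indicator {-1 + inverse (real (Suc n))..real n} x *\<^sub>R G x) \<longlonglongrightarrow> indicator I x *\<^sub>R G x"
      by (rule tendsto_eventually)
  qed
  then obtain g1 where g1: "g1 \<in> borel_measurable borel" "AE x in lebesgue. indicator I x *\<^sub>R G x = g1 x"
    by (rule lebesgue_borel_representative)
  define g where "g x = indicator I x *\<^sub>R g1 x" for x
  note [measurable] = g1(1)
  have mg: "g \<in> borel_measurable borel" unfolding g_def[abs_def] I_def by measurable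
  have Gg: "AE x in lebesgue. x \<in> I \<longrightarrow> G x = g x"
    using g1(2) by eventually_elim (auto simp: g_def indicator_def)
  have g0I: "g x = 0" if "x \<notin> I" for x using that by (simp add: g_def)
  have Lg: "L2_loc g"
    unfolding L2_loc_def
  proof (intro conjI allI mg)
    fix p q :: real
    define A where "A = J \<union> {0..max q 0}"
    have "set_integrable lebesgue {0..max q 0} (\<lambda>x. (norm (G x))\<^sup>2)"
    proof -
      have "{0..max q 0} \<subseteq> I" by (auto simp: I_def)
      then show ?thesis using G(2)[OF compact_Icc] by (simp add: L2_on_def)
    qed
    then have "set_integrable lebesgue A (\<lambda>x. (norm (G x))\<^sup>2)"
      unfolding A_def by (intro set_integrable_Un GJ) (auto simp: J_def)
    then have "set_integrable lebesgue A (\<lambda>x. (norm (g x))\<^sup>2)"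
      by (rule set_integrable_lebesgue_cong_AE(1))
         (use Gg in \<open>auto simp: A_def I_def J_def elim!: eventually_mono\<close>)
    then have "set_integrable lebesgue (A \<inter> {p..q}) (\<lambda>x. (norm (g x))\<^sup>2)"
      by (rule set_integrable_subset) (auto simp: A_def J_def)
    also have "?this \<longleftrightarrow> set_integrable lebesgue {p..q} (\<lambda>x. (norm (g x))\<^sup>2)"
      unfolding set_integrable_def
    proof (intro arg_cong[where f = "integrable lebesgue"] ext)
      fix x
      show "indicator (A \<inter> {p..q}) x *\<^sub>R (norm (g x))\<^sup>2 = indicator {p..q} x *\<^sub>R (norm (g x))\<^sup>2"
        using g0I[of x] by (cases "x \<in> I") (auto simp: indicator_def A_def I_def J_def)
    qed
    finally show "set_integrable lborel {p..q} (\<lambda>x. (norm (g x))\<^sup>2)"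
      unfolding set_integrable_def by (subst (asm) integrable_completion) (use mg in measurable)
  qed
  \<comment> \<open>Since \<open>g\<close> vanishes up to -1, this is the integral from -1; the
    primitive is continued to the left as a constant.\<close>
  define H where "H t = (LBINT s:{..t}. g s)" for t
  have ig: "set_integrable lborel {..t} g" for t
  proof -
    have "indicator {..t} x *\<^sub>R g x = indicator {-1..t} x *\<^sub>R g x" for x
      using g0I[of x] by (cases "x \<in> I") (auto simp: indicator_def I_def)
    then show ?thesis
      using L2_loc_set_integrable[OF Lg, of "-1" t] unfolding set_integrable_def by (simp only:)
  qed
  have inc: "H q - H p = (LBINT s:{p..q}. g s)" if "p \<le> q" for p q
  proof -
    have "H q - H p = (LBINT s. indicator {..q} s *\<^sub>R g s - indicator {..p} s *\<^sub>R g s)"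
      unfolding H_def set_lebesgue_integral_def using ig
      by (subst Bochner_Integration.integral_diff) (auto simp: set_integrable_def)
    also have "\<dots> = (LBINT s:{p..q}. g s)"
      unfolding set_lebesgue_integral_def
    proof (rule integral_cong_AE)
      show "AE s in lborel. indicator {..q} s *\<^sub>R g s - indicator {..p} s *\<^sub>R g s = indicator {p..q} s *\<^sub>R g s"
        using AE_lborel_singleton[of p] by eventually_elim (use that in \<open>auto simp: indicator_def\<close>)
    qed (use mg in measurable)
    finally show ?thesis .
  qed
  have "has_weak_deriv I y g"
    by (rule has_weak_deriv_cong_AE[OF G(1) _ Gg]) simp
  moreover have "H q - H p = integral {p..q} g" if "p \<in> I" "q \<in> I" "p \<le> q" for p q
    using inc[OF that(3)] by (simp add: set_borel_integral_eq_integral(2)[OF L2_loc_set_integrable[OF Lg]])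
  ultimately obtain C where C: "AE x in lebesgue. x \<in> I \<longrightarrow> y x = C + H x"
    using has_weak_deriv_representative[OF _ I, of y g H] by blast
  define Y where "Y x = C + H x" for x
  have Y: "is_primitive Y g" using inc by (simp add: is_primitive_def Y_def)
  have yY: "AE x in lebesgue. -1 < x \<longrightarrow> y x = Y x" using C by (auto simp: I_def Y_def elim!: eventually_mono)
  have wg: "AE x in lebesgue. -1 < x \<longrightarrow> weak_deriv I y x = g x"
    using weak_deriv_AE_eq[OF \<open>has_weak_deriv I y g\<close> I(1,2)] by (auto simp: I_def elim!: eventually_mono)
  have eq: "AE t in lebesgue. t > 0 \<longrightarrow> weak_deriv I y t - weak_deriv I y (t - 1) + of_real a * y t + of_real b * y (t - 1) = 0"
    using assms by (simp add: ndde_solution_def I_def)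
  have "AE t in lebesgue. t \<noteq> 0" by (intro AE_completion AE_lborel_singleton)
  then have "AE t in lebesgue. t \<ge> 0 \<longrightarrow> g t - g (t - 1) + of_real a * Y t + of_real b * Y (t - 1) = 0"
    using eq yY wg AE_lebesgue_shift[OF yY, of "-1"] AE_lebesgue_shift[OF wg, of "-1"]
  proof eventually_elim
    case (elim t)
    then show ?case by auto
  qed
  then have S: "ac_solution a b Y g" using Lg Y by (simp add: ac_solution_def AE_completion_iff)
  show ?thesis
  proof (rule that[OF S])
    have "AE x in lebesgue. x \<in> {-1<..<0} \<longrightarrow> y0 x = Y x"
      using y0 yY by eventually_elim (auto simp: J_def)
    then show "H1_norm {-1<..<0} y0 = sqrt (H1sq (-1) 0 Y g)" by (rule H1_norm_eq[OF Lg Y])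
    show "state_norm y t = sqrt (H1sq (t - 1) t Y g)" if "t \<ge> 0" for t
      by (rule state_norm_eq[OF Lg Y yY that])
  qed
qed

subsection \<open>Stability and instability\<close>

lemma L2_loc_L2_on:
  assumes "L2_loc f" "A \<in> sets borel" "A \<subseteq> {p..q}"
  shows "L2_on A f"
  unfolding L2_on_def
proof
  note [measurable] = L2_loc_measurable[OF assms(1)] assms(2)
  show "set_borel_measurable lebesgue A f"
    unfolding set_borel_measurable_def by (intro measurable_completion) measurable
  have "set_integrable lebesgue {p..q} (\<lambda>x. (norm (f x))\<^sup>2)"
    using L2_loc_square[OF assms(1)] by (simp add: set_integrable_def integrable_completion)
  then show "set_integrable lebesgue A (\<lambda>x. (norm (f x))\<^sup>2)"
    by (rule set_integrable_subset) (use assms in auto)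
qed

lemma classical_primitive:
  fixes y y' :: "real \<Rightarrow> complex"
  assumes dy: "\<And>t. (y has_vector_derivative y' t) (at t)" and c: "continuous_on UNIV y'"
  shows "is_primitive y y'" "L2_loc y'" "L2_loc y"
proof -
  show L: "L2_loc y'" by (rule continuous_L2_loc[OF c])
  show P: "is_primitive y y'"
    unfolding is_primitive_def
  proof (intro allI impI)
    fix p q :: real assume "p \<le> q"
    then have "(y' has_integral y q - y p) {p..q}"
      by (rule fundamental_theorem_of_calculus) (use dy in \<open>auto intro: has_vector_derivative_at_within\<close>)
    then show "y q - y p = (LBINT s:{p..q}. y' s)"
      by (simp add: set_borel_integral_eq_integral(2)[OF L2_loc_set_integrable[OF L]] integral_unique)
  qed
  show "L2_loc y" by (intro continuous_L2_loc increment_continuous[OF L P])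
qed

lemma classical_ndde_solution:
  fixes y y' :: "real \<Rightarrow> complex"
  assumes dy: "\<And>t. (y has_vector_derivative y' t) (at t)" and c: "continuous_on UNIV y'"
    and eq: "\<And>t. t > 0 \<Longrightarrow> y' t - y' (t - 1) + of_real a * y t + of_real b * y (t - 1) = 0"
  shows "ndde_solution a b y y"
  unfolding ndde_solution_def
proof (intro conjI)
  note P = classical_primitive[OF dy c]
  have w: "has_weak_deriv I y y'" for I by (rule primitive_has_weak_deriv[OF P(2,1)])
  have L: "L2_on {-1<..<0} f" if "L2_loc f" for f
    by (rule L2_loc_L2_on[OF that, of _ "-1" 0]) auto
  show "H1_on {-1<..<0} y"
    unfolding H1_on_def using w L P by blast
  have "L2_on K f" if "L2_loc f" "compact K" for f K
    using compact_subset_Icc[OF that(2)] L2_loc_L2_on[OF that(1) borel_compact[OF that(2)]] by metis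
  then show "H1_loc {-1<..} y"
    unfolding H1_loc_def using w P by blast
  have "AE t in lebesgue. t \<in> {-1<..} \<longrightarrow> weak_deriv {-1<..} y t = y' t"
    by (rule weak_deriv_AE_eq[OF w]) (auto simp: is_interval_1)
  then have 1: "AE t in lebesgue. -1 < t \<longrightarrow> weak_deriv {-1<..} y t = y' t" by simp
  show "AE t in lebesgue. 0 < t \<longrightarrow> weak_deriv {-1<..} y t - weak_deriv {-1<..} y (t - 1)
      + of_real a * y t + of_real b * y (t - 1) = 0"
    using 1 AE_lebesgue_shift[OF 1, of "-1"] by eventually_elim (use eq in auto)
qed auto

lemma H1sq_scaleR: "H1sq p q (\<lambda>s. k *\<^sub>R y s) (\<lambda>s. k *\<^sub>R g s) = k\<^sup>2 * H1sq p q y g"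
proof -
  have "H1sq p q (\<lambda>s. k *\<^sub>R y s) (\<lambda>s. k *\<^sub>R g s) = (LBINT s:{p..q}. k\<^sup>2 * ((norm (y s))\<^sup>2 + (norm (g s))\<^sup>2))"
    unfolding H1sq_def by (simp add: power_mult_distrib distrib_left)
  then show ?thesis unfolding H1sq_def by (simp only: set_integral_mult_right)
qed

text \<open>By linearity an unbounded solution can be scaled to arbitrarily small data. Largeness is
  asked on a whole unit window because the state norm is an integral; the term without derivative
  then already exceeds 1.\<close>

lemma unstable_classical:
  fixes y y' :: "real \<Rightarrow> complex"
  assumes dy: "\<And>t. (y has_vector_derivative y' t) (at t)" and c: "continuous_on UNIV y'"
    and eq: "\<And>t. t > 0 \<Longrightarrow> y' t - y' (t - 1) + of_real a * y t + of_real b * y (t - 1) = 0"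
    and unbounded: "\<And>M. \<exists>t\<ge>0. \<forall>s\<in>{t - 1..t}. norm (y s) \<ge> M"
  shows "unstable a b"
  unfolding unstable_def
proof
  assume "lyapunov_stable a b"
  then obtain \<delta> where \<delta>: "\<delta> > 0"
    "\<And>y0 y t. ndde_solution a b y0 y \<Longrightarrow> H1_norm {-1<..<0} y0 < \<delta> \<Longrightarrow> t \<ge> 0 \<Longrightarrow> state_norm y t < 1"
    unfolding lyapunov_stable_def by (metis zero_less_one)
  define N where "N = sqrt (H1sq (-1) 0 y y')"
  have N: "N \<ge> 0" by (simp add: N_def H1sq_nonneg)
  \<comment> \<open>Makes \<open>k * N < \<delta>\<close>; adding 1 avoids division by zero.\<close>
  define k where "k = \<delta> / (N + 1) / 2"
  have k: "k > 0" using \<delta>(1) N by (simp add: k_def)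
  define u where "u t = k *\<^sub>R y t" for t
  define u' where "u' t = k *\<^sub>R y' t" for t
  have du: "(u has_vector_derivative u' t) (at t)" for t
    unfolding u_def[abs_def] u'_def by (auto intro!: derivative_eq_intros dy)
  have cu: "continuous_on UNIV u'" unfolding u'_def[abs_def] by (intro continuous_intros c)
  have "u' t - u' (t - 1) + of_real a * u t + of_real b * u (t - 1) = 0" if "t > 0" for t
  proof -
    have "u' t - u' (t - 1) + of_real a * u t + of_real b * u (t - 1) =
        k *\<^sub>R (y' t - y' (t - 1) + of_real a * y t + of_real b * y (t - 1))"
      by (simp add: u_def u'_def scaleR_right_distrib scaleR_right_diff_distrib)
    then show ?thesis using eq[OF that] by simp
  qed
  then have sol: "ndde_solution a b u u" by (rule classical_ndde_solution[OF du cu])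
  note P = classical_primitive[OF du cu]
  have "H1_norm {-1<..<0} u = sqrt (H1sq (-1) 0 u u')"
    by (rule H1_norm_eq[OF P(2,1)]) simp
  also have "\<dots> = k * N"
    using k unfolding u_def[abs_def] u'_def[abs_def] H1sq_scaleR N_def by (simp add: real_sqrt_mult)
  also have "\<dots> < \<delta>" using \<delta>(1) N by (auto simp: k_def field_simps intro!: add_nonneg_pos)
  finally have small: "H1_norm {-1<..<0} u < \<delta>" .
  obtain t where t: "t \<ge> 0" "\<forall>s\<in>{t - 1..t}. norm (y s) \<ge> 1 / k" using unbounded by blast
  have "1 \<le> H1sq (t - 1) t u u'"
  proof -
    have "(LBINT s:{t - 1..t}. 1) \<le> H1sq (t - 1) t u u'"
      unfolding H1sq_def set_lebesgue_integral_def
    proof (rule integral_mono)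
      show "integrable lborel (\<lambda>s. indicator {t - 1..t} s *\<^sub>R (1::real))"
        using set_integrable_const_Icc[of "t - 1" t 1] by (simp add: set_integrable_def)
      show "integrable lborel (\<lambda>s. indicator {t - 1..t} s *\<^sub>R ((norm (u s))\<^sup>2 + (norm (u' s))\<^sup>2))"
        using H1sq_integrable[OF P(3,2)] by (simp add: set_integrable_def)
      fix s
      have "1 \<le> (norm (u s))\<^sup>2" if "s \<in> {t - 1..t}"
      proof -
        have "1 / k \<le> norm (y s)" using t(2) that by blast
        then have "1 \<le> norm (u s)" using k by (simp add: u_def field_simps)
        then show ?thesis by (rule one_le_power)
      qed
      then show "indicator {t - 1..t} s *\<^sub>R (1::real) \<le> indicator {t - 1..t} s *\<^sub>R ((norm (u s))\<^sup>2 + (norm (u' s))\<^sup>2)"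
        by (auto simp: indicator_def add_increasing2)
    qed
    then show ?thesis by (simp add: set_lebesgue_integral_def)
  qed
  moreover have "state_norm u t = sqrt (H1sq (t - 1) t u u')"
    by (rule state_norm_eq[OF P(2,1) _ t(1)]) simp
  ultimately have "1 \<le> state_norm u t" by simp
  then show False using \<delta>(2)[OF sol small t(1)] by simp
qed

lemma unstable_char_root:
  assumes z: "z \<in> char_roots a b" "Re z > 0"
  shows "unstable a b"
proof (rule unstable_classical)
  let ?y = "\<lambda>t::real. exp (z * of_real t)"
  show "(?y has_vector_derivative z * ?y t) (at t)" for t
    by (auto intro!: derivative_eq_intros has_vector_derivative_real_field)
  show "continuous_on UNIV (\<lambda>t. z * ?y t)" by (intro continuous_intros)
  show "z * ?y t - z * ?y (t - 1) + of_real a * ?y t + of_real b * ?y (t - 1) = 0" for t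
  proof -
    have "?y t = exp z * ?y (t - 1)" by (simp add: algebra_simps flip: exp_add)
    then have "z * ?y t - z * ?y (t - 1) + of_real a * ?y t + of_real b * ?y (t - 1) = char_fun a b z * ?y (t - 1)"
      by (simp add: char_fun_def algebra_simps)
    then show ?thesis using z(1) by (simp add: char_roots_def)
  qed
  \<comment> \<open>With this \<open>t\<close> even the left end of the window satisfies
    \<open>Re z * s \<ge> \<bar>M\<bar>\<close>, and the exponential dominates
    \<open>1 + \<bar>M\<bar>\<close>.\<close>
  show "\<exists>t\<ge>0. \<forall>s\<in>{t - 1..t}. norm (?y s) \<ge> M" for M
  proof (intro exI[of _ "1 + \<bar>M\<bar> / Re z"] conjI ballI)
    show "0 \<le> 1 + \<bar>M\<bar> / Re z" using z(2) by simp
    fix s assume "s \<in> {1 + \<bar>M\<bar> / Re z - 1..1 + \<bar>M\<bar> / Re z}"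
    then have "\<bar>M\<bar> \<le> Re z * s" using z(2) by (simp add: field_simps)
    have "M \<le> 1 + \<bar>M\<bar>" by simp
    also have "\<dots> \<le> exp \<bar>M\<bar>" by (rule exp_ge_add_one_self)
    also have "\<dots> \<le> exp (Re z * s)" using \<open>\<bar>M\<bar> \<le> Re z * s\<close> by simp
    also have "\<dots> = norm (?y s)" by simp
    finally show "M \<le> norm (?y s)" .
  qed
qed

text \<open>The solution \<open>t\<close> belongs to the double root 0: growth is linear although
  every root is imaginary.\<close>

lemma unstable_0: "unstable 0 0"
proof (rule unstable_classical)
  show "(of_real has_vector_derivative (1::complex)) (at t)" for t
    using has_vector_derivative_of_real[OF DERIV_ident] by simp
  show "\<exists>t\<ge>0. \<forall>s\<in>{t - 1..t}. norm (complex_of_real s) \<ge> M" for M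
    by (intro exI[of _ "1 + \<bar>M\<bar>"]) auto
qed auto

lemma lyapunov_stable_of_le:
  assumes "a > 0" "a + b \<ge> 0" "b\<^sup>2 \<le> a\<^sup>2"
  shows "lyapunov_stable a b"
  unfolding lyapunov_stable_def
proof (intro allI impI)
  obtain C where C: "C \<ge> 0"
    "\<And>Y g t. ac_solution a b Y g \<Longrightarrow> t \<ge> 0 \<Longrightarrow> H1sq (t - 1) t Y g \<le> C * H1sq (-1) 0 Y g"
    using ac_solution_estimate[OF assms] by metis
  fix \<epsilon> :: real assume \<epsilon>: "\<epsilon> > 0"
  \<comment> \<open>The estimate is for squared norms, hence the square root; the added 1 covers
    \<open>C = 0\<close> and gives a strict inequality.\<close>
  define \<delta> where "\<delta> = \<epsilon> / (sqrt C + 1)"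
  have sC: "sqrt C + 1 > 0" using C(1) by (simp add: add_nonneg_pos)
  then have \<delta>: "\<delta> > 0" using \<epsilon> by (simp add: \<delta>_def)
  have "state_norm y t < \<epsilon>"
    if sol: "ndde_solution a b y0 y" and small: "H1_norm {-1<..<0} y0 < \<delta>" and t: "t \<ge> 0" for y0 y t
  proof -
    obtain Y g where Y: "ac_solution a b Y g" "H1_norm {-1<..<0} y0 = sqrt (H1sq (-1) 0 Y g)"
      "\<And>t. t \<ge> 0 \<Longrightarrow> state_norm y t = sqrt (H1sq (t - 1) t Y g)"
      using ndde_solution_representation[OF sol] by metis
    have "state_norm y t \<le> sqrt (C * H1sq (-1) 0 Y g)"
      using Y(3)[OF t] C(2)[OF Y(1) t] by simp
    also have "\<dots> = sqrt C * H1_norm {-1<..<0} y0" by (simp add: Y(2) real_sqrt_mult)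
    also have "\<dots> \<le> sqrt C * \<delta>" using C(1) small by (intro mult_left_mono) auto
    also have "\<dots> < (sqrt C + 1) * \<delta>" using \<delta> by simp
    also have "\<dots> = \<epsilon>" using sC by (simp add: \<delta>_def)
    finally show ?thesis .
  qed
  then show "\<exists>\<delta>>0. \<forall>y0 y. ndde_solution a b y0 y \<and> H1_norm {-1<..<0} y0 < \<delta> \<longrightarrow> (\<forall>t\<ge>0. state_norm y t < \<epsilon>)"
    using \<delta> by blast
qed

text \<open>Every solution decays, whatever the size of its datum, so the radius 1 of attraction is
  arbitrary.\<close>

lemma asymptotically_stable_gt:
  assumes a: "a > \<bar>b\<bar>"
  shows "asymptotically_stable a b"
  unfolding asymptotically_stable_def
proof (intro conjI exI[of _ 1] allI impI)
  show "lyapunov_stable a b"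
    using a abs_le_square_iff[of b a] by (intro lyapunov_stable_of_le) auto
  fix y0 y assume "ndde_solution a b y0 y \<and> H1_norm {-1<..<0} y0 < 1"
  then obtain Y g where Y: "ac_solution a b Y g"
    "\<And>t. t \<ge> 0 \<Longrightarrow> state_norm y t = sqrt (H1sq (t - 1) t Y g)"
    using ndde_solution_representation by metis
  have "((\<lambda>t. sqrt (H1sq (t - 1) t Y g)) \<longlongrightarrow> sqrt 0) at_top"
    by (intro tendsto_real_sqrt ac_solution_asymptotic[OF a Y(1)])
  moreover have "\<forall>\<^sub>F t in at_top. sqrt (H1sq (t - 1) t Y g) = state_norm y t"
    using eventually_ge_at_top[of 0] by eventually_elim (simp add: Y(2))
  ultimately show "(state_norm y \<longlongrightarrow> 0) at_top"
    by (simp add: tendsto_cong)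
qed simp

theorem theorem3:
  fixes a b :: real
  shows
    "(a > \<bar>b\<bar> \<longrightarrow>
        asymptotically_stable a b \<and> (\<forall>z\<in>char_roots a b. Re z < 0)) \<and>
     (b > \<bar>a\<bar> \<longrightarrow>
        unstable a b \<and> (\<forall>z\<in>char_roots a b. Re z > 0)) \<and>
     (b < - \<bar>a\<bar> \<longrightarrow>
        unstable a b \<and>
        (\<exists>w\<in>char_roots a b. Re w < 0 \<and> (\<forall>z\<in>char_roots a b - {w}. Re z > 0))) \<and>
     (- a > \<bar>b\<bar> \<longrightarrow>
        unstable a b \<and>
        (\<exists>w\<in>char_roots a b. Re w > 0 \<and> (\<forall>z\<in>char_roots a b - {w}. Re z < 0))) \<and>
     (a = \<bar>b\<bar> \<and> \<bar>b\<bar> \<noteq> 0 \<longrightarrow>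
        lyapunov_stable a b \<and>
        (b > 0 \<longrightarrow> (\<forall>z\<in>char_roots a b. Re z = 0)) \<and>
        (b < 0 \<longrightarrow> - complex_of_real a \<in> char_roots a b \<and> - a < 0 \<and>
           (\<forall>z\<in>char_roots a b - {- complex_of_real a}. Re z = 0))) \<and>
     (a = b \<and> b > 0 \<longrightarrow>
        lyapunov_stable a b \<and> (\<forall>z\<in>char_roots a b. Re z = 0)) \<and>
     (a = - b \<and> - b < 0 \<longrightarrow>
        unstable a b \<and>
        - complex_of_real a \<in> char_roots a b \<and> - a > 0 \<and>
        (\<forall>z\<in>char_roots a b - {- complex_of_real a}. Re z = 0)) \<and>
     (a = 0 \<and> b = 0 \<longrightarrow>
        unstable a b \<and>
        (\<forall>z\<in>char_roots a b. Re z = 0) \<and>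
        (\<forall>z\<in>char_roots a b - {0}. zorder (char_fun a b) z = 1) \<and>
        0 \<in> char_roots a b \<and> zorder (char_fun a b) 0 = 2)"
proof (intro conjI impI)
  show "asymptotically_stable a b" "\<forall>z\<in>char_roots a b. Re z < 0" if "a > \<bar>b\<bar>"
    using asymptotically_stable_gt[OF that] char_root_Re_neg[OF that] by auto
next
  assume ab: "b > \<bar>a\<bar>"
  show pos: "\<forall>z\<in>char_roots a b. Re z > 0"
  proof
    fix z assume "z \<in> char_roots a b"
    then show "Re z > 0"
      using char_root_Re_neg[OF ab, of "- z"] char_root_minus_iff[of z b a] by simp
  qed
  obtain z where "z \<in> char_roots a b" using char_root_nonreal[of a b] by metis
  then show "unstable a b" using pos unstable_char_root by blast
next
  assume ab: "b < - \<bar>a\<bar>"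
  then have ba: "- b > \<bar>a\<bar>" by simp
  obtain x :: real where x: "x > 0" "complex_of_real x \<in> char_roots b a" by (rule char_root_pos_real[OF ba])
  have w: "- complex_of_real x \<in> char_roots a b" using x(2) char_root_minus_iff[of "complex_of_real x" a b] by simp
  \<comment> \<open>Negation takes a further root with \<open>Re z \<le> 0\<close> to the closed
    right half-plane for the interchanged coefficients, where \<open>x\<close> is the only
    root.\<close>
  have pos: "Re z > 0" if z: "z \<in> char_roots a b" "z \<noteq> - complex_of_real x" for z
  proof (rule ccontr)
    assume "\<not> Re z > 0"
    then have "- z = complex_of_real x"
      using char_root_unique[OF ba, of "- z" "complex_of_real x"] z(1) char_root_minus_iff[of z b a] x by simp
    then show False using z(2) by (metis minus_minus)
  qed
  then show "\<exists>w\<in>char_roots a b. Re w < 0 \<and> (\<forall>z\<in>char_roots a b - {w}. Re z > 0)"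
    using w x(1) by (intro bexI[of _ "- complex_of_real x"]) auto
  \<comment> \<open>A nonreal root differs from the exceptional real one, so its real part is
    positive.\<close>
  obtain z where z: "z \<in> char_roots a b" "Im z > 0" using char_root_nonreal[of a b] by metis
  then have "z \<noteq> - complex_of_real x" by auto
  then show "unstable a b" using pos[OF z(1)] unstable_char_root[OF z(1)] by simp
next
  assume ab: "- a > \<bar>b\<bar>"
  obtain x :: real where x: "x > 0" "complex_of_real x \<in> char_roots a b" by (rule char_root_pos_real[OF ab])
  show "unstable a b" using unstable_char_root[OF x(2)] x(1) by simp
  have "Re z < 0" if z: "z \<in> char_roots a b" "z \<noteq> complex_of_real x" for z
  proof (rule ccontr)
    assume "\<not> Re z < 0"
    then have "z = complex_of_real x"
      using char_root_unique[OF ab z(1) _ x(2)] x(1) by simp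
    then show False using z(2) by simp
  qed
  then show "\<exists>w\<in>char_roots a b. Re w > 0 \<and> (\<forall>z\<in>char_roots a b - {w}. Re z < 0)"
    using x by (intro bexI[of _ "complex_of_real x"]) auto
next
  assume ab: "a = \<bar>b\<bar> \<and> \<bar>b\<bar> \<noteq> 0"
  then show "lyapunov_stable a b" by (intro lyapunov_stable_of_le) auto
  show "\<forall>z\<in>char_roots a b. Re z = 0" if "b > 0"
    using char_root_Re_eq_0[of b] ab that by auto
  assume b: "b < 0"
  then show "- complex_of_real a \<in> char_roots a b" "- a < 0"
      "\<forall>z\<in>char_roots a b - {- complex_of_real a}. Re z = 0"
    using ab char_fun_opposite[of a] by (auto simp: char_roots_def exp_eq_1_imp_Re add_eq_0_iff2)
next
  assume ab: "a = b \<and> b > 0"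
  then show "lyapunov_stable a b" "\<forall>z\<in>char_roots a b. Re z = 0"
    using char_root_Re_eq_0[of b] by (auto intro: lyapunov_stable_of_le)
next
  assume ab: "a = - b \<and> - b < 0"
  show w: "- complex_of_real a \<in> char_roots a b" "- a > 0" "\<forall>z\<in>char_roots a b - {- complex_of_real a}. Re z = 0"
    using ab char_fun_opposite[of a] by (auto simp: char_roots_def exp_eq_1_imp_Re add_eq_0_iff2)
  show "unstable a b" using unstable_char_root[OF w(1)] w(2) by simp
next
  assume ab: "a = 0 \<and> b = 0"
  then show "unstable a b" "\<forall>z\<in>char_roots a b. Re z = 0" "0 \<in> char_roots a b"
    "\<forall>z\<in>char_roots a b - {0}. zorder (char_fun a b) z = 1" "zorder (char_fun a b) 0 = 2"
    using unstable_0 zorder_char_fun_0 char_fun_opposite[of 0]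
    by (auto simp: char_roots_def exp_eq_1_imp_Re)
qed

end
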